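(* Let $R=k[t_1^{\pm1},\dots,t_n^{\pm1}]$ be a Laurent polynomial ring over a field $k$ of characteristic $0$. Let $C$ be an octonion $R$-algebra such that its norm $q_C$ is isometric to a Pfister quadratic form. Then all $R$-isotopes of $C$ are trivial.
   Context: An octonion algebra over $R$ is a unital (not necessarily associative) $R$-algebra $C$ whose underlying module is projective of constant rank 8, endowed with a regular multiplicative quadratic form $q_C$, its norm (regular: the polar form induces an isomorphism $C\to\mathrm{Hom}_R(C,R)$). An isotope of $C$ means a unital algebra isotopic to $C$, i.e. (up to isomorphism) an algebra $C^{a,b}$ with $a,b\in C$ invertible, where $C^{a,b}$ is the $R$-module $C$ with multiplication $x*y=(xa)(by)$ (products in $C$ on the right). An isotope is trivial if it is isomorphic to $C$ as an $R$-algebra. Here a Pfister quadratic form is a (3-fold) form $\langle\langle u,v,w\rangle\rangle=\langle 1,-u\rangle\otimes\langle 1,-v\rangle\otimes\langle 1,-w\rangle$ with $u,v,w\in R^*$. *)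

theory Defs
  imports "HOL-Algebra.Algebra" "HOL-Library.Poly_Mapping"
begin

section \<open>Laurent polynomial rings\<close>

text \<open>
  A finitely supported exponent \<open>m :: nat \<Rightarrow>\<^sub>0 int\<close> stands for the monomial
  \<open>\<Prod>i. t\<^sub>i ^ m\<^sub>i\<close>; the product of \<open>Poly_Mapping\<close> is the convolution product.
  The variables are \<open>t\<^sub>0, \<dots>, t\<^sub>n\<^sub>-\<^sub>1\<close>, and \<open>n = 0\<close> gives the field \<open>'k\<close> itself.
\<close>

type_synonym 'k laurent = "(nat \<Rightarrow>\<^sub>0 int) \<Rightarrow>\<^sub>0 'k"

definition laurent_ring :: "nat \<Rightarrow> 'k::field_char_0 laurent ring" where
  "laurent_ring n =
     \<lparr>carrier = {p. \<forall>m \<in> Poly_Mapping.keys p. Poly_Mapping.keys m \<subseteq> {..<n}},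
      monoid.mult = (*), one = 1, ring.zero = 0, ring.add = (+)\<rparr>"

lemma cring_laurent_ring: "cring (laurent_ring n :: 'k::field_char_0 laurent ring)"
proof -
  let ?C = "{p :: 'k laurent. \<forall>m \<in> Poly_Mapping.keys p. Poly_Mapping.keys m \<subseteq> {..<n}}"
  have add: "p + q \<in> ?C" if "p \<in> ?C" "q \<in> ?C" for p q
    using that Poly_Mapping.keys_add[of p q] by blast
  have uminus: "- p \<in> ?C" if "p \<in> ?C" for p
    using that by simp
  have mult: "p * q \<in> ?C" if pq: "p \<in> ?C" "q \<in> ?C" for p q
  proof -
    have "Poly_Mapping.keys m \<subseteq> {..<n}" if m: "m \<in> Poly_Mapping.keys (p * q)" for m
    proof -
      obtain a b where "m = a + b" "a \<in> Poly_Mapping.keys p" "b \<in> Poly_Mapping.keys q"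
        using m Poly_Mapping.keys_mult[of p q] by blast
      then show ?thesis
        using pq Poly_Mapping.keys_add[of a b] by blast
    qed
    then show ?thesis by simp
  qed
  have one: "1 \<in> ?C" and zero: "0 \<in> ?C"
    by auto
  show ?thesis
    unfolding laurent_ring_def
  proof (rule cringI)
    let ?R = "\<lparr>carrier = ?C, monoid.mult = (*), one = 1, ring.zero = 0, ring.add = (+)\<rparr>"
    show "abelian_group ?R"
    proof (rule abelian_groupI)
      fix p assume "p \<in> carrier ?R"
      then have "- p \<in> carrier ?R" "- p \<oplus>\<^bsub>?R\<^esub> p = \<zero>\<^bsub>?R\<^esub>"
        using uminus[of p] by auto
      then show "\<exists>q \<in> carrier ?R. q \<oplus>\<^bsub>?R\<^esub> p = \<zero>\<^bsub>?R\<^esub>" ..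
    qed (use add zero in \<open>simp_all del: mem_Collect_eq add: ac_simps\<close>)
    show "comm_monoid ?R"
      by (rule comm_monoidI) (use mult one in \<open>simp_all del: mem_Collect_eq add: ac_simps\<close>)
  qed (simp add: algebra_simps)
qed


section \<open>Projective modules of constant rank\<close>

definition module_homs ::
  "('r, 'w) ring_scheme \<Rightarrow> ('r, 'a, 'x) module_scheme \<Rightarrow> ('r, 'b, 'y) module_scheme \<Rightarrow> ('a \<Rightarrow> 'b) set"
where
  "module_homs R M N =
     {f \<in> carrier M \<rightarrow> carrier N.
        (\<forall>x \<in> carrier M. \<forall>y \<in> carrier M. f (x \<oplus>\<^bsub>M\<^esub> y) = f x \<oplus>\<^bsub>N\<^esub> f y) \<and>
        (\<forall>r \<in> carrier R. \<forall>x \<in> carrier M. f (r \<odot>\<^bsub>M\<^esub> x) = r \<odot>\<^bsub>N\<^esub> f x)}"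

definition module_isos ::
  "('r, 'w) ring_scheme \<Rightarrow> ('r, 'a, 'x) module_scheme \<Rightarrow> ('r, 'b, 'y) module_scheme \<Rightarrow> ('a \<Rightarrow> 'b) set"
where
  "module_isos R M N = {f \<in> module_homs R M N. bij_betw f (carrier M) (carrier N)}"

definition self_module :: "('r, 'w) ring_scheme \<Rightarrow> ('r, 'r) module" where
  "self_module R =
     \<lparr>carrier = carrier R, monoid.mult = monoid.mult R, one = one R, ring.zero = ring.zero R, ring.add = ring.add R,
      smult = monoid.mult R\<rparr>"

text \<open>The module \<open>R\<^sup>n\<close>; the (componentwise) product only fills the ring fields of the record.\<close>

definition free_module :: "('r, 'w) ring_scheme \<Rightarrow> nat \<Rightarrow> ('r, nat \<Rightarrow> 'r) module" where
  "free_module R n =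
     \<lparr>carrier = {..<n} \<rightarrow>\<^sub>E carrier R,
      monoid.mult = (\<lambda>x y. \<lambda>i\<in>{..<n}. x i \<otimes>\<^bsub>R\<^esub> y i),
      one = (\<lambda>i\<in>{..<n}. \<one>\<^bsub>R\<^esub>),
      ring.zero = (\<lambda>i\<in>{..<n}. \<zero>\<^bsub>R\<^esub>),
      ring.add = (\<lambda>x y. \<lambda>i\<in>{..<n}. x i \<oplus>\<^bsub>R\<^esub> y i),
      smult = (\<lambda>r x. \<lambda>i\<in>{..<n}. r \<otimes>\<^bsub>R\<^esub> x i)\<rparr>"

definition fg_projective :: "('r, 'w) ring_scheme \<Rightarrow> ('r, 'a, 'x) module_scheme \<Rightarrow> bool" where
  "fg_projective R M \<longleftrightarrow>
     module R M \<and>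
     (\<exists>m. \<exists>i \<in> module_homs R M (free_module R m). \<exists>p \<in> module_homs R (free_module R m) M.
        \<forall>x \<in> carrier M. p (i x) = x)"

definition frac_rel ::
  "'r set \<Rightarrow> ('r, 'a, 'x) module_scheme \<Rightarrow> (('a \<times> 'r) \<times> ('a \<times> 'r)) set"
where
  "frac_rel S M =
     {((x, s), (y, t)). x \<in> carrier M \<and> y \<in> carrier M \<and> s \<in> S \<and> t \<in> S \<and>
        (\<exists>u \<in> S. u \<odot>\<^bsub>M\<^esub> (t \<odot>\<^bsub>M\<^esub> x) = u \<odot>\<^bsub>M\<^esub> (s \<odot>\<^bsub>M\<^esub> y))}"

definition frac :: "'r set \<Rightarrow> ('r, 'a, 'x) module_scheme \<Rightarrow> 'a \<Rightarrow> 'r \<Rightarrow> ('a \<times> 'r) set" where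
  "frac S M x s = frac_rel S M `` {(x, s)}"

text \<open>
  The localization \<open>S\<^sup>-\<^sup>1M\<close>, with scalars in \<open>S\<^sup>-\<^sup>1R\<close>, which is the case \<open>M = self_module R\<close>.
  The product of fractions is meaningful only if \<open>M\<close> is an algebra, in particular for \<open>M = self_module R\<close>.
\<close>

definition localization ::
  "('r, 'w) ring_scheme \<Rightarrow> 'r set \<Rightarrow> ('r, 'a, 'x) module_scheme \<Rightarrow> (('r \<times> 'r) set, ('a \<times> 'r) set) module"
where
  "localization R S M =
     \<lparr>carrier = (carrier M \<times> S) // frac_rel S M,
      monoid.mult = (\<lambda>F G. \<Union>{frac S M (x \<otimes>\<^bsub>M\<^esub> y) (s \<otimes>\<^bsub>R\<^esub> t) | x s y t.
                             (x, s) \<in> F \<and> (y, t) \<in> G}),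
      one = frac S M \<one>\<^bsub>M\<^esub> \<one>\<^bsub>R\<^esub>,
      ring.zero = frac S M \<zero>\<^bsub>M\<^esub> \<one>\<^bsub>R\<^esub>,
      ring.add = (\<lambda>F G. \<Union>{frac S M (t \<odot>\<^bsub>M\<^esub> x \<oplus>\<^bsub>M\<^esub> s \<odot>\<^bsub>M\<^esub> y) (s \<otimes>\<^bsub>R\<^esub> t) | x s y t.
                           (x, s) \<in> F \<and> (y, t) \<in> G}),
      smult = (\<lambda>F G. \<Union>{frac S M (r \<odot>\<^bsub>M\<^esub> x) (s \<otimes>\<^bsub>R\<^esub> t) | r s x t.
                        (r, s) \<in> F \<and> (x, t) \<in> G})\<rparr>"

definition has_constant_rank :: "('r, 'w) ring_scheme \<Rightarrow> ('r, 'a, 'x) module_scheme \<Rightarrow> nat \<Rightarrow> bool" where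
  "has_constant_rank R M n \<longleftrightarrow>
     (\<forall>P. primeideal P R \<longrightarrow>
        (let S = carrier R - P; R\<^sub>P = localization R S (self_module R); M\<^sub>P = localization R S M
         in module_isos R\<^sub>P (free_module R\<^sub>P n) M\<^sub>P \<noteq> {}))"


section \<open>Quadratic forms\<close>

definition polar_form ::
  "('r, 'w) ring_scheme \<Rightarrow> ('r, 'a, 'x) module_scheme \<Rightarrow> ('a \<Rightarrow> 'r) \<Rightarrow> 'a \<Rightarrow> 'a \<Rightarrow> 'r"
where
  "polar_form R M q x y = q (x \<oplus>\<^bsub>M\<^esub> y) \<ominus>\<^bsub>R\<^esub> q x \<ominus>\<^bsub>R\<^esub> q y"

definition quadratic_form ::
  "('r, 'w) ring_scheme \<Rightarrow> ('r, 'a, 'x) module_scheme \<Rightarrow> ('a \<Rightarrow> 'r) \<Rightarrow> bool"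
where
  "quadratic_form R M q \<longleftrightarrow>
     q \<in> carrier M \<rightarrow> carrier R \<and>
     (\<forall>r \<in> carrier R. \<forall>x \<in> carrier M. q (r \<odot>\<^bsub>M\<^esub> x) = (r \<otimes>\<^bsub>R\<^esub> r) \<otimes>\<^bsub>R\<^esub> q x) \<and>
     (\<forall>x \<in> carrier M. polar_form R M q x \<in> module_homs R M (self_module R)) \<and>
     (\<forall>y \<in> carrier M. (\<lambda>x. polar_form R M q x y) \<in> module_homs R M (self_module R))"

text \<open>
  Elements of \<open>Hom\<^sub>R(M, R)\<close> are represented by functions that are \<open>undefined\<close> outside \<open>carrier M\<close>,
  so that linear forms agreeing on \<open>carrier M\<close> are equal.  Linearity of \<open>x \<mapsto> b(x, _)\<close> is part of
  \<open>quadratic_form\<close>, so the polar form is an isomorphism iff this map is bijective.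
\<close>

definition regular_form ::
  "('r, 'w) ring_scheme \<Rightarrow> ('r, 'a, 'x) module_scheme \<Rightarrow> ('a \<Rightarrow> 'r) \<Rightarrow> bool"
where
  "regular_form R M q \<longleftrightarrow>
     bij_betw (\<lambda>x. restrict (polar_form R M q x) (carrier M))
       (carrier M) (module_homs R M (self_module R) \<inter> extensional (carrier M))"

definition isometric ::
  "('r, 'w) ring_scheme \<Rightarrow> ('r, 'a, 'x) module_scheme \<Rightarrow> ('a \<Rightarrow> 'r) \<Rightarrow>
   ('r, 'b, 'y) module_scheme \<Rightarrow> ('b \<Rightarrow> 'r) \<Rightarrow> bool"
where
  "isometric R M q N q' \<longleftrightarrow> (\<exists>f \<in> module_isos R M N. \<forall>x \<in> carrier M. q' (f x) = q x)"

text \<open>\<open>diagonal_form R [a\<^sub>1, \<dots>, a\<^sub>n]\<close> is the quadratic form \<open>a\<^sub>1 x\<^sub>1\<^sup>2 + \<dots> + a\<^sub>n x\<^sub>n\<^sup>2\<close> on \<open>R\<^sup>n\<close>.\<close>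

definition diagonal_form :: "('r, 'w) ring_scheme \<Rightarrow> 'r list \<Rightarrow> (nat \<Rightarrow> 'r) \<Rightarrow> 'r" where
  "diagonal_form R as x = (\<Oplus>\<^bsub>R\<^esub>i\<in>{..<length as}. as ! i \<otimes>\<^bsub>R\<^esub> (x i \<otimes>\<^bsub>R\<^esub> x i))"

text \<open>Diagonal coefficients of a tensor product, from \<open>\<langle>a\<rangle> \<otimes> \<langle>b\<rangle> = \<langle>ab\<rangle>\<close>.\<close>

definition tensor_diagonal :: "('r, 'w) ring_scheme \<Rightarrow> 'r list \<Rightarrow> 'r list \<Rightarrow> 'r list" where
  "tensor_diagonal R as bs = concat (map (\<lambda>a. map (\<lambda>b. a \<otimes>\<^bsub>R\<^esub> b) bs) as)"

definition pfister_form :: "('r, 'w) ring_scheme \<Rightarrow> 'r \<Rightarrow> 'r \<Rightarrow> 'r \<Rightarrow> (nat \<Rightarrow> 'r) \<Rightarrow> 'r" where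
  "pfister_form R u v w =
     diagonal_form R
       (tensor_diagonal R
         (tensor_diagonal R [\<one>\<^bsub>R\<^esub>, \<ominus>\<^bsub>R\<^esub> u] [\<one>\<^bsub>R\<^esub>, \<ominus>\<^bsub>R\<^esub> v]) [\<one>\<^bsub>R\<^esub>, \<ominus>\<^bsub>R\<^esub> w])"

definition isometric_to_pfister ::
  "('r, 'w) ring_scheme \<Rightarrow> ('r, 'a, 'x) module_scheme \<Rightarrow> ('a \<Rightarrow> 'r) \<Rightarrow> bool"
where
  "isometric_to_pfister R M q \<longleftrightarrow>
     (\<exists>u \<in> Units R. \<exists>v \<in> Units R. \<exists>w \<in> Units R.
        isometric R M q (free_module R 8) (pfister_form R u v w))"


section \<open>Octonion algebras and isotopes\<close>

text \<open>Unital, not necessarily associative algebras.\<close>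

locale unital_algebra = module R A for R (structure) and A (structure) +
  assumes mult_closed:
      "\<lbrakk>x \<in> carrier A; y \<in> carrier A\<rbrakk> \<Longrightarrow> x \<otimes>\<^bsub>A\<^esub> y \<in> carrier A"
    and mult_add_left:
      "\<lbrakk>x \<in> carrier A; y \<in> carrier A; z \<in> carrier A\<rbrakk>
        \<Longrightarrow> (x \<oplus>\<^bsub>A\<^esub> y) \<otimes>\<^bsub>A\<^esub> z = x \<otimes>\<^bsub>A\<^esub> z \<oplus>\<^bsub>A\<^esub> y \<otimes>\<^bsub>A\<^esub> z"
    and mult_add_right:
      "\<lbrakk>x \<in> carrier A; y \<in> carrier A; z \<in> carrier A\<rbrakk>
        \<Longrightarrow> x \<otimes>\<^bsub>A\<^esub> (y \<oplus>\<^bsub>A\<^esub> z) = x \<otimes>\<^bsub>A\<^esub> y \<oplus>\<^bsub>A\<^esub> x \<otimes>\<^bsub>A\<^esub> z"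
    and mult_smult_left:
      "\<lbrakk>r \<in> carrier R; x \<in> carrier A; y \<in> carrier A\<rbrakk>
        \<Longrightarrow> (r \<odot>\<^bsub>A\<^esub> x) \<otimes>\<^bsub>A\<^esub> y = r \<odot>\<^bsub>A\<^esub> (x \<otimes>\<^bsub>A\<^esub> y)"
    and mult_smult_right:
      "\<lbrakk>r \<in> carrier R; x \<in> carrier A; y \<in> carrier A\<rbrakk>
        \<Longrightarrow> x \<otimes>\<^bsub>A\<^esub> (r \<odot>\<^bsub>A\<^esub> y) = r \<odot>\<^bsub>A\<^esub> (x \<otimes>\<^bsub>A\<^esub> y)"
    and unit_closed: "\<one>\<^bsub>A\<^esub> \<in> carrier A"
    and unit_left: "x \<in> carrier A \<Longrightarrow> \<one>\<^bsub>A\<^esub> \<otimes>\<^bsub>A\<^esub> x = x"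
    and unit_right: "x \<in> carrier A \<Longrightarrow> x \<otimes>\<^bsub>A\<^esub> \<one>\<^bsub>A\<^esub> = x"

definition algebra_isomorphic ::
  "('r, 'w) ring_scheme \<Rightarrow> ('r, 'a, 'x) module_scheme \<Rightarrow> ('r, 'b, 'y) module_scheme \<Rightarrow> bool"
where
  "algebra_isomorphic R A B \<longleftrightarrow> ring_iso A B \<inter> module_isos R A B \<noteq> {}"

definition octonion_algebra ::
  "('r, 'w) ring_scheme \<Rightarrow> ('r, 'a, 'x) module_scheme \<Rightarrow> ('a \<Rightarrow> 'r) \<Rightarrow> bool"
where
  "octonion_algebra R C q \<longleftrightarrow>
     unital_algebra R C \<and> fg_projective R C \<and> has_constant_rank R C 8 \<and>
     quadratic_form R C q \<and> regular_form R C q \<and>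
     (\<forall>x \<in> carrier C. \<forall>y \<in> carrier C. q (x \<otimes>\<^bsub>C\<^esub> y) = q x \<otimes>\<^bsub>R\<^esub> q y)"

text \<open>
  The algebra \<open>C\<^sup>a\<^sup>,\<^sup>b\<close>.  Its unit differs from that of \<open>C\<close> in general, so the \<open>one\<close> field
  is set to the two-sided unit of the new product.
\<close>

definition principal_isotope ::
  "('r, 'c, 'x) module_scheme \<Rightarrow> 'c \<Rightarrow> 'c \<Rightarrow> ('r, 'c, 'x) module_scheme"
where
  "principal_isotope C a b =
     (let m = (\<lambda>x y. (x \<otimes>\<^bsub>C\<^esub> a) \<otimes>\<^bsub>C\<^esub> (b \<otimes>\<^bsub>C\<^esub> y)) in
      C\<lparr>monoid.mult := m, one := (THE e. e \<in> carrier C \<and> (\<forall>x \<in> carrier C. m e x = x \<and> m x e = x))\<rparr>)"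

text \<open>\<open>Units C\<close> is, by definition, the set of elements with a two-sided inverse; it needs no associativity.\<close>

definition isotope ::
  "('r, 'w) ring_scheme \<Rightarrow> ('r, 'c, 'x) module_scheme \<Rightarrow> ('r, 'd, 'y) module_scheme \<Rightarrow> bool"
where
  "isotope R C B \<longleftrightarrow>
     unital_algebra R B \<and>
     (\<exists>a \<in> Units C. \<exists>b \<in> Units C. algebra_isomorphic R B (principal_isotope C a b))"

end

theory Submission
  imports Defs "HOL-Analysis.Cartesian_Space" "HOL-Computational_Algebra.Polynomial_Factorial"
begin

text \<open>
  The coefficients of the Pfister form are units of the Laurent polynomial ring, hence monomials, and
  the norm of an isotope \<open>C\<^sup>a\<^sup>,\<^sup>c\<close> is \<open>q(a) q(c) q\<close>.  A composition algebra is determined by a Cayley triple,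
  so it suffices to match the norms of Cayley triples of \<open>C\<close> and of the isotope.

  If the homogeneous parts of the norm are anisotropic over \<open>k\<close>, then the vectors of unit norm are
  homogeneous, and reflections in them move the image of a Cayley triple under an isometry of
  \<open>C\<close> with its isotope to a Cayley triple.  Otherwise the norm is hyperbolic.  The orthogonal complement of a
  hyperbolic plane containing the unit then makes \<open>C\<close> a Clifford module with a vacuum of rank one.
  Since unimodular rows over Laurent polynomial rings can be completed (Quillen--Suslin),
  this vacuum yields a Cayley triple with norms \<open>-1, 1, 1\<close>; the same holds for the isotope.

  These arguments need no bound on the number of variables, so they are carried out with infinitely many;
  setting the exponents of the surplus variables to zero brings the isomorphism back to \<open>R\<close>.
\<close>

section \<open>Unimodular rows over polynomial rings\<close>

text \<open>Over a general ring an octonion algebra is not determined by its norm, so an isometry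
  between the norms of \<open>C\<close> and of the isotope is not enough; both branches produce
  actual Cayley triples. In the hyperbolic branch freeness is the obstacle. The vacuum is only known
  to have rank one; the norm puts on it a symmetric pairing whose values generate the unit ideal,
  and writing its Gram matrix as \<open>\<epsilon> * s i * s j\<close> exhibits a generator, without
  unique factorization. Rows are completed twice: for the coordinates of \<open>1\<close> in a
  hyperbolic basis, and for those of the idempotent \<open>e\<close> in one half of the algebra.

  Infinitely many variables also remove the induction on their number: the ring is a Laurent
  polynomial ring in one variable over a copy of itself, so one type serves for coefficients and for
  polynomials. For a general weighting of the variables both extreme coefficients of a given element
  are single monomials. The unit at the top makes it monic, as Suslin's method requires; the unit at
  the bottom survives evaluation at zero, after which the row is trivial.\<close>

definition vec_equiv :: "'a::comm_ring_1^'n \<Rightarrow> 'a^'n \<Rightarrow> bool" where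
  "vec_equiv f g \<longleftrightarrow> (\<exists>M N. M ** N = mat 1 \<and> N ** M = mat 1 \<and> M *v f = g)"

definition unimodular :: "'a::comm_ring_1^'n \<Rightarrow> bool" where
  "unimodular f \<longleftrightarrow> (\<exists>g. (\<Sum>i\<in>UNIV. g $ i * f $ i) = 1)"

lemma vec_equiv_refl: "vec_equiv f f"
  unfolding vec_equiv_def by (intro exI[of _ "mat 1"]) simp

lemma vec_equiv_sym: "vec_equiv f g \<Longrightarrow> vec_equiv g f"
  unfolding vec_equiv_def by (metis matrix_vector_mul_assoc matrix_vector_mul_lid)

lemma vec_equiv_trans [trans]:
  assumes "vec_equiv f g" "vec_equiv g h"
  shows "vec_equiv f h"
proof -
  obtain M N M' N' where 1: "M ** N = mat 1" "N ** M = mat 1" "M *v f = g"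
    and 2: "M' ** N' = mat 1" "N' ** M' = mat 1" "M' *v g = h"
    using assms unfolding vec_equiv_def by blast
  have "(M' ** M) ** (N ** N') = M' ** (M ** N) ** N'"
    by (simp add: matrix_mul_assoc)
  moreover have "(N ** N') ** (M' ** M) = N ** (N' ** M') ** M"
    by (simp add: matrix_mul_assoc)
  moreover have "(M' ** M) *v f = h"
    using 1 2 by (simp flip: matrix_vector_mul_assoc)
  ultimately show ?thesis
    using 1 2 unfolding vec_equiv_def by (metis matrix_mul_rid)
qed

lemma linear_fun_matrix:
  fixes T :: "'a::comm_ring_1^'n \<Rightarrow> 'a^'n"
  assumes add: "\<And>x y. T (x + y) = T x + T y" and scale: "\<And>c x. T (c *s x) = c *s T x"
  shows "(\<chi> i j. T (axis j 1) $ i) *v x = T x"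
proof -
  have zero: "T 0 = 0"
    using scale[of 0 0] by simp
  have "T (\<Sum>j\<in>S. x $ j *s axis j 1) = (\<Sum>j\<in>S. x $ j *s T (axis j 1))" if "finite S" for S
    using that by induction (simp_all add: zero add scale)
  from this[of UNIV] have "T x = (\<Sum>j\<in>UNIV. x $ j *s T (axis j 1))"
    by (simp add: basis_expansion)
  then show ?thesis
    by (simp add: matrix_vector_mult_def vec_eq_iff mult.commute)
qed

text \<open>Equivalences are given below as pairs of mutually inverse linear maps; this turns such a
  pair into invertible matrices once and for all.\<close>

lemma vec_equivI:
  fixes T :: "'a::comm_ring_1^'n \<Rightarrow> 'a^'n"
  assumes "\<And>x y. T (x + y) = T x + T y" "\<And>c x. T (c *s x) = c *s T x"
    and "\<And>x y. S (x + y) = S x + S y" "\<And>c x. S (c *s x) = c *s S x"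
    and "\<And>x. T (S x) = x" "\<And>x. S (T x) = x"
  shows "vec_equiv f (T f)"
proof -
  let ?M = "\<chi> i j. T (axis j 1) $ i" and ?N = "\<chi> i j. S (axis j 1) $ i"
  have MN: "?M *v x = T x" "?N *v x = S x" for x
    using linear_fun_matrix[of T] linear_fun_matrix[of S] assms by auto
  have "?M ** ?N = mat 1" "?N ** ?M = mat 1"
    by (subst matrix_eq, simp only: MN assms matrix_vector_mul_lid simp_thms
        flip: matrix_vector_mul_assoc)+
  then show ?thesis
    unfolding vec_equiv_def using MN by blast
qed

lemma vec_equiv_shear:
  fixes f :: "'a::comm_ring_1^'n"
  shows "vec_equiv f (\<chi> j. if j = i then f $ i else f $ j + c j * f $ i)"
proof -
  let ?T = "\<lambda>c f. (\<chi> j. if j = i then f $ i else f $ j + c j * f $ i) :: 'a^'n"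
  show ?thesis
    by (rule vec_equivI[of "?T c" "?T (\<lambda>j. - c j)"])
      (simp_all add: vec_eq_iff algebra_simps)
qed

lemma vec_equiv_diag:
  fixes f :: "'a::comm_ring_1^'n"
  assumes "\<And>j. u j * v j = 1"
  shows "vec_equiv f (\<chi> j. u j * f $ j)"
proof -
  let ?T = "\<lambda>u f. (\<chi> j. u j * f $ j) :: 'a^'n"
  have *: "v j * (u j * x) = x" "u j * (v j * x) = x" for j x
  proof -
    have "v j * (u j * x) = (u j * v j) * x" "u j * (v j * x) = (u j * v j) * x"
      by (simp_all only: mult_ac)
    then show "v j * (u j * x) = x" "u j * (v j * x) = x"
      unfolding assms by simp_all
  qed
  have "u j * (c * x) = c * (u j * x)" "v j * (c * x) = c * (v j * x)" for j c x
    by (simp_all only: mult.left_commute)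
  then show ?thesis
    by (intro vec_equivI[of "?T u" "?T v"]) (simp_all add: vec_eq_iff distrib_left *)
qed

text \<open>Both one-sided inverse relations are hypotheses because they arrive in this form, from
  \<open>suslin_block_inverse\<close> applied a second time with the two evaluation points
  exchanged.\<close>

lemma vec_equiv_block:
  fixes f :: "'a::comm_ring_1^'n"
  assumes "i0 \<noteq> i1"
    and inv: "a * a' + b * c' = 1" "a * b' + b * d' = 0" "c * a' + d * c' = 0" "c * b' + d * d' = 1"
      "a' * a + b' * c = 1" "a' * b + b' * d = 0" "c' * a + d' * c = 0" "c' * b + d' * d = 1"
  shows "vec_equiv f (\<chi> j. if j = i0 then a * f $ i0 + b * f $ i1
    else if j = i1 then c * f $ i0 + d * f $ i1 else f $ j)"
proof -
  let ?T = "\<lambda>a b c d f. (\<chi> j. if j = i0 then a * f $ i0 + b * f $ i1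
    else if j = i1 then c * f $ i0 + d * f $ i1 else f $ j) :: 'a^'n"
  have reassoc: "p * (r * x + s * y) + q * (t * x + u * y) = (p * r + q * t) * x + (p * s + q * u) * y"
    for p q r s t u x y :: 'a
    by (simp add: algebra_simps)
  have *: "a * (a' * x + b' * y) + b * (c' * x + d' * y) = x"
     "c * (a' * x + b' * y) + d * (c' * x + d' * y) = y"
     "a' * (a * x + b * y) + b' * (c * x + d * y) = x"
     "c' * (a * x + b * y) + d' * (c * x + d * y) = y" for x y
    unfolding reassoc inv by simp_all
  have scale: "p * (k * x) + q * (k * y) = k * (p * x + q * y)"
    and add: "p * (x + x') + q * (y + y') = p * x + q * y + (p * x' + q * y')" for p q k x y x' y' :: 'a
    by (simp_all add: algebra_simps)
  have inverse: "?T a b c d (?T a' b' c' d' v) = v" "?T a' b' c' d' (?T a b c d v) = v" for v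
    using assms(1) by (simp_all add: vec_eq_iff * del: distrib_left)
  show ?thesis
    by (rule vec_equivI[of "?T a b c d" "?T a' b' c' d'"])
      (simp_all only: inverse, simp_all add: vec_eq_iff scale add)
qed

lemma unimodular_vec_equiv:
  assumes "vec_equiv f g" "unimodular f"
  shows "unimodular g"
proof -
  obtain M N where N: "N *v g = f"
    using assms(1) vec_equiv_sym unfolding vec_equiv_def by metis
  obtain h where h: "(\<Sum>i\<in>UNIV. h $ i * f $ i) = 1"
    using assms(2) unfolding unimodular_def by blast
  have "(\<Sum>i\<in>UNIV. h $ i * f $ i) = (\<Sum>i\<in>UNIV. \<Sum>j\<in>UNIV. h $ i * N $ i $ j * g $ j)"
    by (simp add: matrix_vector_mult_def sum_distrib_left mult.assoc flip: N)
  also have "\<dots> = (\<Sum>j\<in>UNIV. (\<Sum>i\<in>UNIV. h $ i * N $ i $ j) * g $ j)"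
    by (subst sum.swap) (simp add: sum_distrib_right)
  finally show ?thesis
    unfolding unimodular_def using h by (intro exI[of _ "\<chi> j. \<Sum>i\<in>UNIV. h $ i * N $ i $ j"]) simp
qed

section \<open>Ideals, division modulo an ideal, and Nakayama's lemma\<close>

definition ring_ideal :: "'a::comm_ring_1 set \<Rightarrow> bool" where
  "ring_ideal I \<longleftrightarrow> 0 \<in> I \<and> (\<forall>x\<in>I. \<forall>y\<in>I. x + y \<in> I) \<and> (\<forall>a. \<forall>x\<in>I. a * x \<in> I)"

lemma ring_idealD:
  assumes "ring_ideal I"
  shows "0 \<in> I" "x \<in> I \<Longrightarrow> y \<in> I \<Longrightarrow> x + y \<in> I" "x \<in> I \<Longrightarrow> a * x \<in> I" "x \<in> I \<Longrightarrow> x * a \<in> I"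
    "x \<in> I \<Longrightarrow> - x \<in> I" "x \<in> I \<Longrightarrow> y \<in> I \<Longrightarrow> x - y \<in> I"
proof -
  show neg: "- x \<in> I" if "x \<in> I" for x
    using that assms unfolding ring_ideal_def by (metis mult_minus1)
  show "x - y \<in> I" if "x \<in> I" "y \<in> I"
    using that assms neg[of y] unfolding ring_ideal_def by (metis add_uminus_conv_diff)
qed (use assms in \<open>auto simp: ring_ideal_def mult.commute[of x]\<close>)

lemma ring_ideal_sum:
  assumes "ring_ideal I" "\<And>i. i \<in> S \<Longrightarrow> f i \<in> I"
  shows "sum f S \<in> I"
  using assms(2) by (induction S rule: infinite_finite_induct) (auto intro: ring_idealD[OF assms(1)])

text \<open>Zorn's lemma. Maximality is recorded as the existence of inverses modulo
  \<open>m\<close>, so that residue fields are handled through representatives and no quotient ring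
  is formed.\<close>

lemma maximal_ideal_exists:
  fixes J :: "'a::comm_ring_1 set"
  assumes J: "ring_ideal J" "1 \<notin> J"
  obtains m where "ring_ideal m" "J \<subseteq> m" "1 \<notin> m" "\<And>a. a \<notin> m \<Longrightarrow> \<exists>u. 1 - a * u \<in> m"
proof -
  define P where "P = {K. ring_ideal K \<and> J \<subseteq> K \<and> 1 \<notin> K}"
  have "\<exists>m\<in>P. \<forall>K\<in>P. m \<subseteq> K \<longrightarrow> K = m"
  proof (rule subset_Zorn_nonempty)
    show "P \<noteq> {}"
      using J unfolding P_def by blast
    fix \<C> assume \<C>: "\<C> \<noteq> {}" "subset.chain P \<C>"
    have sub: "\<C> \<subseteq> P" and lin: "\<And>K K'. K \<in> \<C> \<Longrightarrow> K' \<in> \<C> \<Longrightarrow> K \<subseteq> K' \<or> K' \<subseteq> K"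
      using \<C>(2) unfolding subset.chain_def by auto
    have id: "ring_ideal K" if "K \<in> \<C>" for K
      using sub that unfolding P_def by auto
    have "ring_ideal (\<Union>\<C>)"
      unfolding ring_ideal_def
    proof (intro conjI ballI allI)
      show "0 \<in> \<Union>\<C>"
        using \<C>(1) id ring_idealD(1) by blast
      fix x assume x: "x \<in> \<Union>\<C>"
      show "a * x \<in> \<Union>\<C>" for a
        using x id ring_idealD(3) by blast
      fix y assume y: "y \<in> \<Union>\<C>"
      obtain K K' where "K \<in> \<C>" "x \<in> K" "K' \<in> \<C>" "y \<in> K'"
        using x y by blast
      then show "x + y \<in> \<Union>\<C>"
        using lin[of K K'] id ring_idealD(2) by blast
    qed
    then show "\<Union>\<C> \<in> P"
      using sub \<C>(1) unfolding P_def by blast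
  qed
  then obtain m where m: "m \<in> P" and max: "\<And>K. K \<in> P \<Longrightarrow> m \<subseteq> K \<Longrightarrow> K = m"
    by blast
  have I: "ring_ideal m" and Jm: "J \<subseteq> m" "1 \<notin> m"
    using m unfolding P_def by auto
  have "\<exists>u. 1 - a * u \<in> m" if a: "a \<notin> m" for a
  proof -
    define K where "K = {a * u + y | u y. y \<in> m}"
    have "ring_ideal K"
      unfolding ring_ideal_def
    proof (intro conjI ballI allI)
      show "0 \<in> K"
        using ring_idealD(1)[OF I] unfolding K_def by (force intro: exI[of _ 0])
      fix x assume "x \<in> K"
      then obtain u y where x: "x = a * u + y" "y \<in> m"
        unfolding K_def by blast
      show "b * x \<in> K" for b
      proof -
        have "b * x = a * (b * u) + b * y"
          using x by (simp add: algebra_simps)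
        then show ?thesis
          unfolding K_def using ring_idealD(3)[OF I x(2), of b] by blast
      qed
      fix x' assume "x' \<in> K"
      then obtain u' y' where x': "x' = a * u' + y'" "y' \<in> m"
        unfolding K_def by blast
      have "x + x' = a * (u + u') + (y + y')"
        using x x' by (simp add: algebra_simps)
      then show "x + x' \<in> K"
        unfolding K_def using ring_idealD(2)[OF I x(2) x'(2)] by blast
    qed
    moreover have "y \<in> K" if "y \<in> m" for y
      using that unfolding K_def by (force intro: exI[of _ 0])
    moreover have "a \<in> K"
      using ring_idealD(1)[OF I] unfolding K_def by (force intro: exI[of _ 1])
    ultimately have "1 \<in> K"
      using max[of K] a Jm unfolding P_def by blast
    then obtain u y where uy: "1 = a * u + y" "y \<in> m"
      unfolding K_def by blast
    have "1 - a * u = y"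
      using uy(1) by (simp add: algebra_simps)
    then show ?thesis
      using uy(2) by blast
  qed
  then show ?thesis
    using that I Jm by blast
qed

text \<open>Division with remainder over the residue ring of \<open>I\<close>, where
  \<open>h\<close> has degree \<open>n\<close> and an invertible leading coefficient, carried out on
  representatives.\<close>

lemma poly_division_mod_ideal:
  fixes p h :: "'a::comm_ring_1 poly"
  assumes I: "ring_ideal I" and u: "1 - coeff h n * u \<in> I" and h: "\<And>i. i > n \<Longrightarrow> coeff h i \<in> I"
  shows "\<exists>q. \<forall>i\<ge>n. coeff (p - q * h) i \<in> I"
proof -
  have "\<exists>q. \<forall>i\<ge>n. coeff (p - q * h) i \<in> I" if "\<forall>i\<ge>n + N. coeff p i \<in> I" for N p
    using that
  proof (induction N arbitrary: p)
    case 0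
    then show ?case
      by (intro exI[of _ 0]) simp
  next
    case (Suc N)
    define q where "q = monom (coeff p (n + N) * u) N"
    have "coeff (p - q * h) i \<in> I" if i: "i \<ge> n + N" for i
    proof (cases "i = n + N")
      case True
      have "coeff (p - q * h) i = coeff p i * (1 - coeff h n * u)"
        unfolding q_def using True by (simp add: coeff_monom_mult right_diff_distrib mult.assoc mult.commute[of u])
      then show ?thesis
        using ring_idealD(3)[OF I u] by simp
    next
      case False
      then have "coeff p i \<in> I" "coeff h (i - N) \<in> I"
        using i Suc.prems h by auto
      then show ?thesis
        unfolding q_def using i by (auto simp: coeff_monom_mult intro: ring_idealD[OF I])
    qed
    then obtain q' where "\<forall>i\<ge>n. coeff (p - q * h - q' * h) i \<in> I"
      using Suc.IH[of "p - q * h"] by blast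
    then show ?case
      by (intro exI[of _ "q + q'"]) (simp add: algebra_simps)
  qed
  from this[of "Suc (degree p)" p] show ?thesis
    using ring_idealD(1)[OF I] by (simp add: coeff_eq_0)
qed

text \<open>Every division step multiplies \<open>f\<close> by a monomial whose coefficient is taken
  from the current polynomial, so it never leaves \<open>I\<close>.\<close>

lemma monic_remainder_in_ideal:
  fixes p f :: "'a::comm_ring_1 poly"
  assumes I: "ring_ideal I" and monic: "lead_coeff f = 1" and p: "\<And>i. coeff p i \<in> I"
  obtains q where "\<And>i. coeff (p - q * f) i \<in> I" "\<And>i. i \<ge> degree f \<Longrightarrow> coeff (p - q * f) i = 0"
proof -
  let ?d = "degree f"
  have "\<exists>q. (\<forall>i. coeff (p - q * f) i \<in> I) \<and> (\<forall>i\<ge>?d. coeff (p - q * f) i = 0)"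
    if "\<forall>i. coeff p i \<in> I" "\<forall>i\<ge>?d + N. coeff p i = 0" for N p
    using that
  proof (induction N arbitrary: p)
    case 0
    then show ?case
      by (intro exI[of _ 0]) simp
  next
    case (Suc N)
    define q where "q = monom (coeff p (?d + N)) N"
    have "coeff (p - q * f) i \<in> I" for i
      unfolding q_def using Suc.prems(1) by (auto simp: coeff_monom_mult intro!: ring_idealD[OF I])
    moreover have "coeff (p - q * f) i = 0" if "i \<ge> ?d + N" for i
    proof (cases "i = ?d + N")
      case True
      then show ?thesis
        unfolding q_def using monic by (simp add: coeff_monom_mult)
    next
      case False
      then show ?thesis
        unfolding q_def using Suc.prems(2) that by (auto simp: coeff_monom_mult coeff_eq_0)
    qed
    ultimately obtain q' where "\<forall>i. coeff (p - q * f - q' * f) i \<in> I"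
      "\<forall>i\<ge>?d. coeff (p - q * f - q' * f) i = 0"
      using Suc.IH[of "p - q * f"] by blast
    then show ?case
      by (intro exI[of _ "q + q'"]) (simp add: algebra_simps)
  qed
  from this[of p "Suc (degree p)"] show ?thesis
    using p that by (auto simp: coeff_eq_0)
qed

lemma smult_sum_right: "smult c (sum f S) = (\<Sum>i\<in>S. smult c (f i))"
  by (induction S rule: infinite_finite_induct) (simp_all add: smult_add_right)

text \<open>Nakayama's lemma, proved by eliminating one generator at a time instead of by determinants.\<close>

lemma nakayama_elimination:
  fixes x :: "nat \<Rightarrow> 'a::comm_ring_1 poly"
  assumes I: "ring_ideal I"
    and N: "\<And>p q. p \<in> N \<Longrightarrow> q \<in> N \<Longrightarrow> p + q \<in> N" "\<And>c p. p \<in> N \<Longrightarrow> smult c p \<in> N"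
    and rel: "\<And>i. i < d \<Longrightarrow> \<exists>\<mu>. (\<forall>j<d. \<mu> j \<in> I) \<and> x i - (\<Sum>j<d. smult (\<mu> j) (x j)) \<in> N"
  shows "\<exists>r. 1 - r \<in> I \<and> (\<forall>i<d. smult r (x i) \<in> N)"
  using rel
proof (induction d)
  case 0
  then show ?case
    using ring_idealD(1)[OF I] by (intro exI[of _ 1]) simp
next
  case (Suc d)
  obtain \<nu> where \<nu>: "\<And>j. j \<le> d \<Longrightarrow> \<nu> j \<in> I" and "x d - (\<Sum>j<Suc d. smult (\<nu> j) (x j)) \<in> N"
    using Suc.prems[of d] by (metis lessI less_Suc_eq_le)
  moreover define s where "s = 1 - \<nu> d"
  moreover have "x d - (\<Sum>j<Suc d. smult (\<nu> j) (x j)) = smult s (x d) - (\<Sum>j<d. smult (\<nu> j) (x j))"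
    unfolding s_def by (simp add: smult_diff_left)
  ultimately have xd: "smult s (x d) - (\<Sum>j<d. smult (\<nu> j) (x j)) \<in> N"
    by (simp only:)
  have "\<exists>\<mu>. (\<forall>j<d. \<mu> j \<in> I) \<and> x i - (\<Sum>j<d. smult (\<mu> j) (x j)) \<in> N" if i: "i < d" for i
  proof -
    obtain \<mu> where \<mu>: "\<And>j. j \<le> d \<Longrightarrow> \<mu> j \<in> I" and xi: "x i - (\<Sum>j<Suc d. smult (\<mu> j) (x j)) \<in> N"
      using Suc.prems[of i] i by (metis less_Suc_eq less_Suc_eq_le)
    \<comment> \<open>The relation for \<open>x i\<close> is multiplied by \<open>s\<close>, and
      then \<open>s\<close> times \<open>x d\<close> is replaced by its expression in the earlier
      generators. The last summand appears because only \<open>s = 1 - \<nu> d\<close> times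
      \<open>x i\<close> results on the left.\<close>
    define \<mu>' where "\<mu>' j = s * \<mu> j + \<mu> d * \<nu> j + (if j = i then \<nu> d else 0)" for j
    have "(\<Sum>j<d. smult (\<mu>' j) (x j)) = smult s (\<Sum>j<d. smult (\<mu> j) (x j))
        + smult (\<mu> d) (\<Sum>j<d. smult (\<nu> j) (x j)) + smult (\<nu> d) (x i)"
    proof -
      have "(\<Sum>j<d. smult (if j = i then \<nu> d else 0) (x j)) = (\<Sum>j<d. if j = i then smult (\<nu> d) (x i) else 0)"
        by (rule sum.cong) auto
      then show ?thesis
        unfolding \<mu>'_def using i
        by (simp add: smult_add_left sum.distrib flip: smult_smult smult_sum_right)
    qed
    then have "x i - (\<Sum>j<d. smult (\<mu>' j) (x j)) = smult s (x i - (\<Sum>j<Suc d. smult (\<mu> j) (x j)))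
        + smult (\<mu> d) (smult s (x d) - (\<Sum>j<d. smult (\<nu> j) (x j)))"
      unfolding s_def by (simp add: smult_diff_left smult_diff_right smult_add_right algebra_simps)
    moreover have "\<dots> \<in> N"
      using N xi xd by blast
    moreover have "\<mu>' j \<in> I" if "j < d" for j
      unfolding \<mu>'_def using \<mu> \<nu> that by (auto intro!: ring_idealD(1-3)[OF I])
    ultimately show ?thesis
      by (intro exI[of _ \<mu>']) simp
  qed
  then obtain r where r: "1 - r \<in> I" "\<And>i. i < d \<Longrightarrow> smult r (x i) \<in> N"
    using Suc.IH by blast
  have "1 - r * s = (1 - r) + r * \<nu> d"
    unfolding s_def by (simp add: algebra_simps)
  then have rs: "1 - r * s \<in> I"
    using ring_idealD(2)[OF I r(1) ring_idealD(3)[OF I \<nu>, of d r]] by (simp only: order_refl)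
  have "smult (r * s) (x i) \<in> N" if "i < d" for i
    using N(2)[OF r(2)[OF that], of s] by (simp add: mult.commute)
  moreover have "smult (r * s) (x d) \<in> N"
  proof -
    have "smult r (\<Sum>j<d. smult (\<nu> j) (x j)) \<in> N"
    proof -
      have zero: "0 \<in> N"
        using N(2)[OF xd, of 0] by simp
      have elem: "smult (\<nu> j) (smult r (x j)) \<in> N" if "j < d" for j
        using that N(2) r(2) by blast
      have "(\<Sum>j\<in>S. smult (\<nu> j) (smult r (x j))) \<in> N" if "S \<subseteq> {..<d}" for S
        using finite_subset[OF that finite_lessThan] that
        by (induction S rule: finite_induct) (simp_all add: N(1) zero elem del: smult_smult)
      from this[of "{..<d}"] show ?thesis
        by (simp add: smult_sum_right mult.commute)
    qed
    then have "smult r (smult s (x d) - (\<Sum>j<d. smult (\<nu> j) (x j))) + smult r (\<Sum>j<d. smult (\<nu> j) (x j)) \<in> N"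
      using N xd by blast
    then show ?thesis
      by (simp add: smult_diff_right)
  qed
  ultimately show ?case
    using rs less_Suc_eq by auto
qed

section \<open>Suslin's theorem on unimodular vectors with a monic entry\<close>

lemma pcompose_diff_dvd:
  fixes p :: "'a::comm_ring_1 poly"
  shows "\<exists>\<delta>. p \<circ>\<^sub>p (b + smult r c) = p \<circ>\<^sub>p b + smult r \<delta>"
proof (induction p)
  case 0
  then show ?case
    by (intro exI[of _ 0]) simp
next
  case (pCons a p)
  then obtain \<delta> where "p \<circ>\<^sub>p (b + smult r c) = p \<circ>\<^sub>p b + smult r \<delta>"
    by blast
  then show ?case
    by (intro exI[of _ "(b + smult r c) * \<delta> + c * p \<circ>\<^sub>p b"])
      (simp add: pcompose_pCons algebra_simps smult_add_right)
qed

text \<open>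
  With \<open>A = (\<alpha>, \<beta>; -f1, f0)\<close>, of determinant \<open>R\<close>, and \<open>A'\<close> its value at another point, the block below
  is \<open>adj A' A / R\<close>, which is integral since \<open>A' \<equiv> A\<close> modulo \<open>R\<close>.
\<close>

lemma suslin_block:
  fixes R :: "'a::comm_ring_1"
  assumes "\<alpha>' * f0' + \<beta>' * f1' = R"
    and "f0' = f0 + R * d0" "f1' = f1 + R * d1" "\<alpha>' = \<alpha> + R * da" "\<beta>' = \<beta> + R * db"
  shows "\<exists>a b c d. R * a = f0' * \<alpha> + f1 * \<beta>' \<and> R * b = f0' * \<beta> - \<beta>' * f0
    \<and> R * c = f1' * \<alpha> - \<alpha>' * f1 \<and> R * d = f1' * \<beta> + \<alpha>' * f0"
proof (intro exI conjI)
  have d: "R * d0 = f0' - f0" "R * d1 = f1' - f1" "R * da = \<alpha>' - \<alpha>" "R * db = \<beta>' - \<beta>"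
    using assms(2-) by simp_all
  have "R * (1 - (f0' * da + \<beta>' * d1)) = R - f0' * (R * da) - \<beta>' * (R * d1)"
    by (simp add: algebra_simps)
  then show "R * (1 - (f0' * da + \<beta>' * d1)) = f0' * \<alpha> + f1 * \<beta>'"
    unfolding d using assms(1) by (simp add: algebra_simps)
  have "R * (- (f0' * db - \<beta>' * d0)) = \<beta>' * (R * d0) - f0' * (R * db)"
    by (simp add: algebra_simps)
  then show "R * (- (f0' * db - \<beta>' * d0)) = f0' * \<beta> - \<beta>' * f0"
    unfolding d by (simp add: algebra_simps)
  have "R * (- (f1' * da - \<alpha>' * d1)) = \<alpha>' * (R * d1) - f1' * (R * da)"
    by (simp add: algebra_simps)
  then show "R * (- (f1' * da - \<alpha>' * d1)) = f1' * \<alpha> - \<alpha>' * f1"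
    unfolding d by (simp add: algebra_simps)
  have "R * (1 - (f1' * db + \<alpha>' * d0)) = R - f1' * (R * db) - \<alpha>' * (R * d0)"
    by (simp add: algebra_simps)
  then show "R * (1 - (f1' * db + \<alpha>' * d0)) = f1' * \<beta> + \<alpha>' * f0"
    unfolding d using assms(1) by (simp add: algebra_simps)
qed

text \<open>The blocks \<open>adj A' A / R\<close> and \<open>adj A A' / R\<close> are inverse to
  each other since both determinants equal \<open>R\<close>; over a domain this can be checked after
  multiplication by \<open>R * R\<close>.\<close>

lemma suslin_block_inverse:
  fixes R :: "'a::idom"
  assumes "R \<noteq> 0" "A * f0 + B * f1 = R" "A' * f0' + B' * f1' = R"
    and "R * a = f0' * A + f1 * B'" "R * b = f0' * B - B' * f0"
      "R * c = f1' * A - A' * f1" "R * d = f1' * B + A' * f0"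
    and "R * a' = f0 * A' + f1' * B" "R * b' = f0 * B' - B * f0'"
      "R * c' = f1 * A' - A * f1'" "R * d' = f1 * B' + A * f0'"
  shows "a * a' + b * c' = 1" "a * b' + b * d' = 0" "c * a' + d * c' = 0" "c * b' + d * d' = 1"
proof -
  have *: "R * R * (x * y + z * w) = (R * x) * (R * y) + (R * z) * (R * w)" for x y z w
    by (simp add: algebra_simps)
  have canc: "p = q" if "R * R * p = R * R * q" for p q
    using assms(1) that by simp
  have R: "R * R * 1 = (A * f0 + B * f1) * (A' * f0' + B' * f1')"
    by (simp add: assms)
  show "a * a' + b * c' = 1"
    by (rule canc, unfold * assms(4-) R) (simp add: algebra_simps)
  show "a * b' + b * d' = 0"
    by (rule canc, unfold * assms(4-)) (simp add: algebra_simps)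
  show "c * a' + d * c' = 0"
    by (rule canc, unfold * assms(4-)) (simp add: algebra_simps)
  show "c * b' + d * d' = 1"
    by (rule canc, unfold * assms(4-) R) (simp add: algebra_simps)
qed

definition pcompose_vec :: "'a::comm_ring_1 poly^'n \<Rightarrow> 'a poly \<Rightarrow> 'a poly^'n" where
  "pcompose_vec f b = (\<chi> i. f $ i \<circ>\<^sub>p b)"

text \<open>Suslin's ideal. Quantifying over every \<open>b\<close> and \<open>c\<close> is what
  makes it an ideal: a second shift may start where the first one ends, and \<open>c\<close> absorbs
  multiples.\<close>

definition shift_ideal :: "'a::comm_ring_1 poly^'n \<Rightarrow> 'a set" where
  "shift_ideal f = {r. \<forall>b c. vec_equiv (pcompose_vec f b) (pcompose_vec f (b + smult r c))}"

lemma ring_ideal_shift_ideal: "ring_ideal (shift_ideal f)"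
  unfolding ring_ideal_def
proof (intro conjI ballI allI)
  show "0 \<in> shift_ideal f"
    unfolding shift_ideal_def by (simp add: vec_equiv_refl)
  fix r assume r: "r \<in> shift_ideal f"
  show "a * r \<in> shift_ideal f" for a
    unfolding shift_ideal_def
  proof (intro CollectI allI)
    fix b c
    show "vec_equiv (pcompose_vec f b) (pcompose_vec f (b + smult (a * r) c))"
      using r[unfolded shift_ideal_def mem_Collect_eq, rule_format, of b "smult a c"]
      by (simp add: mult.commute)
  qed
  fix s assume s: "s \<in> shift_ideal f"
  show "r + s \<in> shift_ideal f"
    unfolding shift_ideal_def
  proof (intro CollectI allI)
    fix b c
    have "vec_equiv (pcompose_vec f b) (pcompose_vec f (b + smult r c))"
      using r unfolding shift_ideal_def by blast
    also have "vec_equiv \<dots> (pcompose_vec f ((b + smult r c) + smult s c))"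
      using s unfolding shift_ideal_def by blast
    finally show "vec_equiv (pcompose_vec f b) (pcompose_vec f (b + smult (r + s) c))"
      by (simp add: smult_add_left add.assoc)
  qed
qed

lemma shift_ideal_shear:
  fixes f :: "'a::comm_ring_1 poly^'n"
  assumes "f' = (\<chi> j. if j = i then f $ i else f $ j + q j * f $ i)"
  shows "shift_ideal f' \<subseteq> shift_ideal f"
proof
  fix r assume r: "r \<in> shift_ideal f'"
  have *: "vec_equiv (pcompose_vec f b) (pcompose_vec f' b)" for b
  proof -
    have "pcompose_vec f' b = (\<chi> j. if j = i then pcompose_vec f b $ i
        else pcompose_vec f b $ j + (q j \<circ>\<^sub>p b) * pcompose_vec f b $ i)"
      unfolding assms pcompose_vec_def by (simp add: vec_eq_iff pcompose_add pcompose_mult)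
    then show ?thesis
      using vec_equiv_shear[of "pcompose_vec f b" i "\<lambda>j. q j \<circ>\<^sub>p b"] by simp
  qed
  show "r \<in> shift_ideal f"
    unfolding shift_ideal_def
  proof (intro CollectI allI)
    fix b c
    have "vec_equiv (pcompose_vec f' b) (pcompose_vec f' (b + smult r c))"
      using r unfolding shift_ideal_def by blast
    then show "vec_equiv (pcompose_vec f b) (pcompose_vec f (b + smult r c))"
      using * vec_equiv_trans vec_equiv_sym by blast
  qed
qed

text \<open>A block of size two moves the two chosen entries exactly to their new values. The
  remaining entries change by multiples of \<open>r\<close>, and since \<open>r\<close> is a
  combination of the two chosen entries, shears repair them.\<close>

lemma suslin_shift:
  fixes f :: "'a::idom poly^'n"
  assumes "i0 \<noteq> i1" and r: "\<alpha> * f $ i0 + \<beta> * f $ i1 = [:r:]"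
  shows "r \<in> shift_ideal f"
proof (cases "r = 0")
  case True
  then show ?thesis
    using ring_ideal_shift_ideal ring_idealD(1) by blast
next
  case False
  show ?thesis
    unfolding shift_ideal_def
  proof (intro CollectI allI)
    fix b c
    define R where "R = [:r:]"
    have R0: "R \<noteq> 0"
      using False unfolding R_def by simp
    define b' where "b' = b + smult r c"
    have dd: "\<exists>\<delta>. p \<circ>\<^sub>p b' = p \<circ>\<^sub>p b + R * \<delta>" for p
      using pcompose_diff_dvd[of p b r c] unfolding b'_def R_def by simp
    define g where "g = pcompose_vec f b"
    define g' where "g' = pcompose_vec f b'"
    define A B A' B' where AB: "A = \<alpha> \<circ>\<^sub>p b" "B = \<beta> \<circ>\<^sub>p b" "A' = \<alpha> \<circ>\<^sub>p b'" "B' = \<beta> \<circ>\<^sub>p b'"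
    have "(\<alpha> * f $ i0 + \<beta> * f $ i1) \<circ>\<^sub>p b = [:r:]" "(\<alpha> * f $ i0 + \<beta> * f $ i1) \<circ>\<^sub>p b' = [:r:]"
      unfolding r by (simp_all add: pcompose_const)
    then have e: "A * g $ i0 + B * g $ i1 = R" and e': "A' * g' $ i0 + B' * g' $ i1 = R"
      unfolding AB g_def g'_def pcompose_vec_def R_def by (simp_all add: pcompose_add pcompose_mult)
    have "\<forall>i. \<exists>\<delta>. g' $ i = g $ i + R * \<delta>"
      unfolding g_def g'_def pcompose_vec_def using dd by simp
    then have "\<exists>\<delta>. \<forall>i. g' $ i = g $ i + R * \<delta> i"
      by (rule choice)
    then obtain \<delta> where \<delta>: "\<And>i. g' $ i = g $ i + R * \<delta> i"
      by blast
    obtain da db where dab: "A' = A + R * da" "B' = B + R * db"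
      using dd unfolding AB by metis
    obtain a1 b1 c1 d1 where m1: "R * a1 = g' $ i0 * A + g $ i1 * B'" "R * b1 = g' $ i0 * B - B' * g $ i0"
      "R * c1 = g' $ i1 * A - A' * g $ i1" "R * d1 = g' $ i1 * B + A' * g $ i0"
      using suslin_block[OF e' \<delta> \<delta> dab] by blast
    have "g $ i = g' $ i + R * (- \<delta> i)" "A = A' + R * (- da)" "B = B' + R * (- db)" for i
      using \<delta>[of i] dab by auto
    from suslin_block[OF e this(1) this(1) this(2,3)]
    obtain a2 b2 c2 d2 where m2: "R * a2 = g $ i0 * A' + g' $ i1 * B" "R * b2 = g $ i0 * B' - B * g' $ i0"
      "R * c2 = g $ i1 * A' - A * g' $ i1" "R * d2 = g $ i1 * B' + A * g' $ i0"
      by blast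
    note inv = suslin_block_inverse[OF R0 e e' m1 m2] suslin_block_inverse[OF R0 e' e m2 m1]
    define g1 where "g1 = (\<chi> j. if j = i0 then a1 * g $ i0 + b1 * g $ i1
      else if j = i1 then c1 * g $ i0 + d1 * g $ i1 else g $ j)"
    \<comment> \<open>The matrix at the old point sends the two entries to \<open>(R, 0)\<close>;
      the adjugate at the new point, divided by \<open>R\<close>, sends this to the two new
      entries.\<close>
    have "R * (a1 * g $ i0 + b1 * g $ i1) = R * g' $ i0"
    proof -
      have "R * (a1 * g $ i0 + b1 * g $ i1) = (R * a1) * g $ i0 + (R * b1) * g $ i1"
        by (simp add: algebra_simps)
      also have "\<dots> = g' $ i0 * (A * g $ i0 + B * g $ i1)"
        unfolding m1 by (simp add: algebra_simps)
      finally show ?thesis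
        unfolding e by (simp add: mult.commute)
    qed
    moreover have "R * (c1 * g $ i0 + d1 * g $ i1) = R * g' $ i1"
    proof -
      have "R * (c1 * g $ i0 + d1 * g $ i1) = (R * c1) * g $ i0 + (R * d1) * g $ i1"
        by (simp add: algebra_simps)
      also have "\<dots> = g' $ i1 * (A * g $ i0 + B * g $ i1)"
        unfolding m1 by (simp add: algebra_simps)
      finally show ?thesis
        unfolding e by (simp add: mult.commute)
    qed
    ultimately have g1: "g1 = (\<chi> j. if j = i0 then g' $ i0 else if j = i1 then g' $ i1 else g $ j)"
      unfolding g1_def using R0 by (simp cong: if_cong)
    have "vec_equiv g g1"
      unfolding g1_def by (rule vec_equiv_block[OF assms(1) inv])
    \<comment> \<open>The differences \<open>R * \<delta> j\<close> are distributed over the two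
      moved entries by \<open>R = A' * g' $ i0 + B' * g' $ i1\<close>.\<close>
    also have "vec_equiv \<dots> (\<chi> j. if j = i0 then g1 $ i0 else g1 $ j + (if j = i1 then 0 else \<delta> j * A') * g1 $ i0)"
      (is "vec_equiv _ ?g2") by (rule vec_equiv_shear)
    also have "vec_equiv \<dots> (\<chi> j. if j = i1 then ?g2 $ i1 else ?g2 $ j + (if j = i0 then 0 else \<delta> j * B') * ?g2 $ i1)"
      (is "vec_equiv _ ?g3") by (rule vec_equiv_shear)
    also have "?g3 = g'"
    proof -
      have "g $ j + (\<delta> j * A' * g' $ i0 + \<delta> j * B' * g' $ i1) = g' $ j" for j
      proof -
        have "\<delta> j * A' * g' $ i0 + \<delta> j * B' * g' $ i1 = \<delta> j * (A' * g' $ i0 + B' * g' $ i1)"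
          by (simp add: algebra_simps)
        then show ?thesis
          unfolding e' using \<delta>[of j] by (simp add: mult.commute)
      qed
      then show ?thesis
        unfolding g1 using assms(1) by (simp add: vec_eq_iff add.assoc)
    qed
    finally show "vec_equiv (pcompose_vec f b) (pcompose_vec f (b + smult r c))"
      unfolding g_def g'_def b'_def .
  qed
qed

text \<open>Modulo the monic entry the powers of the variable below its degree generate all
  polynomials, so Nakayama's lemma, applied to the ideal \<open>N\<close> of the two entries, finds
  in it a constant \<open>r\<close> congruent to 1 modulo \<open>m\<close>. This takes the place of
  a resultant, and \<open>suslin_shift\<close> puts \<open>r\<close> into the shift ideal.\<close>

lemma shift_ideal_unit_mod:
  fixes f :: "'a::idom poly^'n"
  assumes m: "ring_ideal m" and sub: "shift_ideal f \<subseteq> m" and "i0 \<noteq> i1" and monic: "lead_coeff (f $ i0) = 1"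
    and rel: "\<And>i. coeff (\<alpha> * f $ i0 + \<beta> * f $ i1 - 1) i \<in> m"
  shows "1 \<in> m"
proof -
  let ?f0 = "f $ i0" and ?h = "f $ i1"
  let ?d = "degree ?f0"
  define N where "N = {p. \<exists>\<alpha> \<beta>. p = \<alpha> * ?f0 + \<beta> * ?h}"
  have Nadd: "p + q \<in> N" if p: "p \<in> N" and q: "q \<in> N" for p q
  proof -
    obtain a b where "p = a * ?f0 + b * ?h"
      using p unfolding N_def by blast
    moreover obtain a' b' where "q = a' * ?f0 + b' * ?h"
      using q unfolding N_def by blast
    ultimately
    have "p + q = (a + a') * ?f0 + (b + b') * ?h"
      by (simp add: algebra_simps)
    then show ?thesis
      unfolding N_def by blast
  qed
  have Nmult: "c * p \<in> N" if p: "p \<in> N" for c p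
  proof -
    obtain a b where "p = a * ?f0 + b * ?h"
      using p unfolding N_def by blast
    then have "c * p = (c * a) * ?f0 + (c * b) * ?h"
      by (simp add: algebra_simps)
    then show ?thesis
      unfolding N_def by blast
  qed
  have Nin: "?f0 \<in> N" "\<alpha> * ?f0 + \<beta> * ?h \<in> N"
  proof -
    have "?f0 = 1 * ?f0 + 0 * ?h"
      by simp
    then show "?f0 \<in> N"
      unfolding N_def by (intro CollectI exI)
    show "\<alpha> * ?f0 + \<beta> * ?h \<in> N"
      unfolding N_def by blast
  qed
  have fin: "1 \<in> m" if r: "[:r:] \<in> N" "1 - r \<in> m" for r
  proof -
    have "r \<in> shift_ideal f"
    proof -
      obtain a b where "[:r:] = a * ?f0 + b * ?h"
        using r(1) unfolding N_def by blast
      then show ?thesis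
        using suslin_shift[OF assms(3), of a f b r] by simp
    qed
    then have "1 - r + r \<in> m"
      using r(2) sub ring_idealD(2)[OF m] by blast
    then show ?thesis
      by simp
  qed
  show ?thesis
  proof (cases "?d = 0")
    case True
    then have "?f0 = [:1:]"
      using monic by (metis degree_0_id of_nat_1 of_nat_poly)
    then show ?thesis
      using fin[of 1] Nin(1) ring_idealD(1)[OF m] by simp
  next
    case False
    have "\<exists>r. 1 - r \<in> m \<and> (\<forall>i<?d. smult r (monom 1 i) \<in> N)"
    proof (rule nakayama_elimination[OF m Nadd])
      show "smult c p \<in> N" if "p \<in> N" for c p
        using Nmult[OF that, of "[:c:]"] by simp
      fix i assume i: "i < ?d"
      \<comment> \<open>Modulo \<open>N\<close> the power \<open>monom 1 i\<close> equals
        \<open>\<nu>\<close>, whose coefficients lie in \<open>m\<close>; reduction by the monic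
        entry then leaves only the powers that serve as generators.\<close>
      define \<nu> where "\<nu> = - (monom 1 i * (\<alpha> * ?f0 + \<beta> * ?h - 1))"
      have "coeff \<nu> j \<in> m" for j
        unfolding \<nu>_def coeff_minus coeff_monom_mult
        using rel ring_idealD(1,5)[OF m] by (auto simp del: coeff_diff coeff_add)
      then obtain q where q: "\<And>i. coeff (\<nu> - q * ?f0) i \<in> m" "\<And>i. i \<ge> ?d \<Longrightarrow> coeff (\<nu> - q * ?f0) i = 0"
        using monic_remainder_in_ideal[OF m monic] by metis
      have "(\<Sum>j<?d. smult (coeff (\<nu> - q * ?f0) j) (monom 1 j)) = \<nu> - q * ?f0"
      proof (rule poly_eqI)
        fix n
        have "coeff (\<Sum>j<?d. smult (coeff (\<nu> - q * ?f0) j) (monom 1 j)) n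
          = (\<Sum>j<?d. if j = n then coeff (\<nu> - q * ?f0) j else 0)"
          by (simp add: coeff_sum if_distrib cong: if_cong)
        then show "coeff (\<Sum>j<?d. smult (coeff (\<nu> - q * ?f0) j) (monom 1 j)) n = coeff (\<nu> - q * ?f0) n"
          using q(2)[of n] by simp
      qed
      moreover have "monom 1 i - (\<nu> - q * ?f0) = monom 1 i * (\<alpha> * ?f0 + \<beta> * ?h) + q * ?f0"
        unfolding \<nu>_def by (simp add: algebra_simps)
      moreover have "\<dots> \<in> N"
        using Nin Nadd Nmult by blast
      ultimately show "\<exists>\<mu>. (\<forall>j<?d. \<mu> j \<in> m) \<and> monom 1 i - (\<Sum>j<?d. smult (\<mu> j) (monom 1 j)) \<in> N"
        using q(1) by (intro exI[of _ "coeff (\<nu> - q * ?f0)"]) (simp only: simp_thms)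
    qed
    then obtain r where r: "1 - r \<in> m" "smult r (monom 1 0) \<in> N"
      using False by auto
    then show ?thesis
      using fin[of r] by (simp add: monom_0)
  qed
qed

text \<open>Euclid's algorithm over the residue field of a maximal ideal \<open>m\<close> containing
  the shift ideal. Among all good vectors, an entry of least degree modulo \<open>m\<close> outside
  \<open>i0\<close> divides the others there, so after shears only this entry and the monic one
  survive modulo \<open>m\<close>, and the lemma on two entries applies.\<close>

lemma one_in_shift_ideal:
  fixes f :: "'a::idom poly^'n"
  assumes uni: "unimodular f" and monic: "lead_coeff (f $ i0) = 1" and ne: "i0 \<noteq> i1"
  shows "1 \<in> shift_ideal f"
proof (rule ccontr)
  assume "1 \<notin> shift_ideal f"
  then obtain m where m: "ring_ideal m" "shift_ideal f \<subseteq> m" "1 \<notin> m"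
    and inv: "\<And>a. a \<notin> m \<Longrightarrow> \<exists>u. 1 - a * u \<in> m"
    using maximal_ideal_exists[OF ring_ideal_shift_ideal[of f]] by metis
  define good where "good g \<longleftrightarrow> unimodular g \<and> g $ i0 = f $ i0 \<and> shift_ideal g \<subseteq> m" for g
  define deg where "deg g i n \<longleftrightarrow> i \<noteq> i0 \<and> coeff (g $ i) n \<notin> m \<and> (\<forall>k>n. coeff (g $ i) k \<in> m)" for g i n
  have deg_ex: "\<exists>n. deg g i n \<and> (\<forall>k. coeff (g $ i) k \<notin> m \<longrightarrow> k \<le> n)" if "i \<noteq> i0" "coeff (g $ i) k \<notin> m" for g i k
  proof -
    let ?S = "{k. coeff (g $ i) k \<notin> m}"
    have "?S \<subseteq> {..degree (g $ i)}"
      using ring_idealD(1)[OF m(1)] le_degree by force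
    then have fin: "finite ?S"
      using finite_subset by blast
    have "Max ?S \<in> ?S"
      using Max_in[OF fin] that(2) by blast
    moreover have "k \<le> Max ?S" if "k \<in> ?S" for k
      using Max_ge[OF fin that] .
    ultimately show ?thesis
      unfolding deg_def using that(1) by (metis (mono_tags, lifting) linorder_not_le mem_Collect_eq)
  qed
  have contra: False if g: "good g" and i: "i \<noteq> i0"
    and others: "\<And>j k. j \<noteq> i0 \<Longrightarrow> j \<noteq> i \<Longrightarrow> coeff (g $ j) k \<in> m" for g i
  proof -
    obtain h where h: "(\<Sum>j\<in>UNIV. h $ j * g $ j) = 1"
      using g unfolding good_def unimodular_def by blast
    have "(\<Sum>j\<in>UNIV. h $ j * g $ j) = h $ i0 * g $ i0 + (h $ i * g $ i + (\<Sum>j\<in>UNIV - {i0} - {i}. h $ j * g $ j))"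
      using i by (subst sum.remove[of _ i0], simp, simp, subst sum.remove[of _ i]) auto
    then have e: "h $ i0 * g $ i0 + h $ i * g $ i - 1 = - (\<Sum>j\<in>UNIV - {i0} - {i}. h $ j * g $ j)"
      unfolding h by (simp add: algebra_simps)
    have "coeff (h $ i0 * g $ i0 + h $ i * g $ i - 1) k \<in> m" for k
      unfolding e coeff_minus coeff_sum coeff_mult
      using others by (intro ring_idealD(5)[OF m(1)] ring_ideal_sum[OF m(1)] ring_idealD(3)[OF m(1)]) auto
    then have "1 \<in> m"
      using shift_ideal_unit_mod[OF m(1), of g i0 i "h $ i0" "h $ i"] g i monic unfolding good_def by auto
    then show False
      using m(3) by blast
  qed
  have goodf: "good f"
    unfolding good_def using uni m by blast
  show False
  proof (cases "\<exists>n g i. good g \<and> deg g i n")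
    case False
    then have "coeff (f $ j) k \<in> m" if "j \<noteq> i0" for j k
      using deg_ex[OF that] goodf by blast
    then show False
      using contra[OF goodf] ne by metis
  next
    case True
    define n where "n = (LEAST n. \<exists>g i. good g \<and> deg g i n)"
    obtain g i where g: "good g" "deg g i n"
      using LeastI_ex[OF True] unfolding n_def by blast
    have least: "n \<le> n'" if "good g'" "deg g' i' n'" for g' i' n'
      unfolding n_def using that by (intro Least_le) blast
    have i: "i \<noteq> i0" and cn: "coeff (g $ i) n \<notin> m" and ck: "\<And>k. k > n \<Longrightarrow> coeff (g $ i) k \<in> m"
      using g(2) unfolding deg_def by auto
    obtain u where "1 - coeff (g $ i) n * u \<in> m"
      using inv cn by blast
    then have "\<exists>q. \<forall>j. \<forall>k\<ge>n. coeff (g $ j - q j * g $ i) k \<in> m"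
      using poly_division_mod_ideal[OF m(1) _ ck] by (intro choice) blast
    then obtain q where q: "\<And>j k. k \<ge> n \<Longrightarrow> coeff (g $ j - q j * g $ i) k \<in> m"
      by blast
    \<comment> \<open>The zero at \<open>i0\<close> leaves the monic entry untouched, so that the
      new vector is again good.\<close>
    define c where "c j = (if j = i0 then 0 else - q j)" for j
    define g' where "g' = (\<chi> j. if j = i then g $ i else g $ j + c j * g $ i)"
    have "vec_equiv g g'"
      unfolding g'_def by (rule vec_equiv_shear)
    then have good': "good g'"
      using g(1) unimodular_vec_equiv shift_ideal_shear[OF g'_def] i unfolding good_def
      by (auto simp: g'_def c_def)
    have "coeff (g' $ j) k \<in> m" if j: "j \<noteq> i0" "j \<noteq> i" for j k
    proof (rule ccontr)
      assume "coeff (g' $ j) k \<notin> m"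
      then obtain n' where n': "deg g' j n'"
        using deg_ex j(1) by blast
      then have "n \<le> n'"
        using least[OF good'] by blast
      then have "coeff (g $ j - q j * g $ i) n' \<in> m"
        using q by blast
      then show False
        using n' j unfolding deg_def g'_def c_def by simp
    qed
    then show False
      using contra[OF good' i] by blast
  qed
qed

text \<open>With 1 in the shift ideal any two evaluation points may be compared, in particular zero
  and the variable itself.\<close>

theorem unimodular_monic_equiv:
  fixes f :: "'a::idom poly^'n"
  assumes "unimodular f" "lead_coeff (f $ i0) = 1" "i0 \<noteq> i1"
  shows "vec_equiv f (\<chi> i. [:coeff (f $ i) 0:])"
proof -
  have "vec_equiv (pcompose_vec f 0) (pcompose_vec f (0 + smult 1 [:0, 1:]))"
    using one_in_shift_ideal[OF assms] unfolding shift_ideal_def by blast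
  moreover have "pcompose_vec f [:0, 1:] = f"
    unfolding pcompose_vec_def by (simp add: pcompose_idR)
  moreover have "pcompose_vec f 0 = (\<chi> i. [:coeff (f $ i) 0:])"
    unfolding pcompose_vec_def by (simp add: pcompose_0')
  ultimately show ?thesis
    using vec_equiv_sym by simp
qed

section \<open>Symmetric matrices of rank one over polynomial rings\<close>

text \<open>A nonzero combination of least degree generates the ideal. The Bezout coefficients
  \<open>\<beta>\<close> are part of the result because they show later that \<open>g a a\<close>
  divides the square of the generator.\<close>

lemma field_poly_ideal_generator:
  fixes p :: "'i \<Rightarrow> 'a::field poly"
  assumes S: "finite S" "a \<in> S" "p a \<noteq> 0"
  obtains s \<beta> \<gamma> where "lead_coeff s = 1" "s = (\<Sum>i\<in>S. \<beta> i * p i)" "\<And>i. i \<in> S \<Longrightarrow> p i = s * \<gamma> i"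
proof -
  define J where "J = {s. \<exists>\<beta>. s = (\<Sum>i\<in>S. \<beta> i * p i)}"
  have mult: "c * s \<in> J" if s: "s \<in> J" for c s
  proof -
    obtain \<beta> where "s = (\<Sum>i\<in>S. \<beta> i * p i)"
      using s unfolding J_def by blast
    then have "c * s = (\<Sum>i\<in>S. (c * \<beta> i) * p i)"
      by (simp add: sum_distrib_left mult.assoc)
    then show ?thesis
      unfolding J_def by (intro CollectI exI)
  qed
  have diff: "s - s' \<in> J" if s: "s \<in> J" "s' \<in> J" for s s'
  proof -
    obtain \<beta> \<beta>' where "s = (\<Sum>i\<in>S. \<beta> i * p i)" "s' = (\<Sum>i\<in>S. \<beta>' i * p i)"
      using s unfolding J_def by blast
    then have "s - s' = (\<Sum>i\<in>S. (\<beta> i - \<beta>' i) * p i)"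
      by (simp add: left_diff_distrib sum_subtractf)
    then show ?thesis
      unfolding J_def by (intro CollectI exI)
  qed
  have gen: "p i \<in> J" if "i \<in> S" for i
  proof -
    have "(\<Sum>j\<in>S. (if j = i then 1 else 0) * p j) = (\<Sum>j\<in>S. if j = i then p j else 0)"
      by (intro sum.cong) auto
    then have "p i = (\<Sum>j\<in>S. (if j = i then 1 else 0) * p j)"
      using S(1) that by simp
    then show ?thesis
      unfolding J_def by (intro CollectI exI)
  qed
  define s0 where "s0 = arg_min degree (\<lambda>s. s \<in> J \<and> s \<noteq> 0)"
  have "s0 \<in> J \<and> s0 \<noteq> 0"
    unfolding s0_def using arg_min_natI[of "\<lambda>s. s \<in> J \<and> s \<noteq> 0" "p a" degree] gen[OF S(2)] S(3) by simp
  then have s0: "s0 \<in> J" "s0 \<noteq> 0"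
    by auto
  have min: "degree s0 \<le> degree s" if "s \<in> J" "s \<noteq> 0" for s
    unfolding s0_def using arg_min_nat_le[of "\<lambda>s. s \<in> J \<and> s \<noteq> 0" s degree] that by simp
  define s where "s = smult (inverse (lead_coeff s0)) s0"
  have "s = [:inverse (lead_coeff s0):] * s0"
    unfolding s_def by simp
  then have "s \<in> J"
    using mult[OF s0(1)] by (simp only:)
  have lead: "lead_coeff s = 1"
    unfolding s_def using s0(2) by simp
  have dvd: "s dvd p i" if "i \<in> S" for i
  proof -
    have "p i mod s0 = p i - (p i div s0) * s0"
      by (simp add: minus_div_mult_eq_mod)
    then have "p i mod s0 \<in> J"
      using diff[OF gen[OF that] mult[OF s0(1)]] by (simp only:)
    then have "p i mod s0 = 0"
      using min[of "p i mod s0"] degree_mod_less[OF s0(2), of "p i"] by linarith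
    then have "s0 dvd p i"
      by (simp add: mod_eq_0_iff_dvd)
    then show ?thesis
      unfolding s_def using s0(2) by (simp add: smult_dvd)
  qed
  obtain \<beta> where "s = (\<Sum>i\<in>S. \<beta> i * p i)"
    using \<open>s \<in> J\<close> unfolding J_def by blast
  moreover have "\<forall>i\<in>S. \<exists>c. p i = s * c"
    using dvd by (auto simp: dvd_def)
  then obtain \<gamma> where "\<And>i. i \<in> S \<Longrightarrow> p i = s * \<gamma> i"
    by metis
  ultimately show ?thesis
    using that lead by blast
qed

lemma range_to_fract_closed:
  "x \<in> range to_fract \<Longrightarrow> y \<in> range to_fract \<Longrightarrow> x + y \<in> range to_fract"
  "x \<in> range to_fract \<Longrightarrow> y \<in> range to_fract \<Longrightarrow> x - y \<in> range to_fract"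
  "x \<in> range to_fract \<Longrightarrow> y \<in> range to_fract \<Longrightarrow> x * y \<in> range to_fract"
  "0 \<in> range to_fract" "1 \<in> range to_fract"
  by (auto simp flip: to_fract_add to_fract_diff to_fract_mult to_fract_0 to_fract_1 simp del: to_fract_0 to_fract_1)

lemma sum_in_range_to_fract:
  assumes "\<And>i. i \<in> S \<Longrightarrow> f i \<in> range to_fract"
  shows "sum f S \<in> range to_fract"
  using assms
proof (induction S rule: infinite_finite_induct)
  case (insert i S)
  then have "f i + sum f S \<in> range to_fract"
    by (intro range_to_fract_closed(1)) simp_all
  then show ?case
    using insert by simp
qed (use range_to_fract_closed(4) in simp_all)

lemma fract_poly_of_coeffs:
  fixes s :: "'a::idom fract poly"
  assumes "\<And>i. coeff s i \<in> range to_fract"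
  obtains t where "s = map_poly to_fract t"
proof -
  have "\<forall>i. \<exists>a. coeff s i = to_fract a"
    using assms by blast
  then obtain g where g: "\<And>i. coeff s i = to_fract (g i)"
    by metis
  have "g i = 0" if "i > degree s" for i
    using g[of i] that by (simp add: coeff_eq_0)
  then have "coeff (\<Sum>j\<le>degree s. monom (g j) j) i = g i" for i
    by (cases "i \<le> degree s") (auto simp: coeff_sum)
  then have "s = map_poly to_fract (\<Sum>j\<le>degree s. monom (g j) j)"
    by (intro poly_eqI) (simp add: coeff_map_poly g)
  then show ?thesis
    using that by blast
qed

text \<open>Coefficients are recovered from the top: the one of degree \<open>2 * e - j\<close> in
  \<open>s * s\<close> is twice \<open>coeff s (e - j)\<close> plus products of higher coefficients
  of \<open>s\<close>, and 2 is invertible.\<close>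

lemma monic_square_root_integral:
  fixes s :: "'a::idom fract poly"
  assumes two: "(2::'a) dvd 1" and monic: "lead_coeff s = 1" and sq: "s * s = map_poly to_fract c"
  obtains t where "s = map_poly to_fract t"
proof -
  define e where "e = degree s"
  define H where "H = range (to_fract :: 'a \<Rightarrow> 'a fract)"
  obtain h :: 'a where h: "1 = 2 * h"
    using two by blast
  have half: "x \<in> H" if "x + x \<in> H" for x
  proof -
    have "x = to_fract (2 * h) * x"
      by (simp flip: h)
    also have "\<dots> = to_fract h * (x + x)"
      by (simp only: mult_2 to_fract_add distrib_left distrib_right)
    finally have x: "x = to_fract h * (x + x)" .
    have "to_fract h * (x + x) \<in> H"
      using range_to_fract_closed(3)[of "to_fract h" "x + x"] that unfolding H_def by (simp only: rangeI)
    then show ?thesis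
      using x by metis
  qed
  have coeffs: "coeff s (e - j) \<in> H" if "j \<le> e" for j
    using that
  proof (induction j rule: less_induct)
    case (less j)
    show ?case
    proof (cases "j = 0")
      case True
      then show ?thesis
        using monic range_to_fract_closed(5) unfolding e_def H_def by simp
    next
      case False
      define m where "m = 2 * e - j"
      have "coeff (s * s) m = (\<Sum>i\<le>m. coeff s i * coeff s (m - i))"
        by (rule coeff_mult)
      also have "\<dots> = (\<Sum>i\<in>{e - j..e}. coeff s i * coeff s (m - i))"
      proof (rule sum.mono_neutral_right)
        show "{e - j..e} \<subseteq> {..m}"
          using less.prems unfolding m_def by auto
        show "\<forall>i\<in>{..m} - {e - j..e}. coeff s i * coeff s (m - i) = 0"
        proof
          fix i assume "i \<in> {..m} - {e - j..e}"
          then have "i > e \<or> m - i > e"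
            using less.prems unfolding m_def by auto
          then show "coeff s i * coeff s (m - i) = 0"
            unfolding e_def by (auto simp: coeff_eq_0)
        qed
      qed simp
      also have "{e - j..e} = insert (e - j) (insert e {e - j<..<e})"
        using False less.prems by auto
      also have "(\<Sum>i\<in>insert (e - j) (insert e {e - j<..<e}). coeff s i * coeff s (m - i))
        = coeff s (e - j) + coeff s (e - j) + (\<Sum>i\<in>{e - j<..<e}. coeff s i * coeff s (m - i))"
      proof -
        have "m - (e - j) = e" "m - e = e - j"
          using less.prems unfolding m_def by auto
        then show ?thesis
          using False less.prems monic unfolding e_def by (simp add: add.assoc)
      qed
      finally have "coeff s (e - j) + coeff s (e - j) = coeff (s * s) m - (\<Sum>i\<in>{e - j<..<e}. coeff s i * coeff s (m - i))"
        by simp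
      moreover have "coeff (s * s) m \<in> H"
        unfolding sq H_def by (simp add: coeff_map_poly)
      moreover have "(\<Sum>i\<in>{e - j<..<e}. coeff s i * coeff s (m - i)) \<in> H"
      proof -
        have "coeff s i * coeff s (m - i) \<in> H" if "i \<in> {e - j<..<e}" for i
        proof -
          have "coeff s (e - (e - i)) \<in> H"
            by (rule less.IH) (use that less.prems in auto)
          moreover have "coeff s (e - (e - (m - i))) \<in> H"
            by (rule less.IH) (use that less.prems in \<open>auto simp: m_def\<close>)
          moreover have "e - (e - i) = i" "e - (e - (m - i)) = m - i"
            using that less.prems unfolding m_def by auto
          ultimately show ?thesis
            using range_to_fract_closed(3) unfolding H_def by simp
        qed
        then show ?thesis
          unfolding H_def by (rule sum_in_range_to_fract)
      qed
      ultimately show ?thesis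
        using half range_to_fract_closed(2) unfolding H_def by metis
    qed
  qed
  have "coeff s i \<in> range to_fract" for i
  proof (cases "i \<le> e")
    case True
    then show ?thesis
      using coeffs[of "e - i"] unfolding H_def by simp
  next
    case False
    then show ?thesis
      using range_to_fract_closed(4) unfolding e_def by (simp add: coeff_eq_0)
  qed
  then show ?thesis
    using that fract_poly_of_coeffs by blast
qed

text \<open>Division by a monic polynomial introduces no denominators. The remainder over the ring
  is a multiple of \<open>t\<close> over the fraction field of smaller degree, hence zero.\<close>

lemma fract_poly_monic_cofactor:
  fixes p t :: "'a::idom poly"
  assumes monic: "lead_coeff t = 1" and eq: "map_poly to_fract p = map_poly to_fract t * \<gamma>"
  obtains q where "p = t * q" "\<gamma> = map_poly to_fract q"
proof -
  have "ring_ideal (UNIV :: 'a set)"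
    unfolding ring_ideal_def by simp
  then obtain q where q: "\<And>i. i \<ge> degree t \<Longrightarrow> coeff (p - q * t) i = 0"
    using monic_remainder_in_ideal[OF _ monic, of UNIV p] by auto
  have t0: "t \<noteq> 0"
    using monic by auto
  have e: "map_poly to_fract (p - q * t) = map_poly to_fract t * (\<gamma> - map_poly to_fract q)"
    unfolding fract_poly_diff fract_poly_mult eq by (simp add: algebra_simps)
  have \<gamma>: "\<gamma> = map_poly to_fract q"
  proof (rule ccontr)
    assume "\<gamma> \<noteq> map_poly to_fract q"
    then have nz: "\<gamma> - map_poly to_fract q \<noteq> 0"
      by simp
    have deg: "degree (map_poly to_fract r) = degree r" for r :: "'a poly"
      by (rule degree_map_poly) simp
    have "degree (map_poly to_fract (p - q * t)) = degree t + degree (\<gamma> - map_poly to_fract q)"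
      unfolding e using nz t0 by (subst degree_mult_eq) (simp_all add: deg)
    then have "degree (p - q * t) \<ge> degree t"
      unfolding deg by simp
    then have "lead_coeff (p - q * t) = 0"
      using q by blast
    then have "p - q * t = 0"
      by (simp only: leading_coeff_0_iff)
    then have "map_poly to_fract t * (\<gamma> - map_poly to_fract q) = 0"
      using e by simp
    then show False
      using nz t0 by simp
  qed
  moreover have "p = t * q"
    using eq unfolding \<gamma> by (simp flip: fract_poly_mult)
  ultimately show ?thesis
    using that by blast
qed

lemma monic_dvd_antisym:
  fixes p q :: "'a::idom poly"
  assumes "p dvd q" "q dvd p" "lead_coeff p = 1" "lead_coeff q = 1"
  shows "p = q"
proof -
  obtain c where c: "q = p * c"
    using assms(1) by blast
  have nz: "p \<noteq> 0" "c \<noteq> 0"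
    using assms(3,4) c by auto
  have "degree q \<le> degree p"
    using assms(2) nz(1) by (rule dvd_imp_degree_le)
  then have "degree c = 0"
    using degree_mult_eq[OF nz] unfolding c by simp
  then obtain a where a: "c = [:a:]"
    by (rule degree_eq_zeroE)
  moreover have "lead_coeff q = lead_coeff p * lead_coeff c"
    unfolding c by (rule lead_coeff_mult)
  ultimately have "a = 1"
    using assms(3,4) by simp
  then show ?thesis
    using c a by simp
qed

text \<open>Over the fraction field let \<open>s\<close> be the monic gcd of row \<open>a\<close>.
  The unit relation multiplied by \<open>g a a\<close> shows that \<open>s * s\<close> divides
  \<open>g a a\<close>; squaring the Bezout expression of \<open>s\<close> shows the converse. So
  \<open>g a a\<close> is the square of \<open>s\<close>, which is then integral, and dividing row
  \<open>a\<close> by it gives the factors.\<close>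

lemma rank_one_symmetric_monic:
  fixes g :: "'i \<Rightarrow> 'i \<Rightarrow> 'a::idom poly"
  assumes two: "(2::'a) dvd 1" and S: "finite S" "a \<in> S" and monic: "lead_coeff (g a a) = 1"
    and rank: "\<And>i j. i \<in> S \<Longrightarrow> j \<in> S \<Longrightarrow> g a a * g i j = g a i * g a j"
    and unit: "(\<Sum>i\<in>S. \<Sum>j\<in>S. c i j * g i j) = 1"
  obtains s where "\<And>i j. i \<in> S \<Longrightarrow> j \<in> S \<Longrightarrow> g i j = s i * s j"
proof -
  let ?F = "map_poly to_fract :: 'a poly \<Rightarrow> 'a fract poly"
  have "?F (g a a) \<noteq> 0"
    using monic by auto
  then obtain s \<beta> \<gamma> where s: "lead_coeff s = 1" "s = (\<Sum>i\<in>S. \<beta> i * ?F (g a i))"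
    and \<gamma>: "\<And>i. i \<in> S \<Longrightarrow> ?F (g a i) = s * \<gamma> i"
    by (rule field_poly_ideal_generator[OF S, of "\<lambda>i. ?F (g a i)"]) blast
  have F_sum: "?F (sum f T) = (\<Sum>i\<in>T. ?F (f i))" for f and T :: "'i set"
    by (induction T rule: infinite_finite_induct) simp_all
  have rankF: "?F (g a a) * ?F (g i j) = ?F (g a i) * ?F (g a j)" if "i \<in> S" "j \<in> S" for i j
    using rank[OF that] by (simp flip: fract_poly_mult)
  have "?F (g a a) = ?F (g a a) * ?F (\<Sum>i\<in>S. \<Sum>j\<in>S. c i j * g i j)"
    unfolding unit by simp
  also have "\<dots> = (\<Sum>i\<in>S. \<Sum>j\<in>S. ?F (c i j) * (?F (g a a) * ?F (g i j)))"
    by (simp add: F_sum sum_distrib_left mult.left_commute)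
  also have "\<dots> = (\<Sum>i\<in>S. \<Sum>j\<in>S. ?F (c i j) * ((s * \<gamma> i) * (s * \<gamma> j)))"
    using \<gamma> by (intro sum.cong refl) (simp add: rankF)
  also have "\<dots> = (s * s) * (\<Sum>i\<in>S. \<Sum>j\<in>S. ?F (c i j) * (\<gamma> i * \<gamma> j))"
    by (simp add: sum_distrib_left mult_ac)
  finally have 1: "s * s dvd ?F (g a a)"
    by (rule dvdI)
  have "s * s = (\<Sum>i\<in>S. \<Sum>j\<in>S. \<beta> i * ?F (g a i) * (\<beta> j * ?F (g a j)))"
    by (subst (1 2) s(2)) (rule sum_product)
  also have "\<dots> = (\<Sum>i\<in>S. \<Sum>j\<in>S. \<beta> i * \<beta> j * (?F (g a a) * ?F (g i j)))"
    by (intro sum.cong refl) (subst rankF, assumption, assumption, simp only: mult_ac)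
  also have "\<dots> = ?F (g a a) * (\<Sum>i\<in>S. \<Sum>j\<in>S. \<beta> i * \<beta> j * ?F (g i j))"
    by (simp add: sum_distrib_left mult_ac)
  finally have 2: "?F (g a a) dvd s * s"
    by (rule dvdI)
  have "lead_coeff (s * s) = 1" "lead_coeff (?F (g a a)) = 1"
    using s(1) monic by (simp_all add: lead_coeff_mult coeff_map_poly degree_map_poly)
  then have ss: "s * s = ?F (g a a)"
    by (intro monic_dvd_antisym[OF 1 2])
  then obtain t where t: "s = ?F t"
    using monic_square_root_integral[OF two s(1)] by blast
  have tmonic: "lead_coeff t = 1"
    using s(1) unfolding t by (simp add: coeff_map_poly degree_map_poly) (metis to_fract_1 to_fract_eq_iff)
  have "\<exists>q. g a i = t * q" if "i \<in> S" for i
    using fract_poly_monic_cofactor[OF tmonic \<gamma>[OF that, unfolded t]] by blast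
  then obtain q where q: "\<And>i. i \<in> S \<Longrightarrow> g a i = t * q i"
    by metis
  have "t * t = g a a"
    using ss unfolding t by (simp flip: fract_poly_mult)
  then have "t * t * g i j = t * t * (q i * q j)" if "i \<in> S" "j \<in> S" for i j
    using rank[OF that] q that by (simp add: mult_ac)
  moreover have "t * t \<noteq> 0"
    using tmonic by auto
  ultimately have "g i j = q i * q j" if "i \<in> S" "j \<in> S" for i j
    using that mult_left_cancel by blast
  then show ?thesis
    using that by blast
qed

section \<open>Laurent polynomials as polynomials in one variable\<close>

lemma sum_single_keys: "p = (\<Sum>m\<in>Poly_Mapping.keys p. Poly_Mapping.single m (Poly_Mapping.lookup p m))"
  by (rule poly_mapping_eqI)
    (simp add: lookup_sum lookup_single when_def sum.delta in_keys_iff)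

text \<open>For additive \<open>h\<close> this is the homomorphism of group rings induced by
  \<open>h\<close>; coefficients of exponents with the same image are added.\<close>

definition push :: "('g \<Rightarrow> 'h) \<Rightarrow> ('g \<Rightarrow>\<^sub>0 'a::comm_monoid_add) \<Rightarrow> ('h \<Rightarrow>\<^sub>0 'a)" where
  "push h p = (\<Sum>m\<in>Poly_Mapping.keys p. Poly_Mapping.single (h m) (Poly_Mapping.lookup p m))"

lemma push_superset:
  assumes "finite S" "Poly_Mapping.keys p \<subseteq> S"
  shows "push h p = (\<Sum>m\<in>S. Poly_Mapping.single (h m) (Poly_Mapping.lookup p m))"
  unfolding push_def using assms by (intro sum.mono_neutral_left) (auto simp: in_keys_iff)

lemma push_0 [simp]: "push h 0 = 0"
  by (simp add: push_def)

lemma push_add: "push h (p + q) = push h p + push h q"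
proof -
  let ?S = "Poly_Mapping.keys p \<union> Poly_Mapping.keys q"
  have "push h (p + q) = (\<Sum>m\<in>?S. Poly_Mapping.single (h m) (Poly_Mapping.lookup (p + q) m))"
    using Poly_Mapping.keys_add[of p q] by (intro push_superset) auto
  also have "\<dots> = push h p + push h q"
    by (simp add: push_superset[of ?S p] push_superset[of ?S q] lookup_add single_add sum.distrib)
  finally show ?thesis .
qed

lemma push_single [simp]: "push h (Poly_Mapping.single m c) = Poly_Mapping.single (h m) c"
  by (subst push_superset[of "{m}"]) (auto split: if_splits)

lemma push_sum: "push h (sum f S) = (\<Sum>i\<in>S. push h (f i))"
  by (induction S rule: infinite_finite_induct) (simp_all add: push_add)

lemma push_mult:
  fixes p q :: "'g::monoid_add \<Rightarrow>\<^sub>0 'a::semiring_0"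
  assumes h: "\<And>m n. h (m + n) = h m + h n"
  shows "push h (p * q) = push h p * push h q"
proof -
  have "p * q = (\<Sum>m\<in>Poly_Mapping.keys p. \<Sum>n\<in>Poly_Mapping.keys q.
      Poly_Mapping.single (m + n) (Poly_Mapping.lookup p m * Poly_Mapping.lookup q n))"
    by (subst sum_single_keys[of p], subst sum_single_keys[of q]) (simp add: sum_product mult_single)
  then have "push h (p * q) = (\<Sum>m\<in>Poly_Mapping.keys p. \<Sum>n\<in>Poly_Mapping.keys q.
      Poly_Mapping.single (h m + h n) (Poly_Mapping.lookup p m * Poly_Mapping.lookup q n))"
    by (simp add: push_sum h)
  also have "\<dots> = push h p * push h q"
    unfolding push_def by (simp add: sum_product mult_single)
  finally show ?thesis .
qed

lemma push_1: "h 0 = 0 \<Longrightarrow> push h 1 = 1"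
  by (metis push_single single_one)

lemma lookup_push:
  assumes "inj h"
  shows "Poly_Mapping.lookup (push h p) (h m) = Poly_Mapping.lookup p m"
  using assms by (simp add: push_def lookup_sum lookup_single inj_eq when_def sum.delta in_keys_iff)

lemma lookup_push_notin:
  assumes "k \<notin> range h"
  shows "Poly_Mapping.lookup (push h p) k = 0"
  using assms by (auto simp: push_def lookup_sum lookup_single when_def intro!: sum.neutral)

lemma lookup_single_mult:
  fixes q :: "'g::ab_group_add \<Rightarrow>\<^sub>0 'a::semiring_0"
  shows "Poly_Mapping.lookup (Poly_Mapping.single a c * q) k = c * Poly_Mapping.lookup q (k - a)"
proof -
  have "Poly_Mapping.single a c * q
      = (\<Sum>n\<in>Poly_Mapping.keys q. Poly_Mapping.single (a + n) (c * Poly_Mapping.lookup q n))"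
    by (subst sum_single_keys[of q]) (simp add: sum_distrib_left mult_single)
  then have "Poly_Mapping.lookup (Poly_Mapping.single a c * q) k
      = (\<Sum>n\<in>Poly_Mapping.keys q. if n = k - a then c * Poly_Mapping.lookup q n else 0)"
    by (simp add: lookup_sum lookup_single when_def algebra_simps cong: if_cong)
  then show ?thesis
    by (simp add: in_keys_iff)
qed

definition tpow :: "int \<Rightarrow> 'k::field_char_0 laurent" where
  "tpow z = Poly_Mapping.single (Poly_Mapping.single 0 z) 1"

lemma tpow_add: "tpow (z + w) = tpow z * tpow w"
  by (simp add: tpow_def mult_single single_add)

lemma tpow_0 [simp]: "tpow 0 = 1"
  by (simp add: tpow_def)

lemma tpow_inverse: "tpow z * tpow (- z) = 1" "tpow (- z) * tpow z = 1"
  by (simp_all flip: tpow_add)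

section \<open>Weights of exponents and adapted coordinates\<close>

definition weight :: "int \<Rightarrow> (nat \<Rightarrow>\<^sub>0 int) \<Rightarrow> int" where
  "weight N g = (\<Sum>i\<in>Poly_Mapping.keys g. Poly_Mapping.lookup g i * N ^ i)"

lemma weight_superset:
  assumes "finite S" "Poly_Mapping.keys g \<subseteq> S"
  shows "weight N g = (\<Sum>i\<in>S. Poly_Mapping.lookup g i * N ^ i)"
  unfolding weight_def using assms by (intro sum.mono_neutral_left) (auto simp: in_keys_iff)

lemma weight_add: "weight N (g + h) = weight N g + weight N h"
proof -
  let ?S = "Poly_Mapping.keys g \<union> Poly_Mapping.keys h"
  have "weight N (g + h) = (\<Sum>i\<in>?S. Poly_Mapping.lookup (g + h) i * N ^ i)"
    using Poly_Mapping.keys_add[of g h] by (intro weight_superset) auto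
  then show ?thesis
    by (simp add: weight_superset[of ?S g] weight_superset[of ?S h] lookup_add distrib_right sum.distrib)
qed

text \<open>Read as a polynomial in \<open>N\<close>, the weight determines the exponent. Two
  exponents have equal weight only at the roots of a nonzero polynomial, so a finite set excludes
  finitely many \<open>N\<close>.\<close>

lemma weight_injective_on:
  assumes "finite A"
  obtains N where "inj_on (weight N) A"
proof -
  define wp :: "(nat \<Rightarrow>\<^sub>0 int) \<Rightarrow> int poly"
    where "wp g = (\<Sum>i\<in>Poly_Mapping.keys g. monom (Poly_Mapping.lookup g i) i)" for g
  have wp: "poly (wp g) N = weight N g" for g N
    by (simp add: wp_def weight_def poly_sum poly_monom)
  have coeff_wp: "coeff (wp g) i = Poly_Mapping.lookup g i" for g i
    by (simp add: wp_def coeff_sum in_keys_iff)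
  have inj: "g = h" if "wp g = wp h" for g h
    using that coeff_wp[of g] coeff_wp[of h] by (intro poly_mapping_eqI) simp
  define bad where "bad = (\<Union>g\<in>A. \<Union>h\<in>A - {g}. {N. poly (wp g - wp h) N = 0})"
  have "finite {N. poly (wp g - wp h) N = 0}" if "h \<in> A - {g}" for g h
  proof (rule poly_roots_finite)
    show "wp g - wp h \<noteq> 0"
      using inj that by force
  qed
  then have "finite bad"
    unfolding bad_def using assms by (intro finite_UN_I finite_Diff)
  then obtain N where N: "N \<notin> bad"
    using ex_new_if_finite infinite_UNIV_int by blast
  have "inj_on (weight N) A"
  proof (rule inj_onI, rule ccontr)
    fix g h assume "g \<in> A" "h \<in> A" "weight N g = weight N h" "g \<noteq> h"
    then have "g \<in> A" "h \<in> A - {g}" "poly (wp g - wp h) N = 0"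
      by (simp_all add: wp)
    then show False
      using N unfolding bad_def by blast
  qed
  then show ?thesis
    using that by blast
qed

text \<open>
  In the coordinates given by \<open>lower N\<close> and \<open>t\<^sub>0\<close>, the exponent of \<open>t\<^sub>0\<close> in the monomial \<open>t\<^sup>g\<close> is
  \<open>weight N g\<close>.  For suitable \<open>N\<close> the monomials of a given Laurent polynomial have different weights,
  so its leading coefficient in \<open>t\<^sub>0\<close> is a unit.
\<close>

definition lower :: "int \<Rightarrow> (nat \<Rightarrow>\<^sub>0 int) \<Rightarrow> (nat \<Rightarrow>\<^sub>0 int)" where
  "lower N m = push Suc m - Poly_Mapping.single 0 (N * weight N m)"

definition tail_exponent :: "(nat \<Rightarrow>\<^sub>0 int) \<Rightarrow> (nat \<Rightarrow>\<^sub>0 int)" where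
  "tail_exponent g = Poly_Mapping.map_key Suc g"

lemma lookup_tail_exponent [simp]: "Poly_Mapping.lookup (tail_exponent g) i = Poly_Mapping.lookup g (Suc i)"
  by (simp add: tail_exponent_def map_key.rep_eq)

lemma lower_add: "lower N (m + n) = lower N m + lower N n"
  by (simp add: lower_def push_add weight_add single_add algebra_simps)

lemma lower_0 [simp]: "lower N 0 = 0"
  by (simp add: lower_def weight_def)

lemma lookup_lower_Suc: "Poly_Mapping.lookup (lower N m + Poly_Mapping.single 0 z) (Suc i) = Poly_Mapping.lookup m i"
  by (simp add: lower_def lookup_add lookup_minus lookup_single lookup_push)

lemma lower_eqD:
  assumes "lower N m + Poly_Mapping.single 0 z = lower N m' + Poly_Mapping.single 0 z'"
  shows "m = m'" "z = z'"
proof -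
  show m: "m = m'"
    by (rule poly_mapping_eqI) (metis assms lookup_lower_Suc)
  show "z = z'"
    using assms unfolding m by (metis add_left_cancel lookup_single_eq)
qed

lemma inj_lower: "inj (lower N)"
  using lower_eqD(1)[of N _ 0 _ 0] by (intro injI) simp

text \<open>\<open>lower N\<close> moves every variable up by one and compensates with
  \<open>t\<^sub>0\<close>, which identifies the group of all exponents with its subgroup of weight
  zero. This is where infinitely many variables make the ring a Laurent polynomial ring over a copy
  of itself.\<close>

lemma lower_decomposition: "g = lower N (tail_exponent g) + Poly_Mapping.single 0 (weight N g)"
proof (rule poly_mapping_eqI)
  fix k
  obtain n where n: "Poly_Mapping.keys g \<subseteq> {..<Suc n}"
    using finite_nat_bounded[OF finite_keys[of g]] by (metis lessThan_subset_iff le_SucI order_refl order_trans)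
  then have n': "Poly_Mapping.keys (tail_exponent g) \<subseteq> {..<n}"
    by (force simp: in_keys_iff)
  have "weight N g = Poly_Mapping.lookup g 0 + N * weight N (tail_exponent g)"
    by (simp add: weight_superset[OF _ n] weight_superset[OF _ n'] sum.lessThan_Suc_shift sum_distrib_left mult_ac
        del: sum.lessThan_Suc)
  then show "Poly_Mapping.lookup g k
      = Poly_Mapping.lookup (lower N (tail_exponent g) + Poly_Mapping.single 0 (weight N g)) k"
    by (cases k) (simp_all add: lookup_lower_Suc, simp add: lower_def lookup_add lookup_minus lookup_push_notin)
qed

text \<open>Coefficients are embedded as elements of weight zero and the polynomial variable becomes
  \<open>t\<^sub>0\<close>.\<close>

definition from_poly :: "int \<Rightarrow> 'k::field_char_0 laurent poly \<Rightarrow> 'k laurent" where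
  "from_poly N P = poly (map_poly (push (lower N)) P) (tpow 1)"

lemma from_poly_0 [simp]: "from_poly N 0 = 0"
  by (simp add: from_poly_def)

lemma from_poly_pCons: "from_poly N (pCons a P) = push (lower N) a + tpow 1 * from_poly N P"
  by (simp add: from_poly_def map_poly_pCons)

lemma from_poly_add: "from_poly N (P + Q) = from_poly N P + from_poly N Q"
  by (induction P Q rule: poly_induct2) (simp_all add: from_poly_pCons push_add algebra_simps)

lemma from_poly_smult: "from_poly N (smult c P) = push (lower N) c * from_poly N P"
proof (induction P)
  case (pCons a P)
  have "from_poly N (smult c (pCons a P)) = push (lower N) c * push (lower N) a + tpow 1 * (push (lower N) c * from_poly N P)"
    by (simp only: smult_pCons from_poly_pCons pCons.IH push_mult[of "lower N", OF lower_add])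
  then show ?case
    by (simp only: from_poly_pCons distrib_left mult.left_commute)
qed simp

lemma from_poly_mult: "from_poly N (P * Q) = from_poly N P * from_poly N Q"
proof (induction P)
  case (pCons a P)
  have "from_poly N (pCons a P * Q) = push (lower N) a * from_poly N Q + tpow 1 * (from_poly N P * from_poly N Q)"
    by (simp only: mult_pCons_left from_poly_add from_poly_smult from_poly_pCons pCons.IH push_0 add_0)
  then show ?case
    by (simp only: from_poly_pCons distrib_right mult.assoc)
qed simp

lemma from_poly_1 [simp]: "from_poly N 1 = 1"
  by (simp add: one_pCons from_poly_pCons push_1)

lemma from_poly_sum: "from_poly N (sum f S) = (\<Sum>i\<in>S. from_poly N (f i))"
  by (induction S rule: infinite_finite_induct) (simp_all add: from_poly_add)

lemma from_poly_monom: "from_poly N (monom c n) = push (lower N) c * tpow (int n)"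
  by (induction n) (simp_all add: monom_0 monom_Suc from_poly_pCons tpow_add algebra_simps)

text \<open>The coefficient of degree \<open>j\<close> fills exactly the exponents of weight
  \<open>j\<close>; injectivity of the substitution follows.\<close>

lemma lookup_from_poly:
  "Poly_Mapping.lookup (from_poly N P) (lower N m + Poly_Mapping.single 0 z)
    = (if z \<ge> 0 then Poly_Mapping.lookup (coeff P (nat z)) m else 0)"
proof (induction P arbitrary: z)
  case 0
  then show ?case
    by simp
next
  case (pCons a P)
  have "Poly_Mapping.lookup (push (lower N) a) (lower N m + Poly_Mapping.single 0 z)
      = (if z = 0 then Poly_Mapping.lookup a m else 0)"
  proof (cases "z = 0")
    case True
    then show ?thesis
      by (simp add: lookup_push inj_lower)
  next
    case False
    have "lower N m + Poly_Mapping.single 0 z \<notin> range (lower N)"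
      using False lower_eqD(2)[of N m z _ 0] by auto
    then show ?thesis
      using False by (simp add: lookup_push_notin)
  qed
  moreover have "lower N m + Poly_Mapping.single 0 z - Poly_Mapping.single 0 1
      = lower N m + Poly_Mapping.single 0 (z - 1)"
    by (simp add: single_diff)
  then have "Poly_Mapping.lookup (tpow 1 * from_poly N P) (lower N m + Poly_Mapping.single 0 z)
      = (if z - 1 \<ge> 0 then Poly_Mapping.lookup (coeff P (nat (z - 1))) m else 0)"
    by (simp only: tpow_def lookup_single_mult pCons.IH mult_1)
  ultimately show ?case
    by (auto simp: from_poly_pCons lookup_add coeff_pCons nat_diff_distrib' split: nat.split)
qed

lemma from_poly_inject:
  assumes "from_poly N P = from_poly N Q"
  shows "P = Q"
proof (rule poly_eqI)
  fix j
  show "coeff P j = coeff Q j"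
  proof (rule poly_mapping_eqI)
    fix m
    show "Poly_Mapping.lookup (coeff P j) m = Poly_Mapping.lookup (coeff Q j) m"
      using lookup_from_poly[of N P m "int j"] lookup_from_poly[of N Q m "int j"] assms by simp
  qed
qed

text \<open>\<open>nat\<close> cuts off at zero, so this represents \<open>tpow z * p\<close> only
  under the bound assumed in \<open>from_poly_to_poly\<close>.\<close>

definition to_poly :: "int \<Rightarrow> int \<Rightarrow> 'k::field_char_0 laurent \<Rightarrow> 'k laurent poly" where
  "to_poly N z p = (\<Sum>g\<in>Poly_Mapping.keys p.
    monom (Poly_Mapping.single (tail_exponent g) (Poly_Mapping.lookup p g)) (nat (z + weight N g)))"

lemma from_poly_to_poly:
  assumes "\<And>g. g \<in> Poly_Mapping.keys p \<Longrightarrow> 0 \<le> z + weight N g"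
  shows "from_poly N (to_poly N z p) = tpow z * p"
proof -
  have "from_poly N (to_poly N z p) = (\<Sum>g\<in>Poly_Mapping.keys p.
      Poly_Mapping.single (lower N (tail_exponent g)) (Poly_Mapping.lookup p g) * tpow (z + weight N g))"
    unfolding to_poly_def using assms by (simp add: from_poly_sum from_poly_monom)
  also have "\<dots> = (\<Sum>g\<in>Poly_Mapping.keys p. tpow z * Poly_Mapping.single g (Poly_Mapping.lookup p g))"
  proof (rule sum.cong[OF refl])
    fix g
    have "Poly_Mapping.single (lower N (tail_exponent g)) c * tpow (z + weight N g)
        = tpow z * Poly_Mapping.single (lower N (tail_exponent g) + Poly_Mapping.single 0 (weight N g)) c" for c :: 'a
      by (simp add: tpow_def mult_single single_add algebra_simps)
    then show "Poly_Mapping.single (lower N (tail_exponent g)) (Poly_Mapping.lookup p g) * tpow (z + weight N g)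
        = tpow z * Poly_Mapping.single g (Poly_Mapping.lookup p g)"
      by (simp flip: lower_decomposition)
  qed
  also have "\<dots> = tpow z * p"
    by (subst (3) sum_single_keys[of p]) (simp add: sum_distrib_left)
  finally show ?thesis .
qed

lemma from_poly_surj:
  assumes "finite S"
  obtains K :: nat where "\<And>i K'. i \<in> S \<Longrightarrow> K' \<ge> int K \<Longrightarrow> \<exists>P. from_poly N P = tpow K' * p i"
proof -
  define K where "K = nat (\<Sum>i\<in>S. \<Sum>g\<in>Poly_Mapping.keys (p i). \<bar>weight N g\<bar>)"
  have "from_poly N (to_poly N K' (p i)) = tpow K' * p i" if i: "i \<in> S" and K': "K' \<ge> int K" for i K'
  proof (rule from_poly_to_poly)
    fix g assume g: "g \<in> Poly_Mapping.keys (p i)"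
    have "\<bar>weight N g\<bar> \<le> (\<Sum>g\<in>Poly_Mapping.keys (p i). \<bar>weight N g\<bar>)"
      using g by (intro member_le_sum) auto
    also have "\<dots> \<le> (\<Sum>i\<in>S. \<Sum>g\<in>Poly_Mapping.keys (p i). \<bar>weight N g\<bar>)"
      using i assms by (intro member_le_sum) (auto intro: sum_nonneg)
    finally have "\<bar>weight N g\<bar> \<le> int K"
      unfolding K_def by simp
    then show "0 \<le> K' + weight N g"
      using K' by linarith
  qed
  then show ?thesis
    using that by blast
qed

section \<open>Unimodular rows and rank one matrices over Laurent polynomials\<close>

text \<open>For a weight that separates the exponents of \<open>p\<close>, each nonzero coefficient
  of \<open>P\<close> is a single monomial and thus a unit. A shift by the least weight puts one at
  degree zero, and division by the top one makes \<open>P\<close> monic.\<close>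

lemma laurent_normalization:
  fixes p :: "'k::field_char_0 laurent"
  assumes "p \<noteq> 0"
  obtains N P u v where "from_poly N P = u * p" "u * v = 1" "lead_coeff P = 1" "coeff P 0 dvd 1"
proof -
  let ?A = "Poly_Mapping.keys p"
  obtain N where N: "inj_on (weight N) ?A"
    using weight_injective_on finite_keys by blast
  have "?A \<noteq> {}"
    using assms sum_single_keys[of p] by force
  then have A: "finite (weight N ` ?A)" "weight N ` ?A \<noteq> {}"
    by (simp_all only: finite_imageI finite_keys image_is_empty not_False_eq_True)
  obtain gmin where gmin: "gmin \<in> ?A" "\<And>g. g \<in> ?A \<Longrightarrow> weight N gmin \<le> weight N g"
  proof -
    obtain g where "g \<in> ?A" "Min (weight N ` ?A) = weight N g"
      using Min_in[OF A] by blast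
    then show ?thesis
      using that[of g] Min_le[OF A(1)] by simp
  qed
  obtain gmax where gmax: "gmax \<in> ?A" "\<And>g. g \<in> ?A \<Longrightarrow> weight N g \<le> weight N gmax"
  proof -
    obtain g where "g \<in> ?A" "Max (weight N ` ?A) = weight N g"
      using Max_in[OF A] by blast
    then show ?thesis
      using that[of g] Max_ge[OF A(1)] by simp
  qed
  define z where "z = - weight N gmin"
  define P where "P = to_poly N z p"
  define c where "c g = Poly_Mapping.single (tail_exponent g) (Poly_Mapping.lookup p g)" for g
  have pos: "0 \<le> z + weight N g" if "g \<in> ?A" for g
    unfolding z_def using gmin(2)[OF that] by simp
  have coeffP: "coeff P (nat (z + weight N g)) = c g" if g: "g \<in> ?A" for g
  proof -
    have "nat (z + weight N g') = nat (z + weight N g) \<longleftrightarrow> g' = g" if "g' \<in> ?A" for g'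
      using pos[OF g] pos[OF that] inj_onD[OF N _ that g] by auto
    then have "coeff P (nat (z + weight N g)) = (\<Sum>g'\<in>?A. if g' = g then c g else 0)"
      unfolding P_def to_poly_def c_def by (simp add: coeff_sum cong: sum.cong)
    then show ?thesis
      using g by simp
  qed
  have cunit: "c g * Poly_Mapping.single (- tail_exponent g) (inverse (Poly_Mapping.lookup p g)) = 1"
    if "g \<in> ?A" for g
    unfolding c_def using that by (simp add: mult_single in_keys_iff)
  then have c0: "c g \<noteq> 0" if "g \<in> ?A" for g
    using that by force
  have "degree P \<le> nat (z + weight N gmax)"
    unfolding P_def to_poly_def using gmax(2)
    by (intro degree_sum_le) (auto intro!: order_trans[OF degree_monom_le] nat_mono)
  then have deg: "degree P = nat (z + weight N gmax)"
    using le_degree[of P] coeffP[OF gmax(1)] c0[OF gmax(1)] by (intro antisym) auto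
  define c' where "c' = Poly_Mapping.single (- tail_exponent gmax) (inverse (Poly_Mapping.lookup p gmax))"
  have cc: "c gmax * c' = 1"
    unfolding c'_def using cunit[OF gmax(1)] .
  have P: "from_poly N P = tpow z * p"
    unfolding P_def using pos by (rule from_poly_to_poly)
  show ?thesis
  proof (rule that[of N "smult c' P" "push (lower N) c' * tpow z" "push (lower N) (c gmax) * tpow (- z)"])
    show "from_poly N (smult c' P) = push (lower N) c' * tpow z * p"
      by (simp add: from_poly_smult P mult.assoc)
    have "push (lower N) c' * tpow z * (push (lower N) (c gmax) * tpow (- z))
        = push (lower N) (c gmax * c') * (tpow z * tpow (- z))"
      by (simp add: push_mult lower_add mult_ac)
    then show "push (lower N) c' * tpow z * (push (lower N) (c gmax) * tpow (- z)) = 1"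
      by (simp add: cc push_1 tpow_inverse)
    have "lead_coeff (smult c' P) = c' * c gmax"
      unfolding lead_coeff_smult using coeffP[OF gmax(1)] unfolding deg by (simp only:)
    also have "\<dots> = 1"
      using cc by (simp only: mult.commute)
    finally show "lead_coeff (smult c' P) = 1" .
    have "coeff (smult c' P) 0 = c' * c gmin"
      using coeffP[OF gmin(1)] unfolding z_def by simp
    moreover have "c' * c gmin * (c gmax * d) = (c gmax * c') * (c gmin * d)" for d
      by (simp only: mult_ac)
    ultimately have "coeff (smult c' P) 0
        * (c gmax * Poly_Mapping.single (- tail_exponent gmin) (inverse (Poly_Mapping.lookup p gmin))) = 1"
      by (simp only: cc cunit[OF gmin(1)] mult_1_left)
    then show "coeff (smult c' P) 0 dvd 1"
      by (rule dvdI[OF sym])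
  qed
qed

text \<open>Clearing denominators turns the relation into one with value \<open>x ^ K\<close>. The
  power can be removed because \<open>x\<close> is invertible modulo \<open>P a\<close>, whose
  constant term is a unit.\<close>

lemma from_poly_unit_ideal:
  fixes P :: "'i \<Rightarrow> 'k::field_char_0 laurent poly"
  assumes S: "finite S" "a \<in> S" and unit: "coeff (P a) 0 dvd 1"
    and sum: "(\<Sum>i\<in>S. q i * from_poly N (P i)) = 1"
  obtains Q where "(\<Sum>i\<in>S. Q i * P i) = 1"
proof -
  obtain K :: nat where "\<And>i K'. i \<in> S \<Longrightarrow> K' \<ge> int K \<Longrightarrow> \<exists>P. from_poly N P = tpow K' * q i"
    using from_poly_surj[OF S(1), of N q] by blast
  then have "\<forall>i\<in>S. \<exists>P. from_poly N P = tpow (int K) * q i"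
    by blast
  then obtain Q where Q: "\<And>i. i \<in> S \<Longrightarrow> from_poly N (Q i) = tpow (int K) * q i"
    by metis
  define x :: "'k laurent poly" where "x = [:0, 1:]"
  have "from_poly N (\<Sum>i\<in>S. Q i * P i) = tpow (int K) * (\<Sum>i\<in>S. q i * from_poly N (P i))"
    using Q by (simp add: from_poly_sum from_poly_mult sum_distrib_left mult.assoc)
  also have "\<dots> = from_poly N (x ^ K)"
    unfolding sum x_def by (simp add: from_poly_monom push_1 flip: monom_altdef[of 1, simplified])
  finally have QP: "(\<Sum>i\<in>S. Q i * P i) = x ^ K"
    by (rule from_poly_inject)
  obtain v where v: "coeff (P a) 0 * v = 1"
    using unit by (metis dvdE)
  obtain c R where cR: "P a = pCons c R"
    by (metis pCons_cases)
  \<comment> \<open>Writing \<open>P a\<close> as \<open>c + x * R\<close> with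
    \<open>c * v = 1\<close> shows that \<open>y\<close> inverts \<open>x\<close> modulo
    \<open>P a\<close>.\<close>
  define y where "y = - smult v R"
  have xy: "x * y = 1 - [:v:] * P a"
    using v unfolding x_def y_def cR by (simp add: mult.commute one_pCons)
  have "P a dvd 1 - (1 - [:v:] * P a) ^ n" for n
  proof (induction n)
    case (Suc n)
    have "1 - (1 - [:v:] * P a) ^ Suc n = (1 - (1 - [:v:] * P a) ^ n) + (1 - [:v:] * P a) ^ n * [:v:] * P a"
      by (simp add: algebra_simps)
    then show ?case
      using Suc by (metis dvd_add dvd_triv_right)
  qed simp
  then obtain w where "1 - (1 - [:v:] * P a) ^ K = P a * w"
    by (metis dvdE)
  then have w: "1 = y ^ K * x ^ K + w * P a"
    unfolding xy[symmetric] by (simp add: power_mult_distrib algebra_simps)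
  have "(\<Sum>i\<in>S. (y ^ K * Q i + (if i = a then w else 0)) * P i)
      = y ^ K * (\<Sum>i\<in>S. Q i * P i) + (\<Sum>i\<in>S. if i = a then w * P a else 0)"
    unfolding sum_distrib_left sum.distrib[symmetric]
    by (intro sum.cong refl) (auto simp: algebra_simps)
  also have "\<dots> = 1"
    using S w by (simp add: QP)
  finally show ?thesis
    by (rule that)
qed

lemma vec_equiv_hom:
  fixes \<phi> :: "'a::comm_ring_1 \<Rightarrow> 'b::comm_ring_1" and f g :: "'a^'n"
  assumes hom: "\<phi> 0 = 0" "\<phi> 1 = 1" "\<And>x y. \<phi> (x + y) = \<phi> x + \<phi> y" "\<And>x y. \<phi> (x * y) = \<phi> x * \<phi> y"
    and "vec_equiv f g"
  shows "vec_equiv (\<chi> i. \<phi> (f $ i)) (\<chi> i. \<phi> (g $ i))"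
proof -
  obtain M N where MN: "M ** N = mat 1" "N ** M = mat 1" "M *v f = g"
    using assms(5) unfolding vec_equiv_def by blast
  have sum: "\<phi> (sum h S) = (\<Sum>i\<in>S. \<phi> (h i))" for h and S :: "'n set"
    by (induction S rule: infinite_finite_induct) (simp_all add: hom)
  let ?m = "\<lambda>A. (\<chi> i j. \<phi> (A $ i $ j)) :: 'b^'n^'n"
  have mm: "?m A ** ?m B = ?m (A ** B)" for A B :: "'a^'n^'n"
    by (simp add: matrix_matrix_mult_def vec_eq_iff sum hom)
  have "?m (mat 1) = mat 1"
    by (simp add: mat_def vec_eq_iff hom)
  moreover have "?m M *v (\<chi> i. \<phi> (f $ i)) = (\<chi> i. \<phi> ((M *v f) $ i))"
    by (simp add: matrix_vector_mult_def vec_eq_iff sum hom)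
  ultimately show ?thesis
    unfolding vec_equiv_def using mm MN by metis
qed

text \<open>Scaling by units moves the row to polynomials with a monic entry, which is equivalent to
  its value at zero. There the formerly monic entry is a unit, and a shear clears the rest.\<close>

theorem laurent_unimodular_equiv:
  fixes x :: "'k::field_char_0 laurent^'n" and a b :: 'n
  assumes "a \<noteq> b" "unimodular x"
  obtains i where "vec_equiv x (axis i 1)"
proof -
  have "\<exists>i. x $ i \<noteq> 0"
  proof (rule ccontr)
    assume "\<nexists>i. x $ i \<noteq> 0"
    then show False
      using assms(2) unfolding unimodular_def by simp
  qed
  then obtain i0 where "x $ i0 \<noteq> 0"
    by blast
  then obtain N P u v where P: "from_poly N P = u * x $ i0" "u * v = 1" "lead_coeff P = 1" "coeff P 0 dvd 1"
    by (rule laurent_normalization) blast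
  obtain i1 where i1: "i0 \<noteq> i1"
    using assms(1) by metis
  obtain K :: nat where "\<And>i K'. i \<in> UNIV \<Longrightarrow> K' \<ge> int K \<Longrightarrow> \<exists>P. from_poly N P = tpow K' * x $ i"
    by (rule from_poly_surj[OF finite[of UNIV], of N "\<lambda>i. x $ i"]) blast
  then have "\<forall>i. \<exists>P. from_poly N P = tpow (int K) * x $ i"
    by blast
  then obtain P' where P': "\<And>i. from_poly N (P' i) = tpow (int K) * x $ i"
    by metis
  define f where "f = (\<chi> i. if i = i0 then P else P' i)"
  define U where "U i = (if i = i0 then u else tpow (int K))" for i
  define V where "V i = (if i = i0 then v else tpow (- int K))" for i
  have UV: "U i * V i = 1" for i
    unfolding U_def V_def using P(2) tpow_inverse by auto
  have y: "(\<chi> i. from_poly N (f $ i)) = (\<chi> i. U i * x $ i)"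
    unfolding f_def U_def using P(1) P' by (simp add: vec_eq_iff)
  have xy: "vec_equiv x (\<chi> i. from_poly N (f $ i))"
    unfolding y by (rule vec_equiv_diag[OF UV])
  then have "unimodular (\<chi> i. from_poly N (f $ i))"
    using unimodular_vec_equiv assms(2) by blast
  then obtain g where g: "(\<Sum>i\<in>UNIV. g $ i * from_poly N (f $ i)) = 1"
    unfolding unimodular_def by auto
  have cu: "coeff (f $ i0) 0 dvd 1"
    unfolding f_def using P(4) by simp
  obtain Q where "(\<Sum>i\<in>UNIV. Q i * f $ i) = 1"
    using from_poly_unit_ideal[where S = UNIV and a = i0 and P = "\<lambda>i. f $ i" and q = "\<lambda>i. g $ i" and N = N,
        OF finite UNIV_I cu g] by blast
  then have "unimodular f"
    unfolding unimodular_def by (intro exI[of _ "\<chi> i. Q i"]) simp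
  then have "vec_equiv f (\<chi> i. [:coeff (f $ i) 0:])"
    using unimodular_monic_equiv[of f i0 i1] P(3) i1 by (simp add: f_def)
  then have fg: "vec_equiv (\<chi> i. from_poly N (f $ i)) (\<chi> i. from_poly N ((\<chi> i. [:coeff (f $ i) 0:]) $ i))"
    by (intro vec_equiv_hom) (simp_all add: from_poly_add from_poly_mult)
  define h where "h = (\<chi> i. from_poly N ((\<chi> i. [:coeff (f $ i) 0:]) $ i))"
  have fh: "vec_equiv (\<chi> i. from_poly N (f $ i)) h"
    using fg unfolding h_def .
  obtain c where "coeff P 0 * c = 1"
    using P(4) by (metis dvdE)
  then have "[:coeff P 0:] * [:c:] = 1"
    by (simp add: one_pCons mult.commute)
  then have "from_poly N ([:coeff P 0:] * [:c:]) = 1"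
    by (simp only: from_poly_1)
  moreover define w where "w = from_poly N [:c:]"
  moreover have "h $ i0 = from_poly N [:coeff P 0:]"
    by (simp only: h_def f_def vec_lambda_beta if_True simp_thms)
  ultimately have w: "h $ i0 * w = 1"
    by (simp only: from_poly_mult)
  have hw: "h $ j * w * h $ i0 = h $ j" for j
  proof -
    have "h $ j * w * h $ i0 = h $ j * (h $ i0 * w)"
      by (simp only: mult_ac)
    then show ?thesis
      by (simp only: w mult_1_right)
  qed
  have "vec_equiv h (\<chi> j. if j = i0 then h $ i0 else h $ j + (- h $ j * w) * h $ i0)"
    by (rule vec_equiv_shear)
  also have "(\<chi> j. if j = i0 then h $ i0 else h $ j + (- h $ j * w) * h $ i0) = axis i0 (h $ i0)"
    by (simp add: vec_eq_iff axis_def hw)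
  also have "vec_equiv \<dots> (\<chi> j. (if j = i0 then w else 1) * axis i0 (h $ i0) $ j)"
  proof (rule vec_equiv_diag)
    show "(if j = i0 then w else 1) * (if j = i0 then h $ i0 else 1) = 1" for j
      using w by (simp only: mult.commute[of w] split: if_split) simp
  qed
  also have "\<dots> = axis i0 1"
    using w mult.commute[of "h $ i0" w] by (simp add: vec_eq_iff axis_def)
  finally have "vec_equiv h (axis i0 1)" .
  then show ?thesis
    using that vec_equiv_trans[OF xy vec_equiv_trans[OF fh]] by blast
qed

text \<open>Scaling rows and columns by the same units is a congruence and preserves rank one, so
  the matrix can be moved to polynomials. The normalizing factor \<open>u\<close> of the diagonal
  entry is not a congruence; its inverse is the \<open>\<epsilon>\<close> of the result.\<close>

theorem laurent_rank_one_symmetric: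
  fixes g :: "'i \<Rightarrow> 'i \<Rightarrow> 'k::field_char_0 laurent"
  assumes S: "finite S"
    and rank: "\<And>a i j. a \<in> S \<Longrightarrow> i \<in> S \<Longrightarrow> j \<in> S \<Longrightarrow> g a a * g i j = g a i * g a j"
    and unit: "(\<Sum>i\<in>S. \<Sum>j\<in>S. c i j * g i j) = 1"
  obtains \<epsilon> s where "\<epsilon> dvd 1" "\<And>i j. i \<in> S \<Longrightarrow> j \<in> S \<Longrightarrow> g i j = \<epsilon> * s i * s j"
proof -
  have "\<exists>i\<in>S. \<exists>j\<in>S. c i j * g i j \<noteq> 0"
    using unit by (metis (no_types, lifting) sum.neutral zero_neq_one)
  then obtain a j where a: "a \<in> S" "j \<in> S" "g a j \<noteq> 0"
    by auto
  then have "g a a \<noteq> 0"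
    using rank[of a j j] by auto
  then obtain N P u v where P: "from_poly N P = u * g a a" "u * v = 1" "lead_coeff P = 1" "coeff P 0 dvd 1"
    by (rule laurent_normalization) blast
  have fin: "finite (S \<times> S)"
    using S by simp
  obtain K :: nat where K: "\<And>ij K'. ij \<in> S \<times> S \<Longrightarrow> K' \<ge> int K \<Longrightarrow>
      \<exists>P. from_poly N P = tpow K' * (case ij of (i, j) \<Rightarrow> u * g i j)"
    using from_poly_surj[OF fin, of N "\<lambda>(i, j). u * g i j"] by metis
  \<comment> \<open>The zero at \<open>a\<close> keeps the normalized diagonal entry; every other
    pair of indices has \<open>e i + e j \<ge> int K\<close>, which clears the negative
    powers.\<close>
  define e where "e i = (if i = a then 0 else int K)" for i
  define \<mu> where "\<mu> i = (tpow (e i) :: 'k laurent)" for i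
  define \<mu>' where "\<mu>' i = (tpow (- e i) :: 'k laurent)" for i
  have \<mu>\<mu>': "\<mu> i * \<mu>' i = 1" for i
    unfolding \<mu>_def \<mu>'_def by (rule tpow_inverse)
  have "\<exists>P'. from_poly N P' = u * (\<mu> i * \<mu> j) * g i j \<and> (i = a \<and> j = a \<longrightarrow> P' = P)"
    if "i \<in> S" "j \<in> S" for i j
  proof (cases "i = a \<and> j = a")
    case True
    then show ?thesis
      using P(1) by (intro exI[of _ P]) (simp add: \<mu>_def e_def)
  next
    case False
    then have "e i + e j \<ge> int K"
      by (auto simp: e_def)
    then obtain P' where "from_poly N P' = tpow (e i + e j) * (u * g i j)"
      using K[of "(i, j)" "e i + e j"] \<open>i \<in> S\<close> \<open>j \<in> S\<close> by auto
    then show ?thesis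
      using False by (intro exI[of _ P']) (auto simp: \<mu>_def tpow_add mult_ac)
  qed
  then obtain G where G: "\<And>i j. i \<in> S \<Longrightarrow> j \<in> S \<Longrightarrow> from_poly N (G i j) = u * (\<mu> i * \<mu> j) * g i j"
    and Gaa: "G a a = P"
    using a(1) by metis
  have cancel: "g i j = v * (\<mu>' i * \<mu>' j) * from_poly N (G i j)" if "i \<in> S" "j \<in> S" for i j
  proof -
    have "v * (\<mu>' i * \<mu>' j) * from_poly N (G i j) = (u * v) * (\<mu> i * \<mu>' i) * (\<mu> j * \<mu>' j) * g i j"
      unfolding G[OF that] by (simp only: mult_ac)
    then show ?thesis
      by (simp add: P(2) \<mu>\<mu>')
  qed
  have "(\<Sum>ij\<in>S \<times> S. (case ij of (i, j) \<Rightarrow> c i j * (v * (\<mu>' i * \<mu>' j))) * from_poly N (case ij of (i, j) \<Rightarrow> G i j))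
      = (\<Sum>i\<in>S. \<Sum>j\<in>S. c i j * g i j)"
    unfolding sum.cartesian_product
    by (intro sum.cong refl) (auto simp: cancel mult.assoc)
  then have "(\<Sum>ij\<in>S \<times> S. (case ij of (i, j) \<Rightarrow> c i j * (v * (\<mu>' i * \<mu>' j))) * from_poly N (case ij of (i, j) \<Rightarrow> G i j)) = 1"
    unfolding unit .
  then obtain Q where "(\<Sum>ij\<in>S \<times> S. Q ij * (case ij of (i, j) \<Rightarrow> G i j)) = 1"
    using from_poly_unit_ideal[OF fin, of "(a, a)" "\<lambda>ij. case ij of (i, j) \<Rightarrow> G i j"] a(1) P(4) Gaa
    by auto
  then have Q: "(\<Sum>i\<in>S. \<Sum>j\<in>S. Q (i, j) * G i j) = 1"
    by (simp add: sum.cartesian_product split_def)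
  have rankG: "G a a * G i j = G a i * G a j" if "i \<in> S" "j \<in> S" for i j
  proof (rule from_poly_inject[of N])
    have "from_poly N (G a a * G i j) = u * u * (\<mu> a * \<mu> a * \<mu> i * \<mu> j) * (g a a * g i j)"
      unfolding from_poly_mult using that a(1) by (simp only: G mult_ac)
    also have "\<dots> = from_poly N (G a i * G a j)"
      unfolding from_poly_mult rank[OF a(1) that] using that a(1) by (simp only: G mult_ac)
    finally show "from_poly N (G a a * G i j) = from_poly N (G a i * G a j)" .
  qed
  have "(2 :: 'k laurent) * Poly_Mapping.single 0 (1 / 2) = 1"
    using mult_single[of "0 :: nat \<Rightarrow>\<^sub>0 int" "2 :: 'k" 0 "1 / 2"] by simp
  then have two: "(2 :: 'k laurent) dvd 1"
    by (metis dvd_triv_left)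
  have "lead_coeff (G a a) = 1"
    using Gaa P(3) by simp
  from rank_one_symmetric_monic[OF two S a(1) this rankG Q]
  obtain s where s: "\<And>i j. i \<in> S \<Longrightarrow> j \<in> S \<Longrightarrow> G i j = s i * s j"
    by blast
  show ?thesis
  proof (rule that[of v "\<lambda>i. \<mu>' i * from_poly N (s i)"])
    show "v dvd 1"
      using P(2) by (metis dvd_triv_right)
    show "g i j = v * (\<mu>' i * from_poly N (s i)) * (\<mu>' j * from_poly N (s j))" if "i \<in> S" "j \<in> S" for i j
      using cancel[OF that] s[OF that] by (simp add: from_poly_mult mult_ac)
  qed
qed

section \<open>Composition algebras\<close>

text \<open>Here the algebra is a whole type over a domain; carriers return in the descent. The
  polar form is only required to have zero radical: projections onto subalgebras will come from
  elements of unit norm.\<close>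

locale composition_algebra = Modules.module scale
  for scale :: "'r::idom \<Rightarrow> 'v::ab_group_add \<Rightarrow> 'v" (infixr \<open>*\<^sub>s\<close> 75) +
  fixes mult :: "'v \<Rightarrow> 'v \<Rightarrow> 'v" (infixl \<open>\<star>\<close> 70)
    and unit :: 'v
    and q :: "'v \<Rightarrow> 'r"
  assumes two: "(2::'r) dvd 1"
    and mult_add_left: "(x + y) \<star> z = x \<star> z + y \<star> z"
    and mult_add_right: "x \<star> (y + z) = x \<star> y + x \<star> z"
    and mult_scale_left: "(a *\<^sub>s x) \<star> y = a *\<^sub>s (x \<star> y)"
    and mult_scale_right: "x \<star> (a *\<^sub>s y) = a *\<^sub>s (x \<star> y)"
    and unit_left [simp]: "unit \<star> x = x"
    and unit_right [simp]: "x \<star> unit = x"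
    and q_scale: "q (a *\<^sub>s x) = a * a * q x"
    and q_mult: "q (x \<star> y) = q x * q y"
    and q_unit [simp]: "q unit = 1"
    and polar_add: "q (x + y + z) - q (x + y) - q z = (q (x + z) - q x - q z) + (q (y + z) - q y - q z)"
    and polar_scale: "q (a *\<^sub>s x + y) - q (a *\<^sub>s x) - q y = a * (q (x + y) - q x - q y)"
    and nondegenerate: "(\<And>y. q (x + y) - q x - q y = 0) \<Longrightarrow> x = 0"
begin

definition b :: "'v \<Rightarrow> 'v \<Rightarrow> 'r" where
  "b x y = q (x + y) - q x - q y"

lemma b_sym: "b x y = b y x"
  by (simp add: b_def add.commute)

lemma b_add_left: "b (x + y) z = b x z + b y z"
  unfolding b_def using polar_add[of x y z] by simp

lemma b_add_right: "b x (y + z) = b x y + b x z"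
  using b_add_left b_sym by metis

lemma b_scale_left: "b (a *\<^sub>s x) y = a * b x y"
  unfolding b_def using polar_scale by simp

lemma b_scale_right: "b x (a *\<^sub>s y) = a * b x y"
  using b_scale_left b_sym by metis

lemma b_0 [simp]: "b 0 x = 0" "b x 0 = 0"
  using b_scale_left[of 0 0 x] b_scale_right[of x 0 0] by simp_all

lemma b_minus_left: "b (- x) y = - b x y"
  using b_add_left[of x "- x" y] by (simp add: eq_neg_iff_add_eq_0 add.commute)

lemma b_minus_right: "b x (- y) = - b x y"
  using b_minus_left b_sym by metis

lemma b_diff_left: "b (x - y) z = b x z - b y z"
  using b_add_left[of x "- y" z] by (simp add: b_minus_left)

lemma b_diff_right: "b x (y - z) = b x y - b x z"
  using b_diff_left b_sym by metis

lemmas b_linear = b_add_left b_add_right b_scale_left b_scale_right b_minus_left b_minus_right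
  b_diff_left b_diff_right

lemma q_add: "q (x + y) = q x + q y + b x y"
  by (simp add: b_def)

lemma q_minus [simp]: "q (- x) = q x"
  using q_scale[of "- 1" x] by simp

lemma q_0 [simp]: "q 0 = 0"
  using q_scale[of 0 0] by simp

lemma q_diff: "q (x - y) = q x + q y - b x y"
  using q_add[of x "- y"] by (simp add: b_minus_right)

lemma b_self: "b x x = 2 * q x"
proof -
  have "q (x + x) = q (2 *\<^sub>s x)"
    by (metis one_add_one scale_left_distrib scale_one)
  also have "\<dots> = 4 * q x"
    by (simp add: q_scale)
  finally show ?thesis
    by (simp add: b_def)
qed

lemma b_eqI: "(\<And>z. b x z = b y z) \<Longrightarrow> x = y"
  using nondegenerate[of "x - y"] b_diff_left unfolding b_def[symmetric] by simp

lemma mult_0 [simp]: "0 \<star> x = 0" "x \<star> 0 = 0"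
  using mult_scale_left[of 0 0 x] mult_scale_right[of x 0 0] by simp_all

lemma mult_minus_left: "(- x) \<star> y = - (x \<star> y)"
  using mult_scale_left[of "- 1" x y] by simp

lemma mult_minus_right: "x \<star> (- y) = - (x \<star> y)"
  using mult_scale_right[of x "- 1" y] by simp

lemma mult_diff_left: "(x - y) \<star> z = x \<star> z - y \<star> z"
  using mult_add_left[of x "- y" z] by (simp add: mult_minus_left)

lemma mult_diff_right: "x \<star> (y - z) = x \<star> y - x \<star> z"
  using mult_add_right[of x y "- z"] by (simp add: mult_minus_right)

lemmas mult_linear = mult_add_left mult_add_right mult_scale_left mult_scale_right
  mult_minus_left mult_minus_right mult_diff_left mult_diff_right

lemma b_mult_left: "b (x \<star> y) (x \<star> z) = q x * b y z"
  unfolding b_def mult_add_right[symmetric] q_mult by (simp add: right_diff_distrib)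

lemma b_mult_right: "b (x \<star> y) (z \<star> y) = b x z * q y"
  unfolding b_def mult_add_left[symmetric] q_mult by (simp add: left_diff_distrib)

text \<open>Full polarization of \<open>q (x \<star> y) = q x * q y\<close>. Setting a factor to
  \<open>unit\<close> gives the adjoints of multiplications, and with nondegeneracy the alternative
  laws.\<close>

lemma b_mult_exchange: "b (x \<star> y) (z \<star> w) + b (z \<star> y) (x \<star> w) = b x z * b y w"
proof -
  have "b ((x + z) \<star> y) ((x + z) \<star> w) = q (x + z) * b y w"
    by (rule b_mult_left)
  then have "b (z \<star> y) (x \<star> w) + b (x \<star> y) (z \<star> w) = b x z * b y w"
    by (simp add: mult_add_left b_linear b_mult_left q_add distrib_right)
  then show ?thesis
    by (simp only: add.commute)
qed

definition cnj :: "'v \<Rightarrow> 'v" where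
  "cnj x = b x unit *\<^sub>s unit - x"

lemma b_unit_unit: "b unit unit = 2"
  by (simp add: b_self)

lemma b_cnj_unit [simp]: "b (cnj x) unit = b x unit"
  by (simp add: cnj_def b_linear b_unit_unit)

lemma cnj_cnj [simp]: "cnj (cnj x) = x"
  unfolding cnj_def[of "cnj x"] b_cnj_unit by (simp add: cnj_def)

lemma cnj_add: "cnj (x + y) = cnj x + cnj y"
  by (simp add: cnj_def b_linear scale_left_distrib)

lemma cnj_unit [simp]: "cnj unit = unit"
proof -
  have "cnj unit = (1 + 1 :: 'r) *\<^sub>s unit - unit"
    by (simp add: cnj_def b_unit_unit)
  then show ?thesis
    unfolding scale_left_distrib by simp
qed

lemma cnj_pure: "b x unit = 0 \<Longrightarrow> cnj x = - x"
  by (simp add: cnj_def)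

lemma q_cnj [simp]: "q (cnj x) = q x"
  by (simp add: cnj_def q_diff q_scale b_linear b_sym[of unit])

lemma b_cnj: "b (cnj x) y = b x (cnj y)"
  by (simp add: cnj_def b_linear b_sym[of unit] mult.commute)

lemma b_adjoint_left: "b (x \<star> y) z = b y (cnj x \<star> z)"
  using b_mult_exchange[of x y unit z] by (simp add: cnj_def mult_linear b_linear eq_diff_eq)

lemma b_adjoint_right: "b (x \<star> y) z = b x (z \<star> cnj y)"
  using b_mult_exchange[of x y z unit] by (simp add: cnj_def mult_linear b_linear eq_diff_eq b_sym[of x] mult.commute)

lemma cnj_mult_left: "cnj x \<star> (x \<star> y) = q x *\<^sub>s y"
  by (rule b_eqI) (simp add: b_adjoint_left[of "cnj x"] b_mult_left b_linear)

lemma mult_cnj_right: "(y \<star> x) \<star> cnj x = q x *\<^sub>s y"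
  by (rule b_eqI) (simp add: b_adjoint_right[of _ "cnj x"] b_mult_right b_linear mult.commute)

lemma cnj_mult_left': "x \<star> (cnj x \<star> y) = q x *\<^sub>s y"
  using cnj_mult_left[of "cnj x" y] by simp

lemma mult_cnj_right': "(y \<star> cnj x) \<star> x = q x *\<^sub>s y"
  using mult_cnj_right[of y "cnj x"] by simp

lemma cnj_mult_exchange: "cnj x \<star> (z \<star> y) + cnj z \<star> (x \<star> y) = b x z *\<^sub>s y"
proof -
  have "cnj (x + z) \<star> ((x + z) \<star> y) = q (x + z) *\<^sub>s y"
    by (rule cnj_mult_left)
  then show ?thesis
    by (simp add: cnj_add mult_linear cnj_mult_left q_add scale_left_distrib algebra_simps)
qed

lemma cnj_mult: "cnj (x \<star> y) = cnj y \<star> cnj x"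
proof (rule b_eqI)
  fix z
  have "b (cnj (x \<star> y)) z = b (x \<star> y) (cnj z)"
    by (rule b_cnj)
  moreover have "b (cnj y \<star> cnj x) z = b (cnj x) (y \<star> z)"
    by (simp add: b_adjoint_left[of "cnj y"])
  moreover have "\<dots> = b x (cnj (y \<star> z))"
    by (rule b_cnj)
  moreover have "b x (cnj (y \<star> z)) = b (x \<star> y) (cnj z)"
  proof -
    have "b x (cnj (y \<star> z)) = b (cnj x) (y \<star> z)"
      by (simp add: b_cnj)
    also have "\<dots> = b y (cnj x \<star> cnj z)"
      using b_adjoint_right[of y z "cnj x"] by (simp add: b_sym)
    also have "\<dots> = b (x \<star> y) (cnj z)"
      by (simp add: b_adjoint_left[of x])
    finally show ?thesis .
  qed
  ultimately show "b (cnj (x \<star> y)) z = b (cnj y \<star> cnj x) z"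
    by simp
qed

lemma pure_mult_left: "b x unit = 0 \<Longrightarrow> x \<star> (x \<star> y) = - (q x *\<^sub>s y)"
proof -
  assume x: "b x unit = 0"
  have "- (x \<star> (x \<star> y)) = q x *\<^sub>s y"
    using cnj_mult_left[of x y] by (simp only: cnj_pure[OF x] mult_minus_left)
  from this[symmetric] show ?thesis
    by simp
qed

lemma pure_anticommute:
  "b x unit = 0 \<Longrightarrow> b z unit = 0 \<Longrightarrow> x \<star> (z \<star> y) + z \<star> (x \<star> y) = - (b x z *\<^sub>s y)"
proof -
  assume x: "b x unit = 0" and z: "b z unit = 0"
  have "- (x \<star> (z \<star> y)) + - (z \<star> (x \<star> y)) = b x z *\<^sub>s y"
    using cnj_mult_exchange[of x z y] by (simp only: cnj_pure[OF x] cnj_pure[OF z] mult_minus_left)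
  from this[symmetric] show ?thesis
    by simp
qed

lemma b_pure_adjoint: "b x unit = 0 \<Longrightarrow> b (x \<star> y) z = - b y (x \<star> z)"
  by (simp add: b_adjoint_left[of x] cnj_pure mult_linear b_linear)

lemma orthogonal_cnj: "b l unit = 0 \<Longrightarrow> b l x = 0 \<Longrightarrow> b l (cnj x) = 0"
  by (simp add: cnj_def b_linear)

section \<open>Cayley-Dickson doubling\<close>

lemma commute_orthogonal:
  assumes "b l unit = 0" "b l x = 0"
  shows "x \<star> l = l \<star> cnj x" "cnj (x \<star> l) = - (x \<star> l)"
proof -
  have "b (x \<star> l) unit = 0"
    using orthogonal_cnj[OF assms] by (simp add: b_adjoint_left[of x])
  then show 1: "cnj (x \<star> l) = - (x \<star> l)"
    by (rule cnj_pure)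
  show "x \<star> l = l \<star> cnj x"
    using 1 unfolding cnj_mult cnj_pure[OF assms(1)] mult_minus_left by simp
qed

text \<open>The doubling rules are stated for an \<open>l\<close> orthogonal to just the elements
  that occur, so that they also apply to elements such as \<open>y \<star> k\<close>, which need not
  be fixed in advance.\<close>

lemma doubling_mult_left:
  assumes "b l unit = 0" "b l x = 0" "b l y = 0" "b l (y \<star> x) = 0"
  shows "x \<star> (y \<star> l) = (y \<star> x) \<star> l"
proof -
  have "cnj (cnj x) \<star> (l \<star> cnj y) + cnj l \<star> (cnj x \<star> cnj y) = b (cnj x) l *\<^sub>s cnj y"
    by (rule cnj_mult_exchange)
  then have "x \<star> (l \<star> cnj y) = l \<star> cnj (y \<star> x)"
    using orthogonal_cnj[OF assms(1,2)] by (simp add: cnj_pure[OF assms(1)] mult_linear cnj_mult b_sym)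
  then show ?thesis
    using commute_orthogonal(1)[OF assms(1,3)] commute_orthogonal(1)[OF assms(1,4)] by simp
qed

lemma doubling_mult_right:
  assumes "b l unit = 0" "b l x = 0" "b l y = 0" "b l (x \<star> cnj y) = 0"
  shows "(x \<star> l) \<star> y = (x \<star> cnj y) \<star> l"
proof -
  have "cnj ((x \<star> l) \<star> y) = - (cnj y \<star> (x \<star> l))"
    unfolding cnj_mult[of "x \<star> l"] commute_orthogonal(2)[OF assms(1,2)] by (rule mult_minus_right)
  also have "\<dots> = - ((x \<star> cnj y) \<star> l)"
    using doubling_mult_left[of l "cnj y" x] assms orthogonal_cnj by simp
  also have "\<dots> = cnj ((x \<star> cnj y) \<star> l)"
    using commute_orthogonal(2)[OF assms(1,4)] by simp
  finally show ?thesis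
    by (metis cnj_cnj)
qed

lemma doubling_mult_both:
  assumes "b l unit = 0" "b l x = 0" "b l (cnj x \<star> y) = 0"
  shows "(x \<star> l) \<star> (y \<star> l) = - (q l *\<^sub>s (cnj y \<star> x))"
proof -
  have "b (x \<star> l) y = 0"
    using assms(3) by (simp add: b_adjoint_left[of x])
  moreover have "cnj (x \<star> l) \<star> (y \<star> l) + cnj y \<star> ((x \<star> l) \<star> l) = b (x \<star> l) y *\<^sub>s l"
    by (rule cnj_mult_exchange)
  ultimately have "(x \<star> l) \<star> (y \<star> l) = cnj y \<star> ((x \<star> l) \<star> l)"
    using commute_orthogonal(2)[OF assms(1,2)] by (simp add: mult_linear)
  moreover have "(x \<star> l) \<star> l = - (q l *\<^sub>s x)"
    using mult_cnj_right[of x l] by (simp add: cnj_pure[OF assms(1)] mult_linear minus_equation_iff)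
  ultimately show ?thesis
    by (simp add: mult_linear)
qed

definition subalgebra :: "'v set \<Rightarrow> bool" where
  "subalgebra H \<longleftrightarrow> unit \<in> H \<and> (\<forall>x\<in>H. \<forall>y\<in>H. x + y \<in> H \<and> x \<star> y \<in> H) \<and> (\<forall>a. \<forall>x\<in>H. a *\<^sub>s x \<in> H)"

text \<open>Existence of an orthogonal projection onto \<open>H\<close>; this plays the part of
  regularity of the restricted form.\<close>

definition splits :: "'v set \<Rightarrow> bool" where
  "splits H \<longleftrightarrow> (\<forall>z. \<exists>h\<in>H. \<forall>w\<in>H. b (z - h) w = 0)"

definition double :: "'v set \<Rightarrow> 'v \<Rightarrow> 'v set" where
  "double H l = {x + y \<star> l | x y. x \<in> H \<and> y \<in> H}"

lemma subalgebra_cnj: "subalgebra H \<Longrightarrow> x \<in> H \<Longrightarrow> cnj x \<in> H"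
proof -
  assume H: "subalgebra H" "x \<in> H"
  have "cnj x = b x unit *\<^sub>s unit + (- 1) *\<^sub>s x"
    by (simp add: cnj_def)
  then show "cnj x \<in> H"
    using H unfolding subalgebra_def by metis
qed

lemma double_orthogonal:
  assumes "subalgebra H" "\<And>x. x \<in> H \<Longrightarrow> b l x = 0" "x \<in> H" "y \<in> H"
  shows "b x (y \<star> l) = 0"
proof -
  have "cnj y \<star> x \<in> H"
    using assms(1,3,4) subalgebra_cnj unfolding subalgebra_def by blast
  then show ?thesis
    using assms(2) by (simp add: b_sym[of x] b_adjoint_left[of y])
qed

lemma double_mult:
  assumes H: "subalgebra H" and l: "\<And>x. x \<in> H \<Longrightarrow> b l x = 0"
    and mem: "x \<in> H" "y \<in> H" "z \<in> H" "w \<in> H"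
  shows "(x + y \<star> l) \<star> (z + w \<star> l)
    = (x \<star> z + (- q l) *\<^sub>s (cnj w \<star> y)) + (w \<star> x + y \<star> cnj z) \<star> l"
proof -
  have cl: "unit \<in> H" "\<And>x y. x \<in> H \<Longrightarrow> y \<in> H \<Longrightarrow> x \<star> y \<in> H" "\<And>x. x \<in> H \<Longrightarrow> cnj x \<in> H"
    using H subalgebra_cnj unfolding subalgebra_def by blast+
  have "x \<star> (w \<star> l) = (w \<star> x) \<star> l" "(y \<star> l) \<star> z = (y \<star> cnj z) \<star> l"
    "(y \<star> l) \<star> (w \<star> l) = - (q l *\<^sub>s (cnj w \<star> y))"
    using l cl mem by (simp_all add: doubling_mult_left doubling_mult_right doubling_mult_both)
  then show ?thesis
    by (simp add: mult_linear add_ac)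
qed

lemma subalgebra_double:
  assumes H: "subalgebra H" and l: "\<And>x. x \<in> H \<Longrightarrow> b l x = 0"
  shows "subalgebra (double H l)"
proof -
  have cl: "unit \<in> H" "\<And>x y. x \<in> H \<Longrightarrow> y \<in> H \<Longrightarrow> x \<star> y \<in> H" "\<And>x. x \<in> H \<Longrightarrow> cnj x \<in> H"
    "\<And>x y. x \<in> H \<Longrightarrow> y \<in> H \<Longrightarrow> x + y \<in> H" "\<And>a x. x \<in> H \<Longrightarrow> a *\<^sub>s x \<in> H"
    using H subalgebra_cnj unfolding subalgebra_def by blast+
  have zero: "0 \<in> H"
    using cl(5)[OF cl(1), of 0] by simp
  have mem: "x + y \<star> l \<in> double H l" if "x \<in> H" "y \<in> H" for x y
    using that unfolding double_def by blast
  have "unit \<in> double H l"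
    using mem[OF cl(1) zero] by simp
  moreover have "u + v \<in> double H l \<and> u \<star> v \<in> double H l" if uv: "u \<in> double H l" "v \<in> double H l" for u v
  proof -
    obtain x y z w where d: "u = x + y \<star> l" "v = z + w \<star> l" and m: "x \<in> H" "y \<in> H" "z \<in> H" "w \<in> H"
      using uv unfolding double_def by blast
    have "u + v = (x + z) + (y + w) \<star> l"
      unfolding d by (simp add: mult_linear add_ac)
    moreover have "(x + z) + (y + w) \<star> l \<in> double H l"
      by (intro mem cl m)
    moreover have "u \<star> v = (x \<star> z + (- q l) *\<^sub>s (cnj w \<star> y)) + (w \<star> x + y \<star> cnj z) \<star> l"
      unfolding d by (rule double_mult[OF H _ m]) (rule l)
    moreover have "(x \<star> z + (- q l) *\<^sub>s (cnj w \<star> y)) + (w \<star> x + y \<star> cnj z) \<star> l \<in> double H l"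
      by (intro mem cl m)
    ultimately show ?thesis
      by simp
  qed
  moreover have "a *\<^sub>s u \<in> double H l" if u: "u \<in> double H l" for a u
  proof -
    obtain x y where d: "u = x + y \<star> l" and m: "x \<in> H" "y \<in> H"
      using u unfolding double_def by blast
    have "a *\<^sub>s u = a *\<^sub>s x + (a *\<^sub>s y) \<star> l"
      unfolding d by (simp add: mult_linear scale_right_distrib)
    moreover have "a *\<^sub>s x + (a *\<^sub>s y) \<star> l \<in> double H l"
      by (intro mem cl m)
    ultimately show ?thesis
      by simp
  qed
  ultimately show ?thesis
    unfolding subalgebra_def by blast
qed

text \<open>Right multiplication by \<open>l\<close> is a similitude of factor \<open>q l\<close>, a
  unit, with inverse \<open>c\<close> times right multiplication by \<open>cnj l\<close>. It carries
  the projection onto \<open>H\<close> to one onto the second half of the double.\<close>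

lemma splits_double:
  assumes H: "subalgebra H" and l: "\<And>x. x \<in> H \<Longrightarrow> b l x = 0" and u: "q l dvd 1" and s: "splits H"
  shows "splits (double H l)"
  unfolding splits_def
proof
  fix z
  obtain c where c: "q l * c = 1"
    using u by (metis dvdE)
  obtain h where h: "h \<in> H" "\<And>w. w \<in> H \<Longrightarrow> b (z - h) w = 0"
    using s unfolding splits_def by blast
  define z' where "z' = c *\<^sub>s ((z - h) \<star> cnj l)"
  obtain y where y: "y \<in> H" "\<And>w. w \<in> H \<Longrightarrow> b (z' - y) w = 0"
    using s unfolding splits_def by blast
  have "b (z - (h + y \<star> l)) w = 0" if wl: "w \<in> double H l" for w
  proof -
    obtain w1 w2 where w: "w = w1 + w2 \<star> l" "w1 \<in> H" "w2 \<in> H"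
      using wl unfolding double_def by blast
    have "b (y \<star> l) w1 = 0" "b h (w2 \<star> l) = 0"
      using double_orthogonal[OF H l] w h(1) y(1) b_sym by metis+
    moreover have "b (y \<star> l) (w2 \<star> l) = b z' w2 * q l"
      using y(2)[OF w(3)] by (simp add: b_mult_right b_linear)
    moreover have "b z' w2 * q l = b (z - h) (w2 \<star> l)"
    proof -
      have "b z' w2 = c * b (z - h) (w2 \<star> l)"
        unfolding z'_def by (simp add: b_scale_left b_adjoint_right[of _ "cnj l"])
      then show ?thesis
        using c by (metis mult.assoc mult.commute mult_1)
    qed
    ultimately show ?thesis
      using h(2)[OF w(2)] unfolding w(1) by (simp add: b_linear algebra_simps)
  qed
  moreover have "h + y \<star> l \<in> double H l"
    using h y unfolding double_def by blast
  ultimately show "\<exists>h\<in>double H l. \<forall>w\<in>double H l. b (z - h) w = 0"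
    by blast
qed

definition scalars :: "'v set" where
  "scalars = {a *\<^sub>s unit | a. True}"

lemma subalgebra_scalars: "subalgebra scalars"
  unfolding subalgebra_def
proof (intro conjI ballI allI)
  show "unit \<in> scalars"
    unfolding scalars_def by (metis (mono_tags, lifting) mem_Collect_eq scale_one)
  fix x assume "x \<in> scalars"
  then obtain a where x: "x = a *\<^sub>s unit"
    unfolding scalars_def by blast
  show "c *\<^sub>s x \<in> scalars" for c
    unfolding x scalars_def by auto
  fix y assume "y \<in> scalars"
  then obtain c where y: "y = c *\<^sub>s unit"
    unfolding scalars_def by blast
  have "x + y = (a + c) *\<^sub>s unit" "x \<star> y = (a * c) *\<^sub>s unit"
    unfolding x y by (simp_all add: scale_left_distrib mult_linear mult.commute)
  then show "x + y \<in> scalars" "x \<star> y \<in> scalars"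
    unfolding scalars_def by blast+
qed

lemma splits_scalars: "splits scalars"
  unfolding splits_def
proof
  fix z
  obtain h :: 'r where h: "1 = 2 * h"
    using two by (metis dvdE)
  let ?s = "(h * b z unit) *\<^sub>s unit"
  have "b ?s unit = b z unit"
    using h by (simp add: b_scale_left b_unit_unit mult_ac)
  then have "\<forall>w\<in>scalars. b (z - ?s) w = 0"
    unfolding scalars_def by (auto simp: b_scale_right b_diff_left)
  moreover have "?s \<in> scalars"
    unfolding scalars_def by blast
  ultimately show "\<exists>h\<in>scalars. \<forall>w\<in>scalars. b (z - h) w = 0"
    by blast
qed

definition cayley_triple :: "'v \<Rightarrow> 'v \<Rightarrow> 'v \<Rightarrow> bool" where
  "cayley_triple i j l \<longleftrightarrow> q i dvd 1 \<and> q j dvd 1 \<and> q l dvd 1 \<and> b i unit = 0 \<and> b j unit = 0 \<and> b j i = 0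
    \<and> b l unit = 0 \<and> b l i = 0 \<and> b l j = 0 \<and> b l (i \<star> j) = 0"

lemma cayley_triple_orthogonal:
  assumes "cayley_triple i j l"
  shows "x \<in> scalars \<Longrightarrow> b i x = 0"
    and "x \<in> double scalars i \<Longrightarrow> b j x = 0"
    and "x \<in> double (double scalars i) j \<Longrightarrow> b l x = 0"
proof -
  note t = assms[unfolded cayley_triple_def]
  have s: "b i x = 0" "b j x = 0" "b l x = 0" "b l (x \<star> j) = 0" if x: "x \<in> scalars" for x
  proof -
    obtain a where "x = a *\<^sub>s unit"
      using x unfolding scalars_def by blast
    then show "b i x = 0" "b j x = 0" "b l x = 0" "b l (x \<star> j) = 0"
      using t by (simp_all add: b_scale_right mult_scale_left)
  qed
  have d: "b j x = 0" "b l x = 0" "b l (x \<star> j) = 0" if x: "x \<in> double scalars i" for x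
  proof -
    obtain y a where y: "y \<in> scalars" "x = y + (a *\<^sub>s unit) \<star> i"
      using x unfolding double_def scalars_def by blast
    show "b j x = 0" "b l x = 0" "b l (x \<star> j) = 0"
      unfolding y(2) using t s[OF y(1)] by (simp_all add: b_linear mult_linear)
  qed
  show "x \<in> scalars \<Longrightarrow> b i x = 0" "x \<in> double scalars i \<Longrightarrow> b j x = 0"
    using s d by blast+
  assume "x \<in> double (double scalars i) j"
  then obtain y z where "x = y + z \<star> j" "y \<in> double scalars i" "z \<in> double scalars i"
    unfolding double_def[of "double scalars i"] by blast
  then show "b l x = 0"
    using d by (simp add: b_add_right)
qed

text \<open>
  An element orthogonal to the doubled algebra is killed by all its associators (Hurwitz), and
  \<open>i (j l) - (i j) l = - 2 (i j) l\<close> has unit norm.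
\<close>

lemma cayley_triple_spans:
  assumes t: "cayley_triple i j l"
  shows "double (double (double scalars i) j) l = UNIV"
proof -
  let ?H1 = "double scalars i"
  let ?H2 = "double ?H1 j"
  let ?H3 = "double ?H2 l"
  have u: "q i dvd 1" "q j dvd 1" "q l dvd 1"
    using t unfolding cayley_triple_def by auto
  note o = cayley_triple_orthogonal[OF t]
  have s: "subalgebra ?H1" "subalgebra ?H2" "subalgebra ?H3"
    using subalgebra_double[OF subalgebra_scalars o(1)] subalgebra_double[OF _ o(2)] subalgebra_double[OF _ o(3)]
    by blast+
  have sp: "splits ?H3"
    using splits_double[OF s(2) o(3) u(3)] splits_double[OF s(1) o(2) u(2)]
      splits_double[OF subalgebra_scalars o(1) u(1) splits_scalars] by blast
  have cl: "unit \<in> H" "0 \<in> H" "x \<in> H \<Longrightarrow> y \<in> H \<Longrightarrow> x \<star> y \<in> H" if "subalgebra H" for H x y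
  proof -
    show "0 \<in> H"
      using that unfolding subalgebra_def by (metis scale_zero_left)
  qed (use that in \<open>auto simp: subalgebra_def\<close>)
  have mem: "x \<in> double H k" "k \<in> double H k" if "subalgebra H" "x \<in> H" for H x k
  proof -
    have "x = x + 0 \<star> k" "k = 0 + unit \<star> k"
      by simp_all
    then show "x \<in> double H k" "k \<in> double H k"
      using cl(1,2)[OF that(1)] that(2) unfolding double_def by blast+
  qed
  have i2: "i \<in> ?H2" and j2: "j \<in> ?H2"
    using mem cl(1) s(1) subalgebra_scalars by blast+
  have m3: "i \<in> ?H3" "j \<in> ?H3" "l \<in> ?H3"
    using mem(1)[OF s(2) i2] mem(1)[OF s(2) j2] mem(2)[OF s(2) i2] by blast+
  have "z \<in> ?H3" for z
  proof -
    obtain h where h: "h \<in> ?H3" "\<And>w. w \<in> ?H3 \<Longrightarrow> b (z - h) w = 0"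
      using sp unfolding splits_def by blast
    define k where "k = z - h"
    have k: "b k w = 0" if "w \<in> ?H3" for w
      unfolding k_def using h(2)[OF that] .
    have D: "x \<star> (y \<star> k) = (y \<star> x) \<star> k" if "x \<in> ?H3" "y \<in> ?H3" for x y
      using doubling_mult_left[of k x y] k cl[OF s(3)] that by blast
    have "b (y \<star> k) w = 0" if "y \<in> ?H3" "w \<in> ?H3" for y w
      using double_orthogonal[OF s(3) k that(2,1)] by (simp add: b_sym)
    then have D': "x \<star> (w \<star> (y \<star> k)) = (w \<star> x) \<star> (y \<star> k)" if "x \<in> ?H3" "y \<in> ?H3" "w \<in> ?H3" for x y w
      using doubling_mult_left[of "y \<star> k" x w] cl[OF s(3)] that by blast
    \<comment> \<open>This product is evaluated in two ways: \<open>D'\<close> takes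
      \<open>i \<star> k\<close> as the orthogonal element, repeated use of \<open>D\<close> takes
      \<open>k\<close>.\<close>
    have "l \<star> (j \<star> (i \<star> k)) = (j \<star> l) \<star> (i \<star> k)"
      using D' m3 by blast
    then have "((i \<star> j) \<star> l) \<star> k = (i \<star> (j \<star> l)) \<star> k"
      using D cl(3)[OF s(3)] m3 by metis
    moreover have "i \<star> (j \<star> l) = (j \<star> i) \<star> l"
      using doubling_mult_left[of l i j] o(3) cl[OF s(2)] i2 j2 by blast
    moreover have "j \<star> i = - (i \<star> j)"
      using pure_anticommute[of j i unit] t unfolding cayley_triple_def by (simp add: eq_neg_iff_add_eq_0)
    ultimately have "((i \<star> j) \<star> l) \<star> k = - (((i \<star> j) \<star> l) \<star> k)"
      by (simp add: mult_linear)
    moreover define p where "p = (i \<star> j) \<star> l"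
    ultimately have "p \<star> k + p \<star> k = 0"
      by (metis add.right_inverse)
    then have "2 *\<^sub>s (p \<star> k) = 0"
      by (metis one_add_one scale_left_distrib scale_one)
    moreover obtain c where "1 = 2 * (c::'r)"
      using two by (metis dvdE)
    ultimately have "p \<star> k = 0"
      by (metis mult.commute scale_one scale_scale scale_zero_right)
    then have "q p *\<^sub>s k = 0"
      using cnj_mult_left[of p k] by simp
    moreover have "q p dvd 1"
      unfolding p_def using mult_dvd_mono[OF mult_dvd_mono[OF u(1,2)] u(3)] by (simp add: q_mult)
    then obtain d where "1 = q p * d"
      by (metis dvdE)
    ultimately have "k = 0"
      by (metis mult.commute scale_one scale_scale scale_zero_right)
    then show ?thesis
      using h(1) unfolding k_def by simp
  qed
  then show ?thesis
    by blast
qed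

end

lemma fst_image_iff: "x \<in> fst ` G \<longleftrightarrow> (\<exists>y. (x, y) \<in> G)"
  by (simp add: image_iff Bex_def split_paired_Ex)

lemma snd_image_iff: "y \<in> snd ` G \<longleftrightarrow> (\<exists>x. (x, y) \<in> G)"
  by (simp add: image_iff Bex_def split_paired_Ex)

section \<open>Isomorphisms from Cayley triples\<close>

locale composition_algebra_pair =
  A: composition_algebra scale mult unit q + B: composition_algebra scale mult' unit' q'
  for scale :: "'r::idom \<Rightarrow> 'v::ab_group_add \<Rightarrow> 'v" (infixr \<open>*\<^sub>s\<close> 75)
    and mult (infixl \<open>\<star>\<close> 70) and unit q and mult' (infixl \<open>\<star>''\<close> 70) and unit' q'
begin

text \<open>Partial isomorphisms are represented by their graphs, so that no choice of coordinates is needed.\<close>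

definition iso_graph :: "('v \<times> 'v) set \<Rightarrow> bool" where
  "iso_graph G \<longleftrightarrow> (unit, unit') \<in> G
    \<and> (\<forall>x x'. (x, x') \<in> G \<longrightarrow> q x = q' x' \<and> (\<forall>a. (a *\<^sub>s x, a *\<^sub>s x') \<in> G))
    \<and> (\<forall>x x' y y'. (x, x') \<in> G \<longrightarrow> (y, y') \<in> G \<longrightarrow> (x + y, x' + y') \<in> G \<and> (x \<star> y, x' \<star>' y') \<in> G)"

definition double_graph :: "('v \<times> 'v) set \<Rightarrow> 'v \<Rightarrow> 'v \<Rightarrow> ('v \<times> 'v) set" where
  "double_graph G l l' = {(x + y \<star> l, x' + y' \<star>' l') | x x' y y'. (x, x') \<in> G \<and> (y, y') \<in> G}"

lemma iso_graphD:
  assumes "iso_graph G"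
  shows "(unit, unit') \<in> G" "(x, x') \<in> G \<Longrightarrow> q x = q' x'" "(x, x') \<in> G \<Longrightarrow> (a *\<^sub>s x, a *\<^sub>s x') \<in> G"
    "(x, x') \<in> G \<Longrightarrow> (y, y') \<in> G \<Longrightarrow> (x + y, x' + y') \<in> G"
    "(x, x') \<in> G \<Longrightarrow> (y, y') \<in> G \<Longrightarrow> (x \<star> y, x' \<star>' y') \<in> G"
proof -
  note G = assms[unfolded iso_graph_def]
  show "(unit, unit') \<in> G"
    using G by (elim conjE)
  show "(x, x') \<in> G \<Longrightarrow> q x = q' x'" "(x, x') \<in> G \<Longrightarrow> (a *\<^sub>s x, a *\<^sub>s x') \<in> G"
    using G by (elim conjE, simp)+
  show "(x, x') \<in> G \<Longrightarrow> (y, y') \<in> G \<Longrightarrow> (x + y, x' + y') \<in> G"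
    "(x, x') \<in> G \<Longrightarrow> (y, y') \<in> G \<Longrightarrow> (x \<star> y, x' \<star>' y') \<in> G"
    using G by (elim conjE, simp)+
qed

lemma iso_graph_b:
  assumes "iso_graph G" "(x, x') \<in> G" "(y, y') \<in> G"
  shows "A.b x y = B.b x' y'"
  using iso_graphD(2)[OF assms(1) iso_graphD(4)[OF assms]] iso_graphD(2)[OF assms(1,2)]
    iso_graphD(2)[OF assms(1,3)] by (simp add: A.b_def B.b_def)

lemma iso_graph_cnj:
  assumes G: "iso_graph G" and x: "(x, x') \<in> G"
  shows "(A.cnj x, B.cnj x') \<in> G"
proof -
  have "(A.b x unit *\<^sub>s unit + (- 1) *\<^sub>s x, A.b x unit *\<^sub>s unit' + (- 1) *\<^sub>s x') \<in> G"
    by (intro iso_graphD(3,4)[OF G] iso_graphD(1)[OF G] x)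
  then show ?thesis
    using iso_graph_b[OF G x iso_graphD(1)[OF G]] unfolding A.cnj_def B.cnj_def by simp
qed

lemma iso_graph_subalgebra:
  assumes "iso_graph G"
  shows "A.subalgebra (fst ` G)" "B.subalgebra (snd ` G)"
proof -
  note G = iso_graphD[OF assms]
  show "A.subalgebra (fst ` G)"
    unfolding A.subalgebra_def fst_image_iff
  proof (intro conjI ballI allI)
    show "\<exists>y. (unit, y) \<in> G"
      using G(1) by blast
    fix x assume "x \<in> fst ` G"
    then obtain x' where x: "(x, x') \<in> G"
      unfolding fst_image_iff by blast
    show "\<exists>y. (a *\<^sub>s x, y) \<in> G" for a
      using G(3)[OF x, of a] by blast
    fix y assume "y \<in> fst ` G"
    then obtain y' where y: "(y, y') \<in> G"
      unfolding fst_image_iff by blast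
    show "\<exists>z. (x + y, z) \<in> G" "\<exists>z. (x \<star> y, z) \<in> G"
      using G(4)[OF x y] G(5)[OF x y] by blast+
  qed
  show "B.subalgebra (snd ` G)"
    unfolding B.subalgebra_def snd_image_iff
  proof (intro conjI ballI allI)
    show "\<exists>y. (y, unit') \<in> G"
      using G(1) by blast
    fix x' assume "x' \<in> snd ` G"
    then obtain x where x: "(x, x') \<in> G"
      unfolding snd_image_iff by blast
    show "\<exists>y. (y, a *\<^sub>s x') \<in> G" for a
      using G(3)[OF x, of a] by blast
    fix y' assume "y' \<in> snd ` G"
    then obtain y where y: "(y, y') \<in> G"
      unfolding snd_image_iff by blast
    show "\<exists>z. (z, x' + y') \<in> G" "\<exists>z. (z, x' \<star>' y') \<in> G"
      using G(4)[OF x y] G(5)[OF x y] by blast+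
  qed
qed

lemma fst_double_graph: "fst ` double_graph G l l' = A.double (fst ` G) l"
proof (intro Set.set_eqI iffI)
  fix u assume "u \<in> fst ` double_graph G l l'"
  then obtain u' where "(u, u') \<in> double_graph G l l'"
    unfolding fst_image_iff by blast
  then obtain x x' y y' where "u = x + y \<star> l" "(x, x') \<in> G" "(y, y') \<in> G"
    unfolding double_graph_def by blast
  then show "u \<in> A.double (fst ` G) l"
    unfolding A.double_def fst_image_iff by blast
next
  fix u assume "u \<in> A.double (fst ` G) l"
  then obtain x x' y y' where u: "u = x + y \<star> l" and "(x, x') \<in> G" "(y, y') \<in> G"
    unfolding A.double_def fst_image_iff by blast
  then have "(u, x' + y' \<star>' l') \<in> double_graph G l l'"
    unfolding double_graph_def by blast
  then show "u \<in> fst ` double_graph G l l'"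
    unfolding fst_image_iff by blast
qed

lemma snd_double_graph: "snd ` double_graph G l l' = B.double (snd ` G) l'"
proof (intro Set.set_eqI iffI)
  fix u' assume "u' \<in> snd ` double_graph G l l'"
  then obtain u where "(u, u') \<in> double_graph G l l'"
    unfolding snd_image_iff by blast
  then obtain x x' y y' where "u' = x' + y' \<star>' l'" "(x, x') \<in> G" "(y, y') \<in> G"
    unfolding double_graph_def by blast
  then show "u' \<in> B.double (snd ` G) l'"
    unfolding B.double_def snd_image_iff by blast
next
  fix u' assume "u' \<in> B.double (snd ` G) l'"
  then obtain x x' y y' where u: "u' = x' + y' \<star>' l'" and "(x, x') \<in> G" "(y, y') \<in> G"
    unfolding B.double_def snd_image_iff by blast
  then have "(x + y \<star> l, u') \<in> double_graph G l l'"
    unfolding double_graph_def by blast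
  then show "u' \<in> snd ` double_graph G l l'"
    unfolding snd_image_iff by blast
qed

text \<open>Norm and product on a double depend only on the smaller algebra and on the norm of the
  new element, so a partial isomorphism extends as soon as the two new norms agree.\<close>

lemma iso_graph_double:
  assumes G: "iso_graph G" and l: "\<And>x. x \<in> fst ` G \<Longrightarrow> A.b l x = 0" and l': "\<And>x. x \<in> snd ` G \<Longrightarrow> B.b l' x = 0"
    and ql: "q l = q' l'"
  shows "iso_graph (double_graph G l l')"
proof -
  note S = iso_graph_subalgebra[OF G]
  have mem: "(x + y \<star> l, x' + y' \<star>' l') \<in> double_graph G l l'" if "(x, x') \<in> G" "(y, y') \<in> G" for x x' y y'
    using that unfolding double_graph_def by blast
  have fs: "x \<in> fst ` G" "x' \<in> snd ` G" if "(x, x') \<in> G" for x x'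
    using that unfolding fst_image_iff snd_image_iff by blast+
  have "(0 *\<^sub>s unit, 0 *\<^sub>s unit') \<in> G"
    by (rule iso_graphD(3)[OF G iso_graphD(1)[OF G]])
  then have zero: "(0, 0) \<in> G"
    by simp
  have "(unit, unit') \<in> double_graph G l l'"
    using mem[OF iso_graphD(1)[OF G] zero] by simp
  moreover have "q u = q' u' \<and> (\<forall>a. (a *\<^sub>s u, a *\<^sub>s u') \<in> double_graph G l l')"
    if u: "(u, u') \<in> double_graph G l l'" for u u'
  proof -
    obtain x x' y y' where d: "u = x + y \<star> l" "u' = x' + y' \<star>' l'" and m: "(x, x') \<in> G" "(y, y') \<in> G"
      using u unfolding double_graph_def by blast
    have "A.b x (y \<star> l) = 0"
      by (intro A.double_orthogonal[OF S(1) l] fs[OF m(1)] fs[OF m(2)])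
    moreover have "B.b x' (y' \<star>' l') = 0"
      by (intro B.double_orthogonal[OF S(2) l'] fs[OF m(1)] fs[OF m(2)])
    ultimately have "q u = q' u'"
      unfolding d A.q_add B.q_add A.q_mult B.q_mult
      using iso_graphD(2)[OF G m(1)] iso_graphD(2)[OF G m(2)] ql by (simp only:)
    moreover have "a *\<^sub>s u = a *\<^sub>s x + (a *\<^sub>s y) \<star> l" "a *\<^sub>s u' = a *\<^sub>s x' + (a *\<^sub>s y') \<star>' l'" for a
      unfolding d by (simp_all add: A.mult_linear B.mult_linear A.scale_right_distrib)
    then have "(a *\<^sub>s u, a *\<^sub>s u') \<in> double_graph G l l'" for a
      using mem[OF iso_graphD(3)[OF G m(1), of a] iso_graphD(3)[OF G m(2), of a]] by (simp only:)
    ultimately show ?thesis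
      by blast
  qed
  moreover have "(u + v, u' + v') \<in> double_graph G l l' \<and> (u \<star> v, u' \<star>' v') \<in> double_graph G l l'"
    if uv: "(u, u') \<in> double_graph G l l'" "(v, v') \<in> double_graph G l l'" for u u' v v'
  proof -
    obtain x x' y y' where d: "u = x + y \<star> l" "u' = x' + y' \<star>' l'" and m: "(x, x') \<in> G" "(y, y') \<in> G"
      using uv(1) unfolding double_graph_def by blast
    obtain z z' w w' where e: "v = z + w \<star> l" "v' = z' + w' \<star>' l'" and n: "(z, z') \<in> G" "(w, w') \<in> G"
      using uv(2) unfolding double_graph_def by blast
    have "u + v = (x + z) + (y + w) \<star> l" "u' + v' = (x' + z') + (y' + w') \<star>' l'"
      unfolding d e by (simp_all add: A.mult_linear B.mult_linear add_ac)
    then have 1: "(u + v, u' + v') \<in> double_graph G l l'"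
      using mem[OF iso_graphD(4)[OF G m(1) n(1)] iso_graphD(4)[OF G m(2) n(2)]] by (simp only:)
    have "u \<star> v = (x \<star> z + (- q l) *\<^sub>s (A.cnj w \<star> y)) + (w \<star> x + y \<star> A.cnj z) \<star> l"
      unfolding d e by (intro A.double_mult[OF S(1) l] fs[OF m(1)] fs[OF m(2)] fs[OF n(1)] fs[OF n(2)])
    moreover have "u' \<star>' v' = (x' \<star>' z' + (- q' l') *\<^sub>s (B.cnj w' \<star>' y')) + (w' \<star>' x' + y' \<star>' B.cnj z') \<star>' l'"
      unfolding d e by (intro B.double_mult[OF S(2) l'] fs[OF m(1)] fs[OF m(2)] fs[OF n(1)] fs[OF n(2)])
    moreover have "(x \<star> z + (- q l) *\<^sub>s (A.cnj w \<star> y), x' \<star>' z' + (- q l) *\<^sub>s (B.cnj w' \<star>' y')) \<in> G"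
      by (intro iso_graphD(3-5)[OF G] iso_graph_cnj[OF G] m n)
    moreover have "(w \<star> x + y \<star> A.cnj z, w' \<star>' x' + y' \<star>' B.cnj z') \<in> G"
      by (intro iso_graphD(3-5)[OF G] iso_graph_cnj[OF G] m n)
    ultimately have "(u \<star> v, u' \<star>' v') \<in> double_graph G l l'"
      unfolding ql[symmetric] using mem by (simp only:)
    then show ?thesis
      using 1 by blast
  qed
  ultimately show ?thesis
    unfolding iso_graph_def by simp
qed

theorem isomorphic_if_cayley_triples:
  assumes t: "A.cayley_triple i j l" and t': "B.cayley_triple i' j' l'"
    and norms: "q i = q' i'" "q j = q' j'" "q l = q' l'"
  obtains T where "bij T" "\<And>x y. T (x + y) = T x + T y" "\<And>a x. T (a *\<^sub>s x) = a *\<^sub>s T x"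
    "\<And>x y. T (x \<star> y) = T x \<star>' T y"
proof -
  define G0 where "G0 = {(a *\<^sub>s unit, a *\<^sub>s unit') | a. True}"
  have f0: "fst ` G0 = A.scalars" "snd ` G0 = B.scalars"
    unfolding set_eq_iff fst_image_iff snd_image_iff G0_def A.scalars_def B.scalars_def by blast+
  have G0: "iso_graph G0"
    unfolding iso_graph_def
  proof (intro conjI allI impI)
    have mem: "(a *\<^sub>s unit, a *\<^sub>s unit') \<in> G0" for a
      unfolding G0_def by blast
    show "(unit, unit') \<in> G0"
      using mem[of 1] by simp
    fix x x' assume "(x, x') \<in> G0"
    then obtain a where x: "x = a *\<^sub>s unit" "x' = a *\<^sub>s unit'"
      unfolding G0_def by blast
    show "q x = q' x'" "(c *\<^sub>s x, c *\<^sub>s x') \<in> G0" for c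
      unfolding x using mem[of "c * a"] by (simp_all add: A.q_scale B.q_scale)
    fix y y' assume "(y, y') \<in> G0"
    then obtain c where y: "y = c *\<^sub>s unit" "y' = c *\<^sub>s unit'"
      unfolding G0_def by blast
    show "(x + y, x' + y') \<in> G0" "(x \<star> y, x' \<star>' y') \<in> G0"
      unfolding x y using mem[of "a + c"] mem[of "a * c"]
      by (simp_all add: A.scale_left_distrib A.mult_linear B.mult_linear mult.commute)
  qed
  define G1 where "G1 = double_graph G0 i i'"
  define G2 where "G2 = double_graph G1 j j'"
  define G where "G = double_graph G2 l l'"
  note o = A.cayley_triple_orthogonal[OF t] and o' = B.cayley_triple_orthogonal[OF t']
  have f1: "fst ` G1 = A.double A.scalars i" "snd ` G1 = B.double B.scalars i'"
    unfolding G1_def by (simp_all add: fst_double_graph snd_double_graph f0)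
  have f2: "fst ` G2 = A.double (A.double A.scalars i) j" "snd ` G2 = B.double (B.double B.scalars i') j'"
    unfolding G2_def by (simp_all add: fst_double_graph snd_double_graph f1)
  have fG: "fst ` G = UNIV" "snd ` G = UNIV"
    unfolding G_def using A.cayley_triple_spans[OF t] B.cayley_triple_spans[OF t']
    by (simp_all add: fst_double_graph snd_double_graph f2)
  have G1: "iso_graph G1"
    unfolding G1_def by (rule iso_graph_double[OF G0]) (use f0 o(1) o'(1) norms in auto)
  have G2: "iso_graph G2"
    unfolding G2_def by (rule iso_graph_double[OF G1]) (use f1 o(2) o'(2) norms in auto)
  have G: "iso_graph G"
    unfolding G_def by (rule iso_graph_double[OF G2]) (use f2 o(3) o'(3) norms in auto)
  have ex: "\<exists>x'. (x, x') \<in> G" for x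
    using fG(1) fst_image_iff[of x G] by simp
  have ex': "\<exists>x. (x, x') \<in> G" for x'
    using fG(2) snd_image_iff[of x' G] by simp
  \<comment> \<open>The graph preserves the polar forms and projects onto both algebras, so
    nondegeneracy makes it the graph of a bijection.\<close>
  have functional: "x' = x''" if "(x, x') \<in> G" "(x, x'') \<in> G" for x x' x''
  proof (rule B.b_eqI)
    fix z'
    obtain z where "(z, z') \<in> G"
      using ex' by blast
    then show "B.b x' z' = B.b x'' z'"
      using iso_graph_b[OF G] that by metis
  qed
  have inj: "x = y" if "(x, x') \<in> G" "(y, x') \<in> G" for x y x'
  proof (rule A.b_eqI)
    fix z
    obtain z' where "(z, z') \<in> G"
      using ex by blast
    then show "A.b x z = A.b y z"
      using iso_graph_b[OF G] that by metis
  qed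
  obtain T where T: "\<And>x. (x, T x) \<in> G"
    using ex by metis
  have TI: "T x = x'" if "(x, x') \<in> G" for x x'
    using functional T that by blast
  show ?thesis
  proof (rule that[of T])
    show "bij T"
      unfolding bij_def inj_def surj_def using T TI inj ex' by metis
    show "T (x + y) = T x + T y" "T (x \<star> y) = T x \<star>' T y" for x y
      by (intro TI iso_graphD[OF G] T)+
    show "T (a *\<^sub>s x) = a *\<^sub>s T x" for a x
      by (intro TI iso_graphD[OF G] T)
  qed
qed

end

section \<open>Isotopes of composition algebras\<close>

context composition_algebra
begin

definition isotope_mult :: "'v \<Rightarrow> 'v \<Rightarrow> 'v \<Rightarrow> 'v \<Rightarrow> 'v" where
  "isotope_mult a c x y = (x \<star> a) \<star> (c \<star> y)"

text \<open>The unit \<open>e\<close> must satisfy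
  \<open>(e \<star> a) \<star> (c \<star> y) = y\<close>, that is, \<open>e \<star> a\<close> must
  be \<open>cnj c\<close> divided by \<open>q c\<close>. Solving for \<open>e\<close> gives
  \<open>cnj c \<star> cnj a\<close> divided by \<open>q a * q c\<close>, whose inverse is
  \<open>k\<close>.\<close>

lemma composition_algebra_isotope:
  assumes k: "q a * q c * k = 1"
  shows "composition_algebra (*\<^sub>s) (isotope_mult a c) (k *\<^sub>s (cnj c \<star> cnj a)) (\<lambda>x. q a * q c * q x)"
proof unfold_locales
  show "isotope_mult a c (k *\<^sub>s (cnj c \<star> cnj a)) x = x" for x
  proof -
    have "isotope_mult a c (k *\<^sub>s (cnj c \<star> cnj a)) x = (q a * q c * k) *\<^sub>s x"
      by (simp add: isotope_mult_def mult_linear mult_cnj_right' cnj_mult_left mult_ac)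
    then show ?thesis
      by (simp add: k)
  qed
  show "isotope_mult a c x (k *\<^sub>s (cnj c \<star> cnj a)) = x" for x
  proof -
    have "isotope_mult a c x (k *\<^sub>s (cnj c \<star> cnj a)) = (q a * q c * k) *\<^sub>s x"
      by (simp add: isotope_mult_def mult_linear cnj_mult_left' mult_cnj_right mult_ac)
    then show ?thesis
      by (simp add: k)
  qed
  have "q a * q c * q (k *\<^sub>s (cnj c \<star> cnj a)) = (q a * q c * k) * (q a * q c * k)"
    by (simp add: q_scale q_mult mult_ac)
  then show "q a * q c * q (k *\<^sub>s (cnj c \<star> cnj a)) = 1"
    by (simp add: k)
  show "x = 0" if "\<And>y. q a * q c * q (x + y) - q a * q c * q x - q a * q c * q y = 0" for x
  proof (rule nondegenerate)
    fix y
    have "q a * q c * (q (x + y) - q x - q y) = 0"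
      using that[of y] by (simp only: right_diff_distrib)
    moreover have "q a * q c \<noteq> 0"
      using k by force
    ultimately show "q (x + y) - q x - q y = 0"
      using mult_eq_0_iff by blast
  qed
  show "q a * q c * q (x + y + z) - q a * q c * q (x + y) - q a * q c * q z
      = q a * q c * q (x + z) - q a * q c * q x - q a * q c * q z
        + (q a * q c * q (y + z) - q a * q c * q y - q a * q c * q z)" for x y z
    using polar_add[of x y z] by (simp only: right_diff_distrib[symmetric] distrib_left[symmetric])
  show "q a * q c * q (r *\<^sub>s x + y) - q a * q c * q (r *\<^sub>s x) - q a * q c * q y
      = r * (q a * q c * q (x + y) - q a * q c * q x - q a * q c * q y)" for r x y
    unfolding right_diff_distrib[symmetric] polar_scale by (simp only: mult.left_commute)
qed (simp_all add: two isotope_mult_def mult_linear q_scale q_mult mult_ac)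

lemma pure_mult_orthogonal:
  assumes "b i unit = 0" "b j unit = 0" "b j i = 0"
  shows "b (i \<star> j) unit = 0" "b (i \<star> j) i = 0" "b (i \<star> j) j = 0"
proof -
  show "b (i \<star> j) unit = 0"
    using b_pure_adjoint[OF assms(1), of j unit] assms(3) by simp
  show "b (i \<star> j) i = 0"
    using b_mult_left[of i j unit] assms(2) by simp
  show "b (i \<star> j) j = 0"
    using b_mult_right[of i j unit] assms(1) by simp
qed

text \<open>
  Left multiplication by the unit \<open>e\<close> of the isotope is an isometry onto it.  It need not map \<open>i j\<close> to
  the product of the images of \<open>i\<close> and \<open>j\<close>, but a reflection fixing \<open>1\<close>, \<open>i\<close> and \<open>j\<close> corrects this.
\<close>

lemma isotope_isomorphic_if_anisotropic:
  assumes k: "q a * q c * k = 1"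
    and difference: "\<And>x y. q x dvd 1 \<Longrightarrow> q x = q y \<Longrightarrow> x = y \<or> q (x - y) dvd 1"
    and orthogonal: "\<And>x y z w. q x dvd 1 \<Longrightarrow> q y dvd 1 \<Longrightarrow> q z dvd 1 \<Longrightarrow> q w dvd 1 \<Longrightarrow>
      \<exists>v. q v dvd 1 \<and> b v x = 0 \<and> b v y = 0 \<and> b v z = 0 \<and> b v w = 0"
  obtains T where "bij T" "\<And>x y. T (x + y) = T x + T y" "\<And>r x. T (r *\<^sub>s x) = r *\<^sub>s T x"
    "\<And>x y. T (x \<star> y) = isotope_mult a c (T x) (T y)"
proof -
  define e where "e = k *\<^sub>s (cnj c \<star> cnj a)"
  interpret B: composition_algebra "(*\<^sub>s)" "isotope_mult a c" e "\<lambda>x. q a * q c * q x"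
    unfolding e_def by (rule composition_algebra_isotope[OF k])
  interpret composition_algebra_pair "(*\<^sub>s)" mult unit q "isotope_mult a c" e "\<lambda>x. q a * q c * q x"
    by unfold_locales
  define \<kappa> where "\<kappa> = q a * q c"
  have \<kappa>e: "\<kappa> * q e = 1"
    unfolding \<kappa>_def using B.q_unit .
  have Bq: "\<kappa> * q (e \<star> x) = q x" for x
    unfolding q_mult using \<kappa>e by (simp add: mult.assoc[symmetric])
  have Bb: "B.b x y = \<kappa> * b x y" for x y
    unfolding B.b_def b_def \<kappa>_def by (simp add: right_diff_distrib)
  have Bbe: "B.b (e \<star> x) (e \<star> y) = b x y" for x y
    unfolding Bb b_mult_left using \<kappa>e by (simp add: mult.assoc[symmetric])
  have Be: "B.b (e \<star> x) e = b x unit" for x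
    using Bbe[of x unit] by simp
  obtain i where i: "q i dvd 1" "b i unit = 0"
    using orthogonal[of unit unit unit unit] by auto
  obtain j where j: "q j dvd 1" "b j unit = 0" "b j i = 0"
    using orthogonal[of unit i i i] i by auto
  have qij: "q (i \<star> j) dvd 1"
    unfolding q_mult using mult_dvd_mono[OF i(1) j(1)] by simp
  obtain l where l: "q l dvd 1" "b l unit = 0" "b l i = 0" "b l j = 0" "b l (i \<star> j) = 0"
    using orthogonal[of unit i j "i \<star> j"] i j qij by auto
  have t: "cayley_triple i j l"
    unfolding cayley_triple_def using i j l by simp
  \<comment> \<open>The product in the isotope of the images of \<open>i\<close> and
    \<open>j\<close>; \<open>k''\<close> is its preimage under left multiplication by
    \<open>e\<close>, to be compared with \<open>i \<star> j\<close>.\<close>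
  define k' where "k' = isotope_mult a c (e \<star> i) (e \<star> j)"
  define k'' where "k'' = \<kappa> *\<^sub>s (cnj e \<star> k')"
  have ek: "e \<star> k'' = k'"
    unfolding k''_def using \<kappa>e by (simp add: mult_linear cnj_mult_left')
  have "B.b (e \<star> i) e = 0" "B.b (e \<star> j) e = 0" "B.b (e \<star> j) (e \<star> i) = 0"
    using i j by (simp_all add: Be Bbe)
  from B.pure_mult_orthogonal[OF this, folded k'_def, folded ek]
  have k''o: "b k'' unit = 0" "b k'' i = 0" "b k'' j = 0"
    by (simp_all add: Be Bbe)
  have qk'': "q (i \<star> j) = q k''"
  proof -
    have "q k'' = \<kappa> * q k'"
      using Bq[of k''] unfolding ek by simp
    also have "\<dots> = (\<kappa> * q (e \<star> i)) * (\<kappa> * q (e \<star> j))"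
      unfolding k'_def \<kappa>_def by (rule B.q_mult)
    finally show ?thesis
      unfolding Bq by (simp add: q_mult)
  qed
  note ko = pure_mult_orthogonal[OF i(2) j(2,3)]
  obtain l' where l': "q l' = q l" "b l' unit = 0" "b l' i = 0" "b l' j = 0" "b l' k'' = 0"
  proof (cases "i \<star> j = k''")
    case True
    then show ?thesis
      using that[of l] l by simp
  next
    case False
    \<comment> \<open>As the norms are equal, the reflection in \<open>r\<close> carries
      \<open>i \<star> j\<close> to \<open>k''\<close>, and it fixes \<open>unit\<close>,
      \<open>i\<close> and \<open>j\<close>, which are orthogonal to \<open>r\<close>. The vector
      chosen below is the image of \<open>l\<close>.\<close>
    define r where "r = i \<star> j - k''"
    have "q r dvd 1"
      unfolding r_def using difference[OF qij qk''] False by blast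
    then obtain d where d: "q r * d = 1"
      by (metis dvdE)
    define s where "s = b l r * d"
    have "q (l - s *\<^sub>s r) = q l + (s * s * q r - s * b l r)"
      by (simp add: q_diff q_scale b_linear)
    also have "s * s * q r = s * b l r * (q r * d)"
      unfolding s_def by (simp only: mult_ac)
    finally have "q (l - s *\<^sub>s r) = q l"
      by (simp add: d)
    moreover have "b (l - s *\<^sub>s r) k'' = 0"
    proof -
      have 1: "b r k'' = - q r"
        unfolding r_def by (simp add: b_linear q_diff b_self qk'')
      have "b (l - s *\<^sub>s r) k'' = b l k'' + b l r * (q r * d)"
        unfolding b_diff_left b_scale_left 1 s_def by (simp add: mult_ac)
      then show ?thesis
        unfolding d using l(5) by (simp add: r_def b_linear)
    qed
    moreover have "b r unit = 0" "b r i = 0" "b r j = 0"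
      unfolding r_def using ko k''o by (simp_all add: b_linear)
    ultimately show ?thesis
      using that[of "l - s *\<^sub>s r"] l by (simp add: b_diff_left b_scale_left)
  qed
  have unit_dvd: "\<kappa> * q (e \<star> i) dvd 1" "\<kappa> * q (e \<star> j) dvd 1" "\<kappa> * q (e \<star> l') dvd 1"
    unfolding Bq l'(1) using i(1) j(1) l(1) by blast+
  have "B.b (e \<star> l') (isotope_mult a c (e \<star> i) (e \<star> j)) = 0"
    unfolding k'_def[symmetric] ek[symmetric] Bbe by (rule l'(5))
  then have t': "B.cayley_triple (e \<star> i) (e \<star> j) (e \<star> l')"
    unfolding B.cayley_triple_def Be Bbe using unit_dvd i j l' by (simp add: \<kappa>_def)
  have "q i = q a * q c * q (e \<star> i)" "q j = q a * q c * q (e \<star> j)" "q l = q a * q c * q (e \<star> l')"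
    using Bq[of i] Bq[of j] Bq[of l'] l'(1) unfolding \<kappa>_def by simp_all
  from isomorphic_if_cayley_triples[OF t t' this] show ?thesis
    using that by blast
qed

end

section \<open>Composition algebras with hyperbolic norm over Laurent polynomial rings\<close>

context composition_algebra
begin

text \<open>Torsion-freeness comes from nondegeneracy over a domain; no basis of the module is
  involved.\<close>

lemma scale_eq_0D:
  assumes "r *\<^sub>s x = 0"
  shows "r = 0 \<or> x = 0"
proof (cases "r = 0")
  case False
  have "b x y = 0" for y
    using b_scale_left[of r x y] assms False by simp
  then show ?thesis
    using nondegenerate[of x] unfolding b_def by blast
qed simp

lemma two_nonzero: "(2::'r) \<noteq> 0"
  using two by auto

lemma q_eq_0: "b x x = 0 \<Longrightarrow> q x = 0"
  using two_nonzero by (simp add: b_self)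

lemma b_sum_left: "b (sum f S) y = (\<Sum>i\<in>S. b (f i) y)"
  by (induction S rule: infinite_finite_induct) (simp_all add: b_add_left)

lemma b_sum_right: "b y (sum f S) = (\<Sum>i\<in>S. b y (f i))"
  by (induction S rule: infinite_finite_induct) (simp_all add: b_add_right)

text \<open>Stands for rank at most 8, in a form that makes sense without a basis.\<close>

definition dependent9 :: bool where
  "dependent9 \<longleftrightarrow> (\<forall>v :: nat \<Rightarrow> 'v. \<exists>c. (\<exists>i<9. c i \<noteq> 0) \<and> (\<Sum>i<9. c i *\<^sub>s v i) = 0)"

end

text \<open>Dependence of any two elements makes the Gram matrix of \<open>u\<close> symmetric of
  rank one, so it factors as \<open>\<epsilon> * s i * s j\<close>. The factors \<open>s\<close>
  behave like coordinates with respect to a generator and allow it to be reconstructed.\<close>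

lemma rank_one_form_generator:
  fixes scale :: "'k::field_char_0 laurent \<Rightarrow> 'v::ab_group_add \<Rightarrow> 'v" (infixr \<open>*\<^sub>s\<close> 75)
    and \<beta> :: "'v \<Rightarrow> 'v \<Rightarrow> 'k laurent" and u :: "nat \<Rightarrow> 'v"
  assumes module: "Modules.module scale" and torsion: "\<And>r x. r *\<^sub>s x = 0 \<Longrightarrow> r = 0 \<or> x = 0"
    and L: "\<And>x y. x \<in> L \<Longrightarrow> y \<in> L \<Longrightarrow> x + y \<in> L" "\<And>r x. x \<in> L \<Longrightarrow> r *\<^sub>s x \<in> L"
    and rank: "\<And>x y. x \<in> L \<Longrightarrow> y \<in> L \<Longrightarrow> \<exists>r s. (r \<noteq> 0 \<or> s \<noteq> 0) \<and> r *\<^sub>s x + s *\<^sub>s y = 0"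
    and \<beta>: "\<And>x y z. \<beta> (x + y) z = \<beta> x z + \<beta> y z" "\<And>r x z. \<beta> (r *\<^sub>s x) z = r * \<beta> x z"
      "\<And>x y. \<beta> x y = \<beta> y x"
    and u: "\<And>i. i < n \<Longrightarrow> u i \<in> L" and unit: "(\<Sum>i<n. \<Sum>j<n. c i j * \<beta> (u i) (u j)) = 1"
  obtains l where "l \<in> L" "\<beta> l l dvd 1" "\<And>x. x \<in> L \<Longrightarrow> \<exists>r. x = r *\<^sub>s l"
proof -
  interpret Modules.module scale
    by (rule module)
  have \<beta>0: "\<beta> 0 z = 0" for z
    using \<beta>(2)[of 0 0 z] by simp
  have minor: "\<beta> x x * \<beta> y z = \<beta> x y * \<beta> x z" if xy: "x \<in> L" "y \<in> L" for x y z
  proof -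
    obtain r s where rs: "r \<noteq> 0 \<or> s \<noteq> 0" "r *\<^sub>s x + s *\<^sub>s y = 0"
      using rank[OF xy] by blast
    have e: "r * \<beta> x w + s * \<beta> y w = 0" for w
      using rs(2) \<beta>0[of w] by (metis \<beta>(1,2))
    show ?thesis
    proof (cases "s = 0")
      case True
      then have "x = 0"
        using rs torsion[of r x] by auto
      then show ?thesis
        by (simp add: \<beta>0)
    next
      case False
      have sy: "s * \<beta> y w = - (r * \<beta> x w)" for w
        using e[of w] by (simp add: eq_neg_iff_add_eq_0 add.commute)
      have "s * (\<beta> x x * \<beta> y z) = \<beta> x x * (s * \<beta> y z)" "s * (\<beta> x y * \<beta> x z) = (s * \<beta> y x) * \<beta> x z"
        by (simp_all add: mult_ac \<beta>(3)[of x y])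
      then have "s * (\<beta> x x * \<beta> y z) = s * (\<beta> x y * \<beta> x z)"
        unfolding sy by (simp add: mult_ac)
      then show ?thesis
        using False by simp
    qed
  qed
  have "finite {..<n}"
    by simp
  then obtain \<epsilon> s where \<epsilon>: "\<epsilon> dvd 1" and s: "\<And>i j. i \<in> {..<n} \<Longrightarrow> j \<in> {..<n} \<Longrightarrow> \<beta> (u i) (u j) = \<epsilon> * s i * s j"
    using laurent_rank_one_symmetric[OF _ _ unit] minor u by (metis lessThan_iff)
  \<comment> \<open>If \<open>u i\<close> were \<open>s i *\<^sub>s l\<close> for some
    \<open>l\<close>, the unit relation would express \<open>l\<close> by exactly this
    combination.\<close>
  define l where "l = (\<Sum>i<n. (\<Sum>j<n. c i j * \<epsilon> * s j) *\<^sub>s u i)"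
  have zero: "0 \<in> L"
    using L(2)[OF u, of 0 0] unit by (cases "n = 0") auto
  have comb: "(\<Sum>i\<in>S. r i *\<^sub>s u i) \<in> L" if "S \<subseteq> {..<n}" for S r
    using finite_subset[OF that finite_lessThan] that
    by (induction S rule: finite_induct) (simp_all add: zero L u)
  have lL: "l \<in> L"
    unfolding l_def by (rule comb) simp
  have sum\<beta>: "\<beta> (sum f S) z = (\<Sum>i\<in>S. \<beta> (f i) z)" for f z and S :: "nat set"
    by (induction S rule: infinite_finite_induct) (simp_all add: \<beta>(1) \<beta>0)
  have "(\<Sum>i<n. \<Sum>j<n. c i j * (\<epsilon> * s i * s j)) = (\<Sum>i<n. \<Sum>j<n. c i j * \<beta> (u i) (u j))"
    by (intro sum.cong refl) (simp only: s)
  then have unit': "(\<Sum>i<n. \<Sum>j<n. c i j * (\<epsilon> * s i * s j)) = 1"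
    unfolding unit .
  have \<beta>u: "\<beta> l (u k) = \<epsilon> * s k" if "k < n" for k
  proof -
    have "\<beta> l (u k) = (\<Sum>i<n. (\<Sum>j<n. c i j * \<epsilon> * s j) * (\<epsilon> * s i * s k))"
      unfolding l_def sum\<beta> \<beta>(2) using s that by (intro sum.cong refl) simp
    also have "\<dots> = (\<Sum>i<n. \<Sum>j<n. c i j * (\<epsilon> * s i * s j)) * (\<epsilon> * s k)"
      unfolding sum_distrib_right by (intro sum.cong refl) (simp only: mult_ac)
    finally show ?thesis
      unfolding unit' by simp
  qed
  have "\<beta> l l = (\<Sum>i<n. (\<Sum>j<n. c i j * \<epsilon> * s j) * \<beta> (u i) l)"
    by (subst (1) l_def) (simp only: sum\<beta> \<beta>(2))
  also have "\<dots> = (\<Sum>i<n. (\<Sum>j<n. c i j * \<epsilon> * s j) * (\<epsilon> * s i))"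
    using \<beta>u \<beta>(3)[of _ l] by (intro sum.cong refl) simp
  also have "\<dots> = (\<Sum>i<n. \<Sum>j<n. c i j * (\<epsilon> * s i * s j)) * \<epsilon>"
    unfolding sum_distrib_right by (intro sum.cong refl) (simp only: mult_ac)
  finally have ll: "\<beta> l l = \<epsilon>"
    unfolding unit' by simp
  obtain \<epsilon>' where \<epsilon>': "\<epsilon>' * \<epsilon> = 1"
    using \<epsilon> by (metis dvdE mult.commute)
  have "x = (\<epsilon>' * \<beta> l x) *\<^sub>s l" if x: "x \<in> L" for x
  proof -
    obtain r t where rt: "r \<noteq> 0 \<or> t \<noteq> 0" "r *\<^sub>s l + t *\<^sub>s x = 0"
      using rank[OF lL x] by blast
    have "l \<noteq> 0"
      using ll \<epsilon>' \<beta>0 by auto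
    then have t: "t \<noteq> 0"
      using rt torsion[of r l] by auto
    have "r * \<beta> l l + t * \<beta> x l = 0"
      using rt(2) \<beta>0[of l] by (metis \<beta>(1,2))
    then have "t * \<beta> x l = - (r * \<epsilon>)"
      unfolding ll by (simp add: eq_neg_iff_add_eq_0 add.commute)
    then have "t * (\<epsilon>' * \<beta> l x) = - (r * (\<epsilon>' * \<epsilon>))"
      unfolding \<beta>(3)[of l x] by (simp add: mult.left_commute)
    then have "t * (\<epsilon>' * \<beta> l x) = - r"
      by (simp add: \<epsilon>')
    then have "t *\<^sub>s (x - (\<epsilon>' * \<beta> l x) *\<^sub>s l) = t *\<^sub>s x + r *\<^sub>s l"
      by (simp add: scale_right_diff_distrib)
    then have "t *\<^sub>s (x - (\<epsilon>' * \<beta> l x) *\<^sub>s l) = 0"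
      using rt(2) by (simp add: add.commute)
    then have "x - (\<epsilon>' * \<beta> l x) *\<^sub>s l = 0"
      using torsion t by blast
    then show ?thesis
      by simp
  qed
  then show ?thesis
    using that[OF lL] ll \<epsilon> by blast
qed

section \<open>Creation and annihilation operators, Fock decomposition and vacuum\<close>

text \<open>
  The vectors orthogonal to \<open>1\<close> and \<open>e\<close> act on the algebra by anticommuting left multiplications,
  which make it a module over the Clifford algebra of a hyperbolic space.
\<close>

locale peirce_frame = composition_algebra scale mult unit q
  for scale :: "'r::idom \<Rightarrow> 'v::ab_group_add \<Rightarrow> 'v" (infixr \<open>*\<^sub>s\<close> 75)
    and mult (infixl \<open>\<star>\<close> 70) and unit q +
  fixes e E1 E2 E3 F1 F2 F3 :: 'v
  assumes e: "q e = 0" "b e unit = 1"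
    and pure: "b E1 unit = 0" "b E2 unit = 0" "b E3 unit = 0" "b F1 unit = 0" "b F2 unit = 0" "b F3 unit = 0"
    and orth_e: "b E1 e = 0" "b E2 e = 0" "b E3 e = 0" "b F1 e = 0" "b F2 e = 0" "b F3 e = 0"
    and isotropic: "q E1 = 0" "q E2 = 0" "q E3 = 0" "q F1 = 0" "q F2 = 0" "q F3 = 0"
    and EE: "b E2 E1 = 0" "b E3 E1 = 0" "b E3 E2 = 0"
    and FF: "b F2 F1 = 0" "b F3 F1 = 0" "b F3 F2 = 0"
    and EF: "b F1 E1 = 1" "b F2 E2 = 1" "b F3 E3 = 1" "b F1 E2 = 0" "b F1 E3 = 0" "b F2 E1 = 0"
      "b F2 E3 = 0" "b F3 E1 = 0" "b F3 E2 = 0"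
begin

lemma square_zero:
  "E1 \<star> (E1 \<star> z) = 0" "E2 \<star> (E2 \<star> z) = 0" "E3 \<star> (E3 \<star> z) = 0"
  "F1 \<star> (F1 \<star> z) = 0" "F2 \<star> (F2 \<star> z) = 0" "F3 \<star> (F3 \<star> z) = 0"
  by (simp_all add: pure_mult_left pure isotropic)

lemma anticommute:
  assumes "b x unit = 0" "b y unit = 0" "b x y = 0"
  shows "x \<star> (y \<star> z) = - (y \<star> (x \<star> z))"
  using pure_anticommute[OF assms(1,2), of z] assms(3) by (simp add: eq_neg_iff_add_eq_0)

lemma EE_swap:
  "E2 \<star> (E1 \<star> z) = - (E1 \<star> (E2 \<star> z))" "E3 \<star> (E1 \<star> z) = - (E1 \<star> (E3 \<star> z))"
  "E3 \<star> (E2 \<star> z) = - (E2 \<star> (E3 \<star> z))"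
  by (rule anticommute; simp add: pure EE)+

lemma FE_swap:
  "F1 \<star> (E2 \<star> z) = - (E2 \<star> (F1 \<star> z))" "F1 \<star> (E3 \<star> z) = - (E3 \<star> (F1 \<star> z))"
  "F2 \<star> (E1 \<star> z) = - (E1 \<star> (F2 \<star> z))" "F2 \<star> (E3 \<star> z) = - (E3 \<star> (F2 \<star> z))"
  "F3 \<star> (E1 \<star> z) = - (E1 \<star> (F3 \<star> z))" "F3 \<star> (E2 \<star> z) = - (E2 \<star> (F3 \<star> z))"
  by (rule anticommute; simp add: pure EF)+

lemma FF_swap:
  "F2 \<star> (F1 \<star> z) = - (F1 \<star> (F2 \<star> z))" "F3 \<star> (F1 \<star> z) = - (F1 \<star> (F3 \<star> z))"
  "F3 \<star> (F2 \<star> z) = - (F2 \<star> (F3 \<star> z))"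
  by (rule anticommute; simp add: pure FF)+

text \<open>The Clifford relation between an annihilation operator \<open>F\<close> and its creation
  operator \<open>E\<close>; the sign comes from a pure element of norm \<open>q x\<close> having
  square \<open>- q x\<close>.\<close>

lemma FE:
  "F1 \<star> (E1 \<star> z) = - z - E1 \<star> (F1 \<star> z)" "F2 \<star> (E2 \<star> z) = - z - E2 \<star> (F2 \<star> z)"
  "F3 \<star> (E3 \<star> z) = - z - E3 \<star> (F3 \<star> z)"
  using pure_anticommute[OF pure(4,1), of z] pure_anticommute[OF pure(5,2), of z]
    pure_anticommute[OF pure(6,3), of z] by (simp_all add: EF eq_diff_eq)

definition vacuum :: "'v set" where
  "vacuum = {z. F1 \<star> z = 0 \<and> F2 \<star> z = 0 \<and> F3 \<star> z = 0}"

text \<open>Words in the creation operators applied to \<open>a k\<close>; the bits of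
  \<open>k\<close> select the letters, with value 1 for \<open>E1\<close>, 2 for \<open>E2\<close>
  and 4 for \<open>E3\<close>. The complementary word has index \<open>7 - k\<close>.\<close>

definition fock :: "(nat \<Rightarrow> 'v) \<Rightarrow> 'v" where
  "fock a = ((a 0 + E1 \<star> a 1) + E2 \<star> (a 2 + E1 \<star> a 3)) + E3 \<star> ((a 4 + E1 \<star> a 5) + E2 \<star> (a 6 + E1 \<star> a 7))"

lemma fock_exists:
  obtains a where "\<And>k. a k \<in> vacuum" "z = fock a"
proof -
  \<comment> \<open>By the Clifford relation \<open>z\<close> equals
    \<open>- (F3 \<star> (E3 \<star> z)) - E3 \<star> (F3 \<star> z)\<close>, and \<open>F3\<close>
    applied twice vanishes.\<close>
  have 3: "\<exists>z0 z1. z = z0 + E3 \<star> z1 \<and> F3 \<star> z0 = 0 \<and> F3 \<star> z1 = 0" for z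
    by (intro exI[of _ "- (F3 \<star> (E3 \<star> z))"] exI[of _ "- (F3 \<star> z)"])
      (simp add: mult_linear square_zero FE)
  have 2: "\<exists>z0 z1. z = z0 + E2 \<star> z1 \<and> F2 \<star> z0 = 0 \<and> F2 \<star> z1 = 0 \<and> F3 \<star> z0 = 0 \<and> F3 \<star> z1 = 0"
    if "F3 \<star> z = 0" for z
    by (intro exI[of _ "- (F2 \<star> (E2 \<star> z))"] exI[of _ "- (F2 \<star> z)"])
      (simp add: mult_linear square_zero FE FF_swap FE_swap that)
  have 1: "\<exists>z0\<in>vacuum. \<exists>z1\<in>vacuum. z = z0 + E1 \<star> z1" if "F2 \<star> z = 0" "F3 \<star> z = 0" for z
    by (rule bexI[of _ "- (F1 \<star> (E1 \<star> z))"], rule bexI[of _ "- (F1 \<star> z)"])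
      (simp_all add: vacuum_def mult_linear square_zero FE FF_swap FE_swap that)
  obtain z0 z1 where z: "z = z0 + E3 \<star> z1" "F3 \<star> z0 = 0" "F3 \<star> z1 = 0"
    using 3 by blast
  obtain y0 y1 where y: "z0 = y0 + E2 \<star> y1" "F2 \<star> y0 = 0" "F2 \<star> y1 = 0" "F3 \<star> y0 = 0" "F3 \<star> y1 = 0"
    using 2[OF z(2)] by blast
  obtain y2 y3 where y': "z1 = y2 + E2 \<star> y3" "F2 \<star> y2 = 0" "F2 \<star> y3 = 0" "F3 \<star> y2 = 0" "F3 \<star> y3 = 0"
    using 2[OF z(3)] by blast
  obtain a0 a1 where a: "a0 \<in> vacuum" "a1 \<in> vacuum" "y0 = a0 + E1 \<star> a1"
    using 1[OF y(2,4)] by blast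
  obtain a2 a3 where a': "a2 \<in> vacuum" "a3 \<in> vacuum" "y1 = a2 + E1 \<star> a3"
    using 1[OF y(3,5)] by blast
  obtain a4 a5 where a'': "a4 \<in> vacuum" "a5 \<in> vacuum" "y2 = a4 + E1 \<star> a5"
    using 1[OF y'(2,4)] by blast
  obtain a6 a7 where a''': "a6 \<in> vacuum" "a7 \<in> vacuum" "y3 = a6 + E1 \<star> a7"
    using 1[OF y'(3,5)] by blast
  define f where "f k = (if k = 0 then a0 else if k = 1 then a1 else if k = 2 then a2 else if k = 3 then a3
    else if k = 4 then a4 else if k = 5 then a5 else if k = 6 then a6 else a7)" for k :: nat
  have "f k \<in> vacuum" for k
    unfolding f_def using a a' a'' a''' by simp
  moreover have "z = fock f"
    unfolding fock_def z(1) y(1) y'(1) a(3) a'(3) a''(3) a'''(3) f_def by simp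
  ultimately show ?thesis
    using that by blast
qed

lemma fock_eq_0:
  assumes a: "\<And>k. k < 8 \<Longrightarrow> a k \<in> vacuum" and zero: "fock a = 0"
  shows "k < 8 \<Longrightarrow> a k = 0"
proof -
  have v: "F1 \<star> a k = 0" "F2 \<star> a k = 0" "F3 \<star> a k = 0" if "k < 8" for k
    using a[OF that] unfolding vacuum_def by auto
  have 3: "x = 0 \<and> y = 0" if "F3 \<star> x = 0" "F3 \<star> y = 0" "x + E3 \<star> y = 0" for x y
  proof -
    have "F3 \<star> (x + E3 \<star> y) = - y"
      using that(1,2) by (simp add: mult_linear FE)
    then show ?thesis
      using that(3) by simp
  qed
  have 2: "x = 0 \<and> y = 0" if "F2 \<star> x = 0" "F2 \<star> y = 0" "x + E2 \<star> y = 0" for x y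
  proof -
    have "F2 \<star> (x + E2 \<star> y) = - y"
      using that(1,2) by (simp add: mult_linear FE)
    then show ?thesis
      using that(3) by simp
  qed
  have 1: "x = 0 \<and> y = 0" if "F1 \<star> x = 0" "F1 \<star> y = 0" "x + E1 \<star> y = 0" for x y
  proof -
    have "F1 \<star> (x + E1 \<star> y) = - y"
      using that(1,2) by (simp add: mult_linear FE)
    then show ?thesis
      using that(3) by simp
  qed
  have "(a 0 + E1 \<star> a 1) + E2 \<star> (a 2 + E1 \<star> a 3) = 0 \<and> (a 4 + E1 \<star> a 5) + E2 \<star> (a 6 + E1 \<star> a 7) = 0"
    by (rule 3) (use zero in \<open>simp_all add: fock_def mult_linear FE_swap v\<close>)
  moreover have "a 0 + E1 \<star> a 1 = 0 \<and> a 2 + E1 \<star> a 3 = 0"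
    if "(a 0 + E1 \<star> a 1) + E2 \<star> (a 2 + E1 \<star> a 3) = 0"
    by (rule 2) (use that in \<open>simp_all add: mult_linear FE_swap v\<close>)
  moreover have "a 4 + E1 \<star> a 5 = 0 \<and> a 6 + E1 \<star> a 7 = 0"
    if "(a 4 + E1 \<star> a 5) + E2 \<star> (a 6 + E1 \<star> a 7) = 0"
    by (rule 2) (use that in \<open>simp_all add: mult_linear FE_swap v\<close>)
  ultimately have "a 0 + E1 \<star> a 1 = 0" "a 2 + E1 \<star> a 3 = 0" "a 4 + E1 \<star> a 5 = 0" "a 6 + E1 \<star> a 7 = 0"
    by blast+
  then have "a 0 = 0" "a 1 = 0" "a 2 = 0" "a 3 = 0" "a 4 = 0" "a 5 = 0" "a 6 = 0" "a 7 = 0"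
    using 1[of "a 0" "a 1"] 1[of "a 2" "a 3"] 1[of "a 4" "a 5"] 1[of "a 6" "a 7"] v by simp_all
  moreover assume "k < 8"
  then have "k = 0 \<or> k = 1 \<or> k = 2 \<or> k = 3 \<or> k = 4 \<or> k = 5 \<or> k = 6 \<or> k = 7"
    by linarith
  ultimately show "a k = 0"
    by blast
qed

lemma vacuum_closed:
  "x \<in> vacuum \<Longrightarrow> y \<in> vacuum \<Longrightarrow> x + y \<in> vacuum" "x \<in> vacuum \<Longrightarrow> r *\<^sub>s x \<in> vacuum"
  unfolding vacuum_def by (simp_all add: mult_linear)

text \<open>A nonzero vacuum vector generates eight independent ones, one for each word, so together
  with another vacuum vector there are nine, and uniqueness of the Fock decomposition isolates a
  relation between the two.\<close>

lemma vacuum_rank_one: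
  assumes dep: dependent9 and z: "z \<in> vacuum" "w \<in> vacuum"
  shows "\<exists>r s. (r \<noteq> 0 \<or> s \<noteq> 0) \<and> r *\<^sub>s z + s *\<^sub>s w = 0"
proof (cases "z = 0")
  case True
  then show ?thesis
    by (intro exI[of _ 1] exI[of _ 0]) simp
next
  case False
  \<comment> \<open>For \<open>k < 8\<close> this is word number \<open>k\<close> applied to
    \<open>z\<close>; the ninth vector \<open>w\<close> can only interact with the empty
    word.\<close>
  define v where "v k = (if k = 8 then w else fock (\<lambda>j. if j = k then z else 0))" for k
  obtain c where c: "\<exists>i<9. c i \<noteq> 0" "(\<Sum>i<9. c i *\<^sub>s v i) = 0"
    using dep unfolding dependent9_def by blast
  define a where "a k = (if k = 0 then c 0 *\<^sub>s z + c 8 *\<^sub>s w else c k *\<^sub>s z)" for k :: nat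
  have nine: "{..<9::nat} = {0, 1, 2, 3, 4, 5, 6, 7, 8}"
    by auto
  have "fock a = (\<Sum>i<9. c i *\<^sub>s v i)"
    unfolding nine a_def v_def fock_def by (simp add: mult_linear add_ac)
  then have "a k = 0" if "k < 8" for k
    using fock_eq_0[of a, OF _ _ that] c(2) z vacuum_closed unfolding a_def by simp
  note ak = this
  have 0: "c 0 *\<^sub>s z + c 8 *\<^sub>s w = 0"
    using ak[of 0] unfolding a_def by simp
  have k: "c k = 0" if "0 < k" "k < 8" for k
    using ak[OF that(2)] scale_eq_0D[of "c k" z] False that(1) unfolding a_def by simp
  obtain i where i: "i < 9" "c i \<noteq> 0"
    using c(1) by blast
  then have "i = 0 \<or> i = 8"
    using k[of i] by linarith
  then show ?thesis
    using 0 i(2) by blast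
qed

text \<open>The longest word is the only one whose image of the vacuum is not orthogonal to the
  vacuum, so this is the form that the norm induces there.\<close>

definition pairing :: "'v \<Rightarrow> 'v \<Rightarrow> 'r" where
  "pairing z w = b z (E3 \<star> (E2 \<star> (E1 \<star> w)))"

lemma E_adjoint:
  "b (E1 \<star> x) y = - b x (E1 \<star> y)" "b (E2 \<star> x) y = - b x (E2 \<star> y)" "b (E3 \<star> x) y = - b x (E3 \<star> y)"
  by (rule b_pure_adjoint, rule pure)+

lemma pairing_sym: "pairing z w = pairing w z"
proof -
  have "pairing z w = - b (E3 \<star> z) (E2 \<star> (E1 \<star> w))"
    unfolding pairing_def using E_adjoint(3)[of z] by simp
  also have "\<dots> = b (E2 \<star> (E3 \<star> z)) (E1 \<star> w)"
    using E_adjoint(2)[of "E3 \<star> z"] by simp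
  also have "\<dots> = - b (E1 \<star> (E2 \<star> (E3 \<star> z))) w"
    using E_adjoint(1)[of "E2 \<star> (E3 \<star> z)"] by simp
  also have "E1 \<star> (E2 \<star> (E3 \<star> z)) = - (E3 \<star> (E2 \<star> (E1 \<star> z)))"
    by (simp add: EE_swap mult_linear)
  finally show ?thesis
    unfolding pairing_def by (simp add: b_linear b_sym)
qed

text \<open>The kernel of \<open>F\<close> is contained in its image by the Clifford relation, and
  left multiplication by an isotropic element has totally isotropic image.\<close>

lemma b_F_kernel:
  assumes "b F unit = 0" "q F = 0" "\<And>z. F \<star> (E \<star> z) = - z - E \<star> (F \<star> z)" "F \<star> x = 0" "F \<star> y = 0"
  shows "b x y = 0"
proof -
  have "x = F \<star> (- (E \<star> x))" "y = F \<star> (- (E \<star> y))"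
    using assms(3)[of x] assms(3)[of y] assms(4,5) by (simp_all add: mult_linear)
  then obtain x' y' where "x = F \<star> x'" "y = F \<star> y'"
    by blast
  then show ?thesis
    by (simp add: b_mult_left assms(2))
qed

lemmas b_F1_kernel = b_F_kernel[OF pure(4) isotropic(4) FE(1)]
lemmas b_F2_kernel = b_F_kernel[OF pure(5) isotropic(5) FE(2)]
lemmas b_F3_kernel = b_F_kernel[OF pure(6) isotropic(6) FE(3)]

lemma b_E_image: "b (E1 \<star> x) (E1 \<star> y) = 0" "b (E2 \<star> x) (E2 \<star> y) = 0" "b (E3 \<star> x) (E3 \<star> y) = 0"
  by (simp_all add: b_mult_left isotropic)

text \<open>Three steps remove one operator pair each: the kernel of each \<open>F\<close> and the
  image of each \<open>E\<close> are totally isotropic, so only complementary words survive.\<close>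

lemma b_fock:
  assumes a: "\<And>k. a k \<in> vacuum" and c: "\<And>k. c k \<in> vacuum"
  shows "b (fock a) (fock c) = pairing (a 0) (c 7) - pairing (a 1) (c 6) + pairing (a 2) (c 5)
    - pairing (a 3) (c 4) - pairing (a 4) (c 3) + pairing (a 5) (c 2) - pairing (a 6) (c 1) + pairing (a 7) (c 0)"
proof -
  have v: "F1 \<star> a k = 0" "F2 \<star> a k = 0" "F3 \<star> a k = 0" "F1 \<star> c k = 0" "F2 \<star> c k = 0" "F3 \<star> c k = 0" for k
    using a[of k] c[of k] unfolding vacuum_def by auto
  have 1: "b (z0 + E1 \<star> z1) (E3 \<star> (E2 \<star> (w0 + E1 \<star> w1))) = pairing z0 w1 - pairing z1 w0"
    if "F1 \<star> z0 = 0" "F1 \<star> z1 = 0" "F1 \<star> w0 = 0" "F1 \<star> w1 = 0" for z0 z1 w0 w1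
  proof -
    have "b z0 (E3 \<star> (E2 \<star> w0)) = 0"
      by (rule b_F1_kernel) (simp_all add: FE_swap that mult_linear)
    moreover have "b (E1 \<star> z1) (E3 \<star> (E2 \<star> (E1 \<star> w1))) = 0"
      using b_E_image(1)[of z1 "E3 \<star> (E2 \<star> w1)"] by (simp add: EE_swap mult_linear)
    moreover have "b (E1 \<star> z1) (E3 \<star> (E2 \<star> w0)) = - pairing z1 w0"
      unfolding pairing_def E_adjoint by (simp add: EE_swap mult_linear)
    ultimately show ?thesis
      unfolding pairing_def by (simp add: b_add_left b_add_right mult_add_right)
  qed
  have 2: "b (z0 + E2 \<star> z1) (E3 \<star> (w0 + E2 \<star> w1)) = b z0 (E3 \<star> (E2 \<star> w1)) + b z1 (E3 \<star> (E2 \<star> w0))"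
    if "F2 \<star> z0 = 0" "F2 \<star> z1 = 0" "F2 \<star> w0 = 0" "F2 \<star> w1 = 0" for z0 z1 w0 w1
  proof -
    have "b z0 (E3 \<star> w0) = 0"
      by (rule b_F2_kernel) (simp_all add: FE_swap that mult_linear)
    moreover have "b (E2 \<star> z1) (E3 \<star> (E2 \<star> w1)) = 0"
      using b_E_image(2)[of z1 "E3 \<star> w1"] by (simp add: EE_swap b_linear)
    moreover have "b (E2 \<star> z1) (E3 \<star> w0) = b z1 (E3 \<star> (E2 \<star> w0))"
      unfolding E_adjoint by (simp add: EE_swap b_linear)
    ultimately show ?thesis
      by (simp add: b_add_left b_add_right mult_add_right)
  qed
  have 3: "b (z0 + E3 \<star> z1) (w0 + E3 \<star> w1) = b z0 (E3 \<star> w1) - b z1 (E3 \<star> w0)"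
    if "F3 \<star> z0 = 0" "F3 \<star> z1 = 0" "F3 \<star> w0 = 0" "F3 \<star> w1 = 0" for z0 z1 w0 w1
  proof -
    have "b z0 w0 = 0"
      by (rule b_F3_kernel) (simp_all add: that)
    moreover have "b (E3 \<star> z1) (E3 \<star> w1) = 0"
      by (rule b_E_image)
    ultimately show ?thesis
      by (simp add: b_add_left b_add_right E_adjoint(3)[of z1 w0])
  qed
  have "b (fock a) (fock c) = b ((a 0 + E1 \<star> a 1) + E2 \<star> (a 2 + E1 \<star> a 3)) (E3 \<star> ((c 4 + E1 \<star> c 5) + E2 \<star> (c 6 + E1 \<star> c 7)))
    - b ((a 4 + E1 \<star> a 5) + E2 \<star> (a 6 + E1 \<star> a 7)) (E3 \<star> ((c 0 + E1 \<star> c 1) + E2 \<star> (c 2 + E1 \<star> c 3)))"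
    unfolding fock_def by (rule 3) (simp_all add: mult_linear FE_swap v)
  also have "b ((a 0 + E1 \<star> a 1) + E2 \<star> (a 2 + E1 \<star> a 3)) (E3 \<star> ((c 4 + E1 \<star> c 5) + E2 \<star> (c 6 + E1 \<star> c 7)))
    = b (a 0 + E1 \<star> a 1) (E3 \<star> (E2 \<star> (c 6 + E1 \<star> c 7))) + b (a 2 + E1 \<star> a 3) (E3 \<star> (E2 \<star> (c 4 + E1 \<star> c 5)))"
    by (rule 2) (simp_all add: mult_linear FE_swap v)
  also have "b ((a 4 + E1 \<star> a 5) + E2 \<star> (a 6 + E1 \<star> a 7)) (E3 \<star> ((c 0 + E1 \<star> c 1) + E2 \<star> (c 2 + E1 \<star> c 3)))
    = b (a 4 + E1 \<star> a 5) (E3 \<star> (E2 \<star> (c 2 + E1 \<star> c 3))) + b (a 6 + E1 \<star> a 7) (E3 \<star> (E2 \<star> (c 0 + E1 \<star> c 1)))"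
    by (rule 2) (simp_all add: mult_linear FE_swap v)
  finally show ?thesis
    by (simp add: 1 v)
qed

lemma idempotent_facts:
  "e \<star> (e \<star> z) = e \<star> z" "e \<star> e = e"
proof -
  show *: "e \<star> (e \<star> z) = e \<star> z" for z
    using cnj_mult_left[of e z] by (simp add: cnj_def e mult_linear)
  show "e \<star> e = e"
    using *[of unit] by simp
qed

text \<open>An element orthogonal to \<open>unit\<close> and \<open>e\<close> exchanges the images
  of the idempotents \<open>e\<close> and \<open>unit - e\<close> under left multiplication. Hence
  \<open>e\<close> preserves the vacuum, and passing a creation operator changes the half.\<close>

lemma e_swap:
  assumes "b x unit = 0" "b x e = 0"
  shows "x \<star> (e \<star> z) = x \<star> z - e \<star> (x \<star> z)" "e \<star> (x \<star> z) = x \<star> z - x \<star> (e \<star> z)"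
proof -
  have "cnj e \<star> (x \<star> z) + cnj x \<star> (e \<star> z) = b e x *\<^sub>s z"
    by (rule cnj_mult_exchange)
  then have "x \<star> z - e \<star> (x \<star> z) = x \<star> (e \<star> z)"
    using assms by (simp add: cnj_def e mult_linear b_sym[of e x])
  then show "x \<star> (e \<star> z) = x \<star> z - e \<star> (x \<star> z)" "e \<star> (x \<star> z) = x \<star> z - x \<star> (e \<star> z)"
    by (auto simp: algebra_simps)
qed

lemmas e_E = e_swap(2)[OF pure(1) orth_e(1)] e_swap(2)[OF pure(2) orth_e(2)] e_swap(2)[OF pure(3) orth_e(3)]

lemma e_vacuum: "z \<in> vacuum \<Longrightarrow> e \<star> z \<in> vacuum"
  unfolding vacuum_def using e_swap(1)[OF pure(4) orth_e(4)] e_swap(1)[OF pure(5) orth_e(5)]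
    e_swap(1)[OF pure(6) orth_e(6)] by simp

lemma e_fixed_orthogonal:
  assumes "e \<star> x = x" "e \<star> y = y"
  shows "b x y = 0"
  using b_mult_left[of e x y] assms e(1) by simp

lemma e_killed_orthogonal:
  assumes "e \<star> x = 0" "e \<star> y = 0"
  shows "b x y = 0"
proof -
  have "q (unit - e) = 0"
    using e by (simp add: q_diff b_sym[of unit])
  moreover have "(unit - e) \<star> x = x" "(unit - e) \<star> y = y"
    using assms by (simp_all add: mult_linear)
  ultimately show ?thesis
    using b_mult_left[of "unit - e" x y] by simp
qed


text \<open>Covers the case in which \<open>e\<close> kills the generator of the vacuum: exchanging
  the idempotents changes neither the operators nor the vacuum.\<close>

lemma peirce_frame_swap: "peirce_frame scale mult unit q (unit - e) E1 E2 E3 F1 F2 F3"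
  by unfold_locales
    (use e pure orth_e isotropic EE FF EF in \<open>simp_all add: q_diff b_linear b_unit_unit b_sym[of unit e]\<close>)

end

section \<open>Cayley triples from a generator of the vacuum\<close>

text \<open>A generator of the vacuum gives dual bases of the two halves \<open>e \<star> C\<close>
  and \<open>(unit - e) \<star> C\<close>. In the first half \<open>e\<close> is a unimodular vector
  because \<open>b e unit = 1\<close>; completing it to a basis leaves hyperbolic pairs orthogonal
  to \<open>unit\<close> and \<open>e\<close>, from which the triple is assembled.\<close>

lemma (in peirce_frame) vacuum_fixed_cayley_triple:
  fixes M N :: "'r^4^4"
  assumes l: "l \<in> vacuum" "e \<star> l = l" "pairing l l * d = 1"
    and gen: "\<And>x. x \<in> vacuum \<Longrightarrow> \<exists>r. x = r *\<^sub>s l"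
    and complete: "\<And>x y :: 'r^4. (\<Sum>i\<in>UNIV. x $ i * y $ i) = 1 \<Longrightarrow> \<exists>i. vec_equiv x (axis i 1)"
  shows "\<exists>i j k. cayley_triple i j k \<and> q i = - 1 \<and> q j = 1 \<and> q k = 1"
proof -
  \<comment> \<open>Words of even length are fixed by \<open>e\<close> and words of odd length are
    killed, as \<open>e \<star> l = l\<close>. The signs and the factor \<open>d\<close> make
    \<open>h\<close> dual to \<open>g\<close>.\<close>
  define g :: "4 \<Rightarrow> 'v" where "g i = (if i = 1 then l else if i = 2 then E2 \<star> (E1 \<star> l)
    else if i = 3 then E3 \<star> (E1 \<star> l) else E3 \<star> (E2 \<star> l))" for i
  define h :: "4 \<Rightarrow> 'v" where "h i = (if i = 1 then d *\<^sub>s (E3 \<star> (E2 \<star> (E1 \<star> l)))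
    else if i = 2 then (- d) *\<^sub>s (E3 \<star> l) else if i = 3 then d *\<^sub>s (E2 \<star> l) else (- d) *\<^sub>s (E1 \<star> l))" for i
  have ne: "(1::4) \<noteq> 2" "(1::4) \<noteq> 3" "(1::4) \<noteq> 4" "(2::4) \<noteq> 3" "(2::4) \<noteq> 4" "(3::4) \<noteq> 4"
    "(2::4) \<noteq> 1" "(3::4) \<noteq> 1" "(4::4) \<noteq> 1" "(3::4) \<noteq> 2" "(4::4) \<noteq> 2" "(4::4) \<noteq> 3"
    by simp_all
  have v: "F1 \<star> l = 0" "F2 \<star> l = 0" "F3 \<star> l = 0"
    using l(1) unfolding vacuum_def by auto
  have eg: "e \<star> g i = g i" for i
    unfolding g_def by (simp add: e_E l(2) mult_linear)
  have eh: "e \<star> h i = 0" for i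
    unfolding h_def by (simp add: e_E l(2) mult_linear)
  have p: "pairing l l = b l (E3 \<star> (E2 \<star> (E1 \<star> l)))"
    by (rule pairing_def)
  have z: "b l (E1 \<star> l) = 0" "b l (E2 \<star> l) = 0" "b l (E3 \<star> l) = 0"
    by (rule b_F2_kernel b_F1_kernel; simp add: FE_swap v)+
  have gh: "b (g i) (h j) = (if i = j then 1 else 0)" for i j
  proof -
    have d: "d * pairing l l = 1"
      using l(3) by (simp add: mult.commute)
    have 1: "b l (E3 \<star> (E2 \<star> (E1 \<star> l))) = pairing l l" "b (E2 \<star> (E1 \<star> l)) (E3 \<star> l) = - pairing l l"
      "b (E3 \<star> (E1 \<star> l)) (E2 \<star> l) = pairing l l" "b (E3 \<star> (E2 \<star> l)) (E1 \<star> l) = - pairing l l"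
      unfolding p E_adjoint by (simp_all add: EE_swap mult_linear b_linear)
    have 2: "b (E2 \<star> (E1 \<star> l)) (E3 \<star> (E2 \<star> (E1 \<star> l))) = 0" "b (E2 \<star> (E1 \<star> l)) (E2 \<star> l) = 0"
      "b (E2 \<star> (E1 \<star> l)) (E1 \<star> l) = 0"
      unfolding E_adjoint by (simp_all add: EE_swap mult_linear b_linear square_zero)
    have 3: "b (E3 \<star> (E1 \<star> l)) (E3 \<star> (E2 \<star> (E1 \<star> l))) = 0" "b (E3 \<star> (E1 \<star> l)) (E3 \<star> l) = 0"
      "b (E3 \<star> (E1 \<star> l)) (E1 \<star> l) = 0"
      unfolding E_adjoint by (simp_all add: EE_swap mult_linear b_linear square_zero)
    have 4: "b (E3 \<star> (E2 \<star> l)) (E3 \<star> (E2 \<star> (E1 \<star> l))) = 0" "b (E3 \<star> (E2 \<star> l)) (E3 \<star> l) = 0"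
      "b (E3 \<star> (E2 \<star> l)) (E2 \<star> l) = 0"
      unfolding E_adjoint by (simp_all add: EE_swap mult_linear b_linear square_zero)
    have "i = 1 \<or> i = 2 \<or> i = 3 \<or> i = 4" "j = 1 \<or> j = 2 \<or> j = 3 \<or> j = 4"
      by (rule exhaust_4)+
    then show ?thesis
      unfolding g_def h_def
      by (elim disjE) (simp_all only: ne if_True if_False simp_thms b_scale_right 1 2 3 4 z d mult_zero_right
          minus_mult_minus mult_minus_left minus_minus refl)
  qed
  have span: "\<exists>x :: 'r^4. e \<star> z = (\<Sum>i\<in>UNIV. x $ i *\<^sub>s g i)" for z
  proof -
    obtain a where a: "\<And>k. a k \<in> vacuum" "z = fock a"
      using fock_exists by blast
    obtain r where r: "\<And>k. a k = r k *\<^sub>s l"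
      using gen[OF a(1)] by metis
    have "e \<star> z = r 0 *\<^sub>s l + r 3 *\<^sub>s (E2 \<star> (E1 \<star> l)) + r 5 *\<^sub>s (E3 \<star> (E1 \<star> l)) + r 6 *\<^sub>s (E3 \<star> (E2 \<star> l))"
      unfolding a(2) fock_def r by (simp add: mult_linear e_E l(2) add_ac)
    moreover define x :: "'r^4" where "x = (\<chi> i. if i = 1 then r 0 else if i = 2 then r 3 else if i = 3 then r 5 else r 6)"
    ultimately have "e \<star> z = (\<Sum>i\<in>UNIV. x $ i *\<^sub>s g i)"
      unfolding sum_4 g_def by (simp add: x_def)
    then show ?thesis
      by blast
  qed
  obtain x :: "'r^4" where x: "e = (\<Sum>i\<in>UNIV. x $ i *\<^sub>s g i)"
    using span[of unit] by auto
  define y :: "'r^4" where "y = (\<chi> i. b (g i) unit)"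
  have "(\<Sum>i\<in>UNIV. x $ i * y $ i) = b e unit"
    using arg_cong[OF x, of "\<lambda>z. b z unit"] by (simp add: b_sum_left b_scale_left y_def)
  then obtain i0 where "vec_equiv x (axis i0 1)"
    using complete e(2) by metis
  then obtain M N :: "'r^4^4" where MN: "M ** N = mat 1" "N ** M = mat 1" "M *v x = axis i0 1"
    unfolding vec_equiv_def by blast
  have Nx: "N $ i $ i0 = x $ i" for i
  proof -
    have "N *v axis i0 1 = x"
      using MN by (metis matrix_vector_mul_assoc matrix_vector_mul_lid)
    then have "(N *v axis i0 1) $ i = x $ i"
      by simp
    then show ?thesis
      by (simp add: matrix_vector_mult_def axis_def if_distrib cong: if_cong)
  qed
  \<comment> \<open>Contragredient changes of basis: \<open>M ** N = mat 1\<close> keeps the systems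
    dual, and column \<open>i0\<close> of \<open>N\<close> holds the coordinates of
    \<open>e\<close>.\<close>
  define g' where "g' j = (\<Sum>i\<in>UNIV. N $ i $ j *\<^sub>s g i)" for j
  define h' where "h' j = (\<Sum>i\<in>UNIV. M $ j $ i *\<^sub>s h i)" for j
  have g'h': "b (g' j) (h' k) = (if j = k then 1 else 0)" for j k
  proof -
    have "b (g' j) (h' k) = (\<Sum>i\<in>UNIV. \<Sum>m\<in>UNIV. M $ k $ i * (N $ m $ j * (if m = i then 1 else 0)))"
      unfolding g'_def h'_def by (simp only: b_sum_left b_sum_right b_scale_left b_scale_right gh sum_distrib_left)
    also have "\<dots> = (\<Sum>i\<in>UNIV. M $ k $ i * N $ i $ j)"
    proof (intro sum.cong refl)
      fix i
      have "(\<Sum>m\<in>UNIV. M $ k $ i * (N $ m $ j * (if m = i then 1 else 0)))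
          = (\<Sum>m\<in>UNIV. if m = i then M $ k $ i * N $ m $ j else 0)"
        by (intro sum.cong refl) simp
      then show "(\<Sum>m\<in>UNIV. M $ k $ i * (N $ m $ j * (if m = i then 1 else 0))) = M $ k $ i * N $ i $ j"
        by simp
    qed
    also have "\<dots> = (M ** N) $ k $ j"
      by (simp add: matrix_matrix_mult_def)
    finally show ?thesis
      unfolding MN by (simp add: mat_def)
  qed
  have e_sum: "e \<star> sum f S = (\<Sum>i\<in>S. e \<star> f i)" for f and S :: "4 set"
    by (induction S rule: infinite_finite_induct) (simp_all add: mult_linear)
  have eg': "e \<star> g' j = g' j" and eh': "e \<star> h' j = 0" for j
    unfolding g'_def h'_def by (simp_all add: e_sum mult_linear eg eh)
  have ei0: "g' i0 = e"
    unfolding g'_def Nx x[symmetric] ..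
  obtain j1 j2 where j: "j1 \<noteq> i0" "j2 \<noteq> i0" "j1 \<noteq> j2"
  proof -
    have "i0 = 1 \<or> i0 = 2 \<or> i0 = 3 \<or> i0 = 4"
      by (rule exhaust_4)
    then show ?thesis
      using that[of 2 3] that[of 1 3] that[of 1 2] ne by metis
  qed
  \<comment> \<open>Subtracting a multiple of \<open>e = g' i0\<close> makes the vector orthogonal
    to \<open>unit\<close> and does not affect its products with \<open>h' k\<close> for
    \<open>k \<noteq> i0\<close>.\<close>
  define u where "u j = g' j - b (g' j) unit *\<^sub>s e" for j
  have eu: "e \<star> u j = u j" for j
    unfolding u_def by (simp add: mult_linear eg' idempotent_facts)
  have ee: "b e e = 0"
    by (simp add: b_self e)
  have uu: "b (u j) (u k) = 0" "b (u j) e = 0" "b e (u j) = 0" for j k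
    using e_fixed_orthogonal eu idempotent_facts(2) by blast+
  have hh: "b (h' j) (h' k) = 0" for j k
    using e_killed_orthogonal eh' by blast
  have eh0: "b e (h' j) = 0" if "j \<noteq> i0" for j
    using g'h'[of i0 j] that unfolding ei0 by simp
  have uh: "b (u j) (h' k) = (if j = k then 1 else 0)" if "k \<noteq> i0" for j k
    unfolding u_def using g'h' eh0[OF that] by (simp add: b_linear)
  have hu: "b (h' k) (u j) = (if j = k then 1 else 0)" if "k \<noteq> i0" for j k
    unfolding b_sym[of "h' k"] using uh[OF that] .
  have h0: "b (h' j) e = 0" if "j \<noteq> i0" for j
    unfolding b_sym[of "h' j"] using eh0[OF that] .
  have u1: "b (u j) unit = 0" for j
    unfolding u_def by (simp add: b_linear e)
  have h1: "b (h' j) unit = 0" if "j \<noteq> i0" for j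
  proof -
    have "e \<star> (unit - e) = 0"
      by (simp add: mult_linear idempotent_facts)
    then have "b (h' j) (unit - e) = 0"
      using e_killed_orthogonal eh' by blast
    then show ?thesis
      using h0[OF that] by (simp add: b_diff_right)
  qed
  have qu: "q (u j) = 0" and qh: "q (h' j) = 0" for j
    using q_eq_0 uu hh by blast+
  define i where "i = e - (unit - e)"
  define jj where "jj = u j1 + h' j1"
  define k where "k = u j2 + h' j2"
  have "i \<star> jj = u j1 - h' j1"
    unfolding i_def jj_def by (simp add: mult_linear eu eh')
  then have "b k (i \<star> jj) = 0"
    unfolding k_def using j by (simp add: b_linear uu hh uh hu)
  moreover have "b k jj = 0"
    unfolding k_def jj_def using j by (simp add: b_linear uu hh uh hu)
  moreover have "b (u m + h' m) unit = 0" "b (u m + h' m) i = 0" if "m \<noteq> i0" for m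
    unfolding i_def using that by (simp_all add: b_linear uu u1 h1 h0)
  moreover have "b i unit = 0"
    unfolding i_def by (simp add: b_linear e b_unit_unit)
  moreover have qi: "q i = - 1"
  proof -
    have "q (unit - e) = 0"
      using e by (simp add: q_diff b_sym[of unit])
    moreover have "b e (unit - e) = 1"
      by (simp add: b_linear e ee)
    ultimately show ?thesis
      unfolding i_def q_diff[of e] by (simp add: e)
  qed
  moreover have qj: "q (u m + h' m) = 1" if "m \<noteq> i0" for m
    unfolding q_add using uh[OF that] by (simp add: qu qh)
  ultimately show ?thesis
    unfolding cayley_triple_def using j
    by (intro exI[of _ i] exI[of _ jj] exI[of _ k]) (simp add: jj_def k_def)
qed

lemma laurent_peirce_frame_cayley_triple:
  fixes scale :: "'k::field_char_0 laurent \<Rightarrow> 'v::ab_group_add \<Rightarrow> 'v" and mult :: "'v \<Rightarrow> 'v \<Rightarrow> 'v"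
  assumes "peirce_frame scale mult unit q e E1 E2 E3 F1 F2 F3"
    and dep: "composition_algebra.dependent9 scale"
  shows "\<exists>i j k. composition_algebra.cayley_triple mult unit q i j k \<and> q i = - 1 \<and> q j = 1 \<and> q k = 1"
proof -
  interpret peirce_frame scale mult unit q e E1 E2 E3 F1 F2 F3
    by (rule assms(1))
  have complete: "\<exists>i. vec_equiv x (axis i 1)" if "(\<Sum>i\<in>UNIV. x $ i * y $ i) = 1" for x y :: "'k laurent^4"
  proof -
    have "unimodular x"
      unfolding unimodular_def using that by (intro exI[of _ y]) (simp add: mult.commute)
    moreover have "(1::4) \<noteq> 2"
      by simp
    ultimately show ?thesis
      using laurent_unimodular_equiv by blast
  qed
  obtain a where a: "\<And>k. a k \<in> vacuum" "e = fock a"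
    using fock_exists by blast
  obtain c where c: "\<And>k. c k \<in> vacuum" "unit = fock c"
    using fock_exists by blast
  \<comment> \<open>By \<open>b_fock\<close>, the equation \<open>b e unit = 1\<close> says that the
    pairings of components of \<open>e\<close> and \<open>unit\<close> with complementary indices
    generate the unit ideal. In the joint list of sixteen vectors the partner of \<open>i\<close>
    sits at \<open>15 - i\<close>; \<open>\<sigma>\<close> holds the signs of
    \<open>b_fock\<close>.\<close>
  define u where "u k = (if k < 8 then a k else c (k - 8))" for k
  define \<sigma> :: "nat \<Rightarrow> 'k laurent" where "\<sigma> k = (if k \<in> {0, 2, 5, 7} then 1 else - 1)" for k
  define m where "m i j = (if i < 8 \<and> j = 15 - i then \<sigma> i else 0)" for i j :: nat
  have eight: "{..<16} \<inter> {i. i < 8} = {0, 1, 2, 3, 4, 5, 6, 7 :: nat}"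
    by auto
  have "(\<Sum>i<16. \<Sum>j<16. m i j * pairing (u i) (u j)) = (\<Sum>i<16. if i < 8 then \<sigma> i * pairing (a i) (c (7 - i)) else 0)"
  proof (intro sum.cong refl)
    fix i :: nat assume i: "i \<in> {..<16}"
    show "(\<Sum>j<16. m i j * pairing (u i) (u j)) = (if i < 8 then \<sigma> i * pairing (a i) (c (7 - i)) else 0)"
    proof (cases "i < 8")
      case True
      have "(\<Sum>j<16. m i j * pairing (u i) (u j)) = (\<Sum>j<16. if j = 15 - i then \<sigma> i * pairing (u i) (u j) else 0)"
        using True by (intro sum.cong refl) (simp add: m_def)
      also have "\<dots> = \<sigma> i * pairing (u i) (u (15 - i))"
        using True by simp
      finally have "(\<Sum>j<16. m i j * pairing (u i) (u j)) = \<sigma> i * pairing (u i) (u (15 - i))" .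
      moreover have "u i = a i" "u (15 - i) = c (7 - i)"
        using True by (auto simp: u_def)
      ultimately show ?thesis
        using True by simp
    qed (simp add: m_def)
  qed
  also have "\<dots> = b (fock a) (fock c)"
    unfolding b_fock[OF a(1) c(1)] by (simp add: sum.If_cases eight \<sigma>_def)
  also have "\<dots> = 1"
    unfolding a(2)[symmetric] c(2)[symmetric] by (rule e(2))
  finally have one: "(\<Sum>i<16. \<Sum>j<16. m i j * pairing (u i) (u j)) = 1" .
  have uv: "u i \<in> vacuum" for i
    unfolding u_def using a(1) c(1) by simp
  have pairing: "pairing (x + y) z = pairing x z + pairing y z" "pairing (scale r x) z = r * pairing x z" for x y z r
    unfolding pairing_def by (simp_all add: b_linear)
  have "\<exists>l\<in>vacuum. pairing l l dvd 1 \<and> (\<forall>x\<in>vacuum. \<exists>r. x = scale r l)"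
    by (rule rank_one_form_generator[of scale vacuum pairing 16 u m, OF module_axioms scale_eq_0D vacuum_closed
        vacuum_rank_one[OF dep] pairing pairing_sym uv one]) blast+
  then obtain l where l: "l \<in> vacuum" "pairing l l dvd 1" "\<And>x. x \<in> vacuum \<Longrightarrow> \<exists>r. x = scale r l"
    by blast
  obtain d where d: "pairing l l * d = 1"
    using l(2) by (metis dvdE)
  have "pairing 0 0 = 0"
    unfolding pairing_def by simp
  then have "l \<noteq> 0"
    using d by fastforce
  \<comment> \<open>An idempotent acts on a module with one generator by an idempotent scalar, which
    is 1 or 0 in a domain.\<close>
  obtain r where r: "mult e l = scale r l"
    using l(3)[OF e_vacuum[OF l(1)]] by blast
  have "scale (r * r) l = scale r l"
    using idempotent_facts(1)[of l] unfolding r mult_scale_right by simp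
  then have "scale (r * r - r) l = 0"
    by (simp add: scale_left_diff_distrib)
  then have "r * r - r = 0"
    using scale_eq_0D[of "r * r - r" l] \<open>l \<noteq> 0\<close> by blast
  then have "r * (r - 1) = 0"
    by (simp add: right_diff_distrib)
  then consider "r = 1" | "r = 0"
    by auto
  then show ?thesis
  proof cases
    case 1
    then show ?thesis
      using vacuum_fixed_cayley_triple[OF l(1) _ d l(3) complete] r by simp
  next
    case 2
    interpret S: peirce_frame scale mult unit q "unit - e" E1 E2 E3 F1 F2 F3
      by (rule peirce_frame_swap)
    have "mult (unit - e) l = l"
      using r 2 by (simp add: mult_diff_left)
    then show ?thesis
      using S.vacuum_fixed_cayley_triple[OF l(1) _ d l(3) complete] by simp
  qed
qed

section \<open>Hyperbolic bases\<close>

lemma linear_system_nontrivial_solution: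
  fixes f :: "'i \<Rightarrow> 'j \<Rightarrow> 'a::idom"
  assumes "finite B" "finite A" "card B < card A"
  shows "\<exists>c. (\<exists>i\<in>A. c i \<noteq> 0) \<and> (\<forall>r\<in>B. (\<Sum>i\<in>A. c i * f i r) = 0)"
  using assms
proof (induction B arbitrary: A f rule: finite_induct)
  case empty
  then have "A \<noteq> {}"
    by auto
  then show ?case
    by (intro exI[of _ "\<lambda>_. 1"]) auto
next
  case (insert r0 B)
  show ?case
  proof (cases "\<exists>p\<in>A. f p r0 \<noteq> 0")
    case False
    have "card B < card A"
      using insert.prems(2) insert.hyps by simp
    then obtain c where "\<exists>i\<in>A. c i \<noteq> 0" "\<forall>r\<in>B. (\<Sum>i\<in>A. c i * f i r) = 0"
      using insert.IH[OF insert.prems(1), of f] by blast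
    then show ?thesis
      using False by (intro exI[of _ c]) simp
  next
    case True
    then obtain p where p: "p \<in> A" "f p r0 \<noteq> 0"
      by blast
    define A' where "A' = A - {p}"
    have A': "finite A'" "card B < card A'"
      using insert.prems insert.hyps p(1) unfolding A'_def by auto
    obtain c where c: "\<exists>i\<in>A'. c i \<noteq> 0" "\<forall>r\<in>B. (\<Sum>i\<in>A'. c i * (f p r0 * f i r - f i r0 * f p r)) = 0"
      using insert.IH[OF A', of "\<lambda>i r. f p r0 * f i r - f i r0 * f p r"] by blast
    \<comment> \<open>Cross-multiplication by the pivot \<open>f p r0\<close> avoids fractions. The
      value at \<open>p\<close> is dictated by equation \<open>r0\<close>, in which all reduced
      coefficients vanish.\<close>
    define c' where "c' i = (if i = p then - (\<Sum>i\<in>A'. c i * f i r0) else f p r0 * c i)" for i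
    have sum: "(\<Sum>i\<in>A. c' i * f i r) = (\<Sum>i\<in>A'. c i * (f p r0 * f i r - f i r0 * f p r))" for r
    proof -
      have "(\<Sum>i\<in>A. c' i * f i r) = c' p * f p r + (\<Sum>i\<in>A'. c' i * f i r)"
        unfolding A'_def using insert.prems(1) p(1) by (rule sum.remove)
      also have "(\<Sum>i\<in>A'. c' i * f i r) = (\<Sum>i\<in>A'. f p r0 * c i * f i r)"
        by (intro sum.cong refl) (simp add: c'_def A'_def)
      finally show ?thesis
        by (simp add: c'_def sum_distrib_right sum_distrib_left right_diff_distrib sum_subtractf mult_ac)
    qed
    have "(\<Sum>i\<in>A. c' i * f i r) = 0" if "r \<in> insert r0 B" for r
      unfolding sum using that c(2) by (auto simp: mult.commute)
    moreover have "\<exists>i\<in>A. c' i \<noteq> 0"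
      using c(1) p(2) unfolding c'_def A'_def by auto
    ultimately show ?thesis
      by blast
  qed
qed

context composition_algebra
begin

text \<open>Pairing a relation among \<open>z\<close> and the eight \<open>v i\<close> with the
  \<open>w j\<close> computes all coefficients from that of \<open>z\<close>, which therefore is
  nonzero and can be cancelled.\<close>

lemma dual_basis_expansion:
  fixes v w :: "nat \<Rightarrow> 'v"
  assumes dep: dependent9
    and dual: "\<And>i j. i < 8 \<Longrightarrow> j < 8 \<Longrightarrow> b (v i) (w j) = (if i = j then 1 else 0)"
  shows "z = (\<Sum>i<8. b z (w i) *\<^sub>s v i)"
proof -
  define v' where "v' i = (if i = 8 then z else v i)" for i :: nat
  obtain c where c: "\<exists>i<9. c i \<noteq> 0" "(\<Sum>i<9. c i *\<^sub>s v' i) = 0"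
    using dep unfolding dependent9_def by blast
  have "{..<9::nat} = insert 8 {..<8}"
    by auto
  then have "(\<Sum>i<9. c i *\<^sub>s v' i) = c 8 *\<^sub>s z + (\<Sum>i<8. c i *\<^sub>s v' i)"
    by (simp add: v'_def)
  also have "(\<Sum>i<8. c i *\<^sub>s v' i) = (\<Sum>i<8. c i *\<^sub>s v i)"
    by (intro sum.cong refl) (simp add: v'_def)
  finally have zero: "c 8 *\<^sub>s z + (\<Sum>i<8. c i *\<^sub>s v i) = 0"
    using c(2) by simp
  have cj: "c j = - (c 8 * b z (w j))" if "j < 8" for j
  proof -
    have "(\<Sum>i<8. c i * b (v i) (w j)) = (\<Sum>i<8. if i = j then c j else 0)"
      by (intro sum.cong refl) (simp add: dual that)
    then have "b (c 8 *\<^sub>s z + (\<Sum>i<8. c i *\<^sub>s v i)) (w j) = c 8 * b z (w j) + (\<Sum>i<8. if i = j then c j else 0)"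
      by (simp add: b_add_left b_sum_left b_scale_left)
    then have "0 = c 8 * b z (w j) + c j"
      unfolding zero using that by simp
    then show ?thesis
      by (simp add: eq_neg_iff_add_eq_0 add.commute)
  qed
  have c8: "c 8 \<noteq> 0"
  proof
    assume "c 8 = 0"
    then have "c i = 0" if "i < 9" for i
      using cj[of i] that by (cases "i = 8") auto
    then show False
      using c(1) by blast
  qed
  have "(\<Sum>i<8. c i *\<^sub>s v i) = - (c 8 *\<^sub>s (\<Sum>i<8. b z (w i) *\<^sub>s v i))"
    unfolding scale_sum_right sum_negf[symmetric] by (intro sum.cong refl) (simp add: cj)
  then have "c 8 *\<^sub>s (z - (\<Sum>i<8. b z (w i) *\<^sub>s v i)) = 0"
    using zero by (simp add: scale_right_diff_distrib)
  then have "z - (\<Sum>i<8. b z (w i) *\<^sub>s v i) = 0"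
    using scale_eq_0D c8 by blast
  then show ?thesis
    by simp
qed

definition hyperbolic_basis :: "(nat \<Rightarrow> 'v) \<Rightarrow> (nat \<Rightarrow> 'v) \<Rightarrow> bool" where
  "hyperbolic_basis E F \<longleftrightarrow> (\<forall>i<4. \<forall>j<4. b (E i) (E j) = 0 \<and> b (F i) (F j) = 0
    \<and> b (E i) (F j) = (if i = j then 1 else 0))"

lemma hyperbolic_basis_expansion:
  assumes dep: dependent9 and h: "hyperbolic_basis E F"
  shows "z = (\<Sum>i<4. b z (F i) *\<^sub>s E i) + (\<Sum>i<4. b z (E i) *\<^sub>s F i)"
proof -
  define v where "v i = (if i < 4 then E i else F (i - 4))" for i
  define w where "w i = (if i < 4 then F i else E (i - 4))" for i
  have "b (v i) (w j) = (if i = j then 1 else 0)" if "i < 8" "j < 8" for i j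
    using h that unfolding hyperbolic_basis_def v_def w_def by (auto simp: b_sym[of "F _" "E _"])
  from dual_basis_expansion[OF dep this, of z]
  have "z = (\<Sum>i<8. b z (w i) *\<^sub>s v i)"
    by simp
  also have "\<dots> = (\<Sum>i<4. b z (F i) *\<^sub>s E i) + (\<Sum>i<4. b z (E i) *\<^sub>s F i)"
    by (simp add: v_def w_def eval_nat_numeral add_ac)
  finally show ?thesis .
qed

text \<open>Writing \<open>unit\<close> in the hyperbolic basis, \<open>q unit = 1\<close> says that
  its coordinates on the \<open>E i\<close> form a unimodular row. Completing this row makes the
  isotropic part of \<open>unit\<close> a basis vector \<open>e\<close>, with
  \<open>b e unit = 1\<close>.\<close>

lemma hyperbolic_basis_peirce_frame:
  assumes dep: dependent9 and h: "hyperbolic_basis E F"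
    and complete: "\<And>x y :: 'r^4. (\<Sum>i\<in>UNIV. x $ i * y $ i) = 1 \<Longrightarrow> \<exists>i. vec_equiv x (axis i 1)"
  shows "\<exists>e E1 E2 E3 F1 F2 F3. peirce_frame scale mult unit q e E1 E2 E3 F1 F2 F3"
proof -
  define n :: "4 \<Rightarrow> nat" where "n i = (if i = 1 then 0 else if i = 2 then 1 else if i = 3 then 2 else 3)" for i
  have ne: "(1::4) \<noteq> 2" "(1::4) \<noteq> 3" "(1::4) \<noteq> 4" "(2::4) \<noteq> 3" "(2::4) \<noteq> 4" "(3::4) \<noteq> 4"
    "(2::4) \<noteq> 1" "(3::4) \<noteq> 1" "(4::4) \<noteq> 1" "(3::4) \<noteq> 2" "(4::4) \<noteq> 2" "(4::4) \<noteq> 3"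
    by simp_all
  have n4: "n i < 4" for i
    unfolding n_def by simp
  have n_inj: "n i = n j \<longleftrightarrow> i = j" for i j
  proof -
    have "i = 1 \<or> i = 2 \<or> i = 3 \<or> i = 4" "j = 1 \<or> j = 2 \<or> j = 3 \<or> j = 4"
      by (rule exhaust_4)+
    then show ?thesis
      unfolding n_def by (elim disjE) simp_all
  qed
  have EF: "b (E (n i)) (E (n j)) = 0" "b (F (n i)) (F (n j)) = 0" "b (E (n i)) (F (n j)) = (if i = j then 1 else 0)" for i j
    using h n4 n_inj unfolding hyperbolic_basis_def by auto
  define x :: "'r^4" where "x = (\<chi> i. b unit (F (n i)))"
  define y :: "'r^4" where "y = (\<chi> i. b unit (E (n i)))"
  have unit: "unit = (\<Sum>i\<in>UNIV. x $ i *\<^sub>s E (n i)) + (\<Sum>i\<in>UNIV. y $ i *\<^sub>s F (n i))"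
    using hyperbolic_basis_expansion[OF dep h, of unit]
    unfolding sum_4 by (simp add: x_def y_def n_def eval_nat_numeral add_ac)
  have "2 * (\<Sum>i\<in>UNIV. x $ i * y $ i) = b unit unit"
  proof -
    have "b unit unit = b ((\<Sum>i\<in>UNIV. x $ i *\<^sub>s E (n i)) + (\<Sum>i\<in>UNIV. y $ i *\<^sub>s F (n i))) unit"
      using arg_cong[OF unit, of "\<lambda>z. b z unit"] .
    also have "\<dots> = (\<Sum>i\<in>UNIV. x $ i * y $ i) + (\<Sum>i\<in>UNIV. y $ i * x $ i)"
      unfolding b_add_left b_sum_left b_scale_left
      by (simp add: x_def y_def b_sym[of _ unit])
    finally show ?thesis
      by (simp add: mult.commute)
  qed
  then have xy: "(\<Sum>i\<in>UNIV. x $ i * y $ i) = 1"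
    using two_nonzero by (simp add: b_unit_unit)
  then obtain i0 where "vec_equiv x (axis i0 1)"
    using complete by blast
  then obtain M N :: "'r^4^4" where MN: "M ** N = mat 1" "N ** M = mat 1" "M *v x = axis i0 1"
    unfolding vec_equiv_def by blast
  have Nx: "N $ i $ i0 = x $ i" for i
  proof -
    have "N *v axis i0 1 = x"
      using MN by (metis matrix_vector_mul_assoc matrix_vector_mul_lid)
    then have "(N *v axis i0 1) $ i = x $ i"
      by simp
    then show ?thesis
      by (simp add: matrix_vector_mult_def axis_def if_distrib cong: if_cong)
  qed
  define E' where "E' j = (\<Sum>i\<in>UNIV. N $ i $ j *\<^sub>s E (n i))" for j
  define F' where "F' j = (\<Sum>i\<in>UNIV. M $ j $ i *\<^sub>s F (n i))" for j
  define e where "e = E' i0"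
  have e: "e = (\<Sum>i\<in>UNIV. x $ i *\<^sub>s E (n i))"
    unfolding e_def E'_def Nx ..
  have EE': "b (E' j) (E' k) = 0" and FF': "b (F' j) (F' k) = 0" for j k
    unfolding E'_def F'_def by (simp_all add: b_sum_left b_sum_right b_scale_left b_scale_right EF)
  have EF': "b (E' j) (F' k) = (if j = k then 1 else 0)" for j k
  proof -
    have "b (E' j) (F' k) = (\<Sum>i\<in>UNIV. \<Sum>m\<in>UNIV. M $ k $ i * (N $ m $ j * (if m = i then 1 else 0)))"
      unfolding E'_def F'_def by (simp only: b_sum_left b_sum_right b_scale_left b_scale_right EF sum_distrib_left)
    also have "\<dots> = (\<Sum>i\<in>UNIV. M $ k $ i * N $ i $ j)"
    proof (intro sum.cong refl)
      fix i
      have "(\<Sum>m\<in>UNIV. M $ k $ i * (N $ m $ j * (if m = i then 1 else 0)))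
          = (\<Sum>m\<in>UNIV. if m = i then M $ k $ i * N $ m $ j else 0)"
        by (intro sum.cong refl) simp
      then show "(\<Sum>m\<in>UNIV. M $ k $ i * (N $ m $ j * (if m = i then 1 else 0))) = M $ k $ i * N $ i $ j"
        by simp
    qed
    also have "\<dots> = (M ** N) $ k $ j"
      by (simp add: matrix_matrix_mult_def)
    finally show ?thesis
      unfolding MN by (simp add: mat_def)
  qed
  have e1: "b e unit = 1"
  proof -
    have "b e unit = (\<Sum>i\<in>UNIV. x $ i * y $ i)"
      unfolding e b_sum_left b_scale_left by (simp add: y_def b_sym[of _ unit])
    then show ?thesis
      using xy by simp
  qed
  have ee: "b e e = 0"
    unfolding e_def by (rule EE')
  have F1: "b (F' j) unit = (if j = i0 then 1 else 0)" for j
  proof -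
    have "b (F' j) unit = (M *v x) $ j"
      unfolding F'_def b_sum_left b_scale_left by (simp add: matrix_vector_mult_def x_def b_sym[of _ unit])
    then show ?thesis
      unfolding MN by (simp add: axis_def)
  qed
  \<comment> \<open>Only the \<open>E'\<close> need a correction by \<open>e\<close>: the
    \<open>F'\<close> with index other than \<open>i0\<close> are already orthogonal to
    \<open>unit\<close>, because \<open>M *v x = axis i0 1\<close>.\<close>
  define G where "G j = E' j - b (E' j) unit *\<^sub>s e" for j
  have Ge: "b (G j) e = 0" and eG: "b e (G j) = 0" for j
    unfolding G_def e_def by (simp_all add: b_linear EE')
  have GG: "b (G j) (G k) = 0" for j k
    unfolding G_def e_def by (simp add: b_linear EE')
  have G1: "b (G j) unit = 0" for j
    unfolding G_def by (simp add: b_linear e1)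
  have eF: "b e (F' j) = (if j = i0 then 1 else 0)" for j
    unfolding e_def EF' by auto
  have FG: "b (F' j) (G k) = (if j = k then 1 else 0)" if "j \<noteq> i0" for j k
    unfolding b_sym[of "F' j"] G_def using that by (simp add: b_linear EF' eF)
  have Fe: "b (F' j) e = (if j = i0 then 1 else 0)" for j
    unfolding b_sym[of "F' j"] by (rule eF)
  obtain j1 j2 j3 where j: "j1 \<noteq> i0" "j2 \<noteq> i0" "j3 \<noteq> i0" "j1 \<noteq> j2" "j1 \<noteq> j3" "j2 \<noteq> j3"
  proof -
    have "i0 = 1 \<or> i0 = 2 \<or> i0 = 3 \<or> i0 = 4"
      by (rule exhaust_4)
    then show ?thesis
      using that[of 2 3 4] that[of 1 3 4] that[of 1 2 4] that[of 1 2 3] ne by metis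
  qed
  have "peirce_frame scale mult unit q e (G j1) (G j2) (G j3) (F' j1) (F' j2) (F' j3)"
    by unfold_locales (use j in \<open>simp_all add: q_eq_0 ee e1 GG FF' G1 Ge F1 Fe FG\<close>)
  then show ?thesis
    by blast
qed

text \<open>
  The columns of the left multiplication by \<open>z\<close> in the quaternion algebra \<open>i\<^sup>2 = p\<close>, \<open>j\<^sup>2 = r\<close>; this map is a
  similitude of the norm form with factor \<open>N(z)\<close>.
\<close>

definition quaternion_column :: "'r \<Rightarrow> 'r \<Rightarrow> 'r \<Rightarrow> 'r \<Rightarrow> 'r \<Rightarrow> 'r \<Rightarrow> nat \<Rightarrow> nat \<Rightarrow> 'r" where
  "quaternion_column p r z0 z1 z2 z3 i =
    (!) ([[z0, z1, z2, z3], [p * z1, z0, - p * z3, - z2], [r * z2, r * z3, z0, z1],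
      [- p * r * z3, - r * z2, p * z1, z0]] ! i)"

text \<open>The form is the sum of a quaternion norm form and its multiple by
  \<open>- \<kappa>\<close>, where \<open>\<kappa>\<close> is one of its values. Multiplication by a
  quaternion of norm \<open>\<kappa>\<close> turns the \<open>c i\<close> into vectors
  \<open>y i\<close> whose norms are opposite to those of the \<open>d i\<close>.\<close>

lemma hyperbolic_basis_if_similitude:
  fixes c d :: "nat \<Rightarrow> 'v"
  assumes cc: "\<And>i j. i < 4 \<Longrightarrow> j < 4 \<Longrightarrow> i \<noteq> j \<Longrightarrow> b (c i) (c j) = 0"
    and dd: "\<And>i j. i < 4 \<Longrightarrow> j < 4 \<Longrightarrow> i \<noteq> j \<Longrightarrow> b (d i) (d j) = 0"
    and cd: "\<And>i j. i < 4 \<Longrightarrow> j < 4 \<Longrightarrow> b (c i) (d j) = 0"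
    and qc: "q (c 0) = 1" "q (c 1) = - p" "q (c 2) = - r" "q (c 3) = p * r"
    and qd: "\<And>i. i < 4 \<Longrightarrow> q (d i) = - (\<kappa> * q (c i))"
    and \<kappa>: "\<kappa> = z0 * z0 - p * z1 * z1 - r * z2 * z2 + p * r * z3 * z3"
    and units: "p dvd 1" "r dvd 1" "\<kappa> dvd 1"
  obtains E F where "hyperbolic_basis E F"
proof -
  define Z where "Z = quaternion_column p r z0 z1 z2 z3"
  define y where "y i = (\<Sum>l<4. Z i l *\<^sub>s c l)" for i
  have less4: "i = 0 \<or> i = 1 \<or> i = 2 \<or> i = 3" if "i < 4" for i :: nat
    using that by linarith
  have bcc: "b (c i) (c j) = (if i = j then 2 * q (c i) else 0)" if "i < 4" "j < 4" for i j
    using cc that by (auto simp: b_self)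
  have bdd: "b (d i) (d j) = (if i = j then - (2 * (\<kappa> * q (c i))) else 0)" if "i < 4" "j < 4" for i j
    using dd qd that by (auto simp: b_self)
  have yy: "b (y i) (y j) = (if i = j then 2 * (\<kappa> * q (c i)) else 0)" if ij: "i < 4" "j < 4" for i j
  proof -
    have "b (y i) (y j) = (\<Sum>l<4. \<Sum>m<4. Z j l * (Z i m * b (c m) (c l)))"
      unfolding y_def by (simp only: b_sum_left b_sum_right b_scale_left b_scale_right sum_distrib_left)
    also have "\<dots> = (\<Sum>l<4. Z j l * (Z i l * (2 * q (c l))))"
    proof (intro sum.cong refl)
      fix l :: nat assume l: "l \<in> {..<4}"
      have "(\<Sum>m<4. Z j l * (Z i m * b (c m) (c l))) = (\<Sum>m<4. if m = l then Z j l * (Z i l * (2 * q (c l))) else 0)"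
        using l by (intro sum.cong refl) (simp add: bcc)
      then show "(\<Sum>m<4. Z j l * (Z i m * b (c m) (c l))) = Z j l * (Z i l * (2 * q (c l)))"
        using l by simp
    qed
    also have "\<dots> = 2 * (Z i 0 * Z j 0 - p * (Z i 1 * Z j 1) - r * (Z i 2 * Z j 2) + p * r * (Z i 3 * Z j 3))"
      using qc by (simp add: eval_nat_numeral algebra_simps)
    also have "\<dots> = (if i = j then 2 * (\<kappa> * q (c i)) else 0)"
      using less4[OF ij(1)] less4[OF ij(2)] qc
      by (elim disjE) (simp_all add: Z_def quaternion_column_def \<kappa> algebra_simps)
    finally show ?thesis .
  qed
  have yd: "b (y i) (d j) = 0" "b (d j) (y i) = 0" if "j < 4" for i j
  proof -
    show "b (y i) (d j) = 0"
      unfolding y_def b_sum_left b_scale_left using cd that by simp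
    then show "b (d j) (y i) = 0"
      using b_sym by simp
  qed
  have "\<exists>k. 4 * (\<kappa> * q (c i)) * k = 1" if "i < 4" for i
  proof -
    have "q (c i) dvd 1"
      using less4[OF that] qc mult_dvd_mono[OF units(1,2)] units by auto
    moreover have "2 * 2 dvd (1 * 1 :: 'r)"
      by (rule mult_dvd_mono[OF two two])
    ultimately have "4 * (\<kappa> * q (c i)) dvd 1 * (1 * 1)"
      using units(3) by (intro mult_dvd_mono) simp_all
    then show ?thesis
      by (metis dvdE mult_1)
  qed
  then obtain k where k: "\<And>i. i < 4 \<Longrightarrow> 4 * (\<kappa> * q (c i)) * k i = 1"
    by metis
  \<comment> \<open>Orthogonal vectors of opposite norms have isotropic sum and difference; these
    pair to \<open>4 * (\<kappa> * q (c i))\<close>, which \<open>k i\<close> inverts.\<close>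
  define E where "E i = y i + d i" for i
  define F where "F i = k i *\<^sub>s (y i - d i)" for i
  have "hyperbolic_basis E F"
    unfolding hyperbolic_basis_def
  proof (intro allI impI conjI)
    fix i j :: nat assume ij: "i < 4" "j < 4"
    show "b (E i) (E j) = 0"
      unfolding E_def b_add_left b_add_right yd[OF ij(1)] yd[OF ij(2)] yy[OF ij] bdd[OF ij] by simp
    show "b (F i) (F j) = 0"
      unfolding F_def b_scale_left b_scale_right b_diff_left b_diff_right yd[OF ij(1)] yd[OF ij(2)] yy[OF ij] bdd[OF ij]
      by simp
    have "b (E i) (F j) = k j * (if i = j then 4 * (\<kappa> * q (c i)) else 0)"
      unfolding F_def E_def b_scale_right b_add_left b_diff_right yd[OF ij(1)] yd[OF ij(2)] yy[OF ij] bdd[OF ij]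
      by simp
    also have "\<dots> = (if i = j then 4 * (\<kappa> * q (c i)) * k i else 0)"
      by (cases "i = j") (simp_all only: if_True if_False mult_zero_right mult_zero_left simp_thms mult.commute)
    finally show "b (E i) (F j) = (if i = j then 1 else 0)"
      unfolding k[OF ij(1)] .
  qed
  then show ?thesis
    by (rule that)
qed

end

lemma laurent_hyperbolic_cayley_triple:
  fixes scale :: "'k::field_char_0 laurent \<Rightarrow> 'v::ab_group_add \<Rightarrow> 'v" and mult :: "'v \<Rightarrow> 'v \<Rightarrow> 'v"
  assumes C: "composition_algebra scale mult unit q"
    and dep: "composition_algebra.dependent9 scale"
    and h: "composition_algebra.hyperbolic_basis q E F"
  shows "\<exists>i j k. composition_algebra.cayley_triple mult unit q i j k \<and> q i = - 1 \<and> q j = 1 \<and> q k = 1"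
proof -
  interpret composition_algebra scale mult unit q
    by (rule C)
  have complete: "\<exists>i. vec_equiv x (axis i 1)" if "(\<Sum>i\<in>UNIV. x $ i * y $ i) = 1" for x y :: "'k laurent^4"
  proof -
    have "unimodular x"
      unfolding unimodular_def using that by (intro exI[of _ y]) (simp add: mult.commute)
    moreover have "(1::4) \<noteq> 2"
      by simp
    ultimately show ?thesis
      using laurent_unimodular_equiv by blast
  qed
  have "\<exists>e E1 E2 E3 F1 F2 F3. peirce_frame scale mult unit q e E1 E2 E3 F1 F2 F3"
    by (rule hyperbolic_basis_peirce_frame[OF dep h]) (rule complete)
  then obtain e E1 E2 E3 F1 F2 F3 where "peirce_frame scale mult unit q e E1 E2 E3 F1 F2 F3"
    by blast
  then show ?thesis
    using laurent_peirce_frame_cayley_triple dep by blast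
qed

text \<open>Multiplying a hyperbolic norm by a unit leaves it hyperbolic, after rescaling the
  \<open>F i\<close>. So both algebras have Cayley triples with the same norms.\<close>

lemma laurent_isotope_isomorphic_if_hyperbolic:
  fixes scale :: "'k::field_char_0 laurent \<Rightarrow> 'v::ab_group_add \<Rightarrow> 'v" and mult :: "'v \<Rightarrow> 'v \<Rightarrow> 'v"
  assumes C: "composition_algebra scale mult unit q"
    and dep: "composition_algebra.dependent9 scale"
    and h: "composition_algebra.hyperbolic_basis q E F"
    and k: "q a * q c * k = 1"
  obtains T where "bij T" "\<And>x y. T (x + y) = T x + T y" "\<And>r x. T (scale r x) = scale r (T x)"
    "\<And>x y. T (mult x y) = composition_algebra.isotope_mult mult a c (T x) (T y)"
proof -
  interpret A: composition_algebra scale mult unit q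
    by (rule C)
  interpret B: composition_algebra scale "A.isotope_mult a c" "scale k (mult (A.cnj c) (A.cnj a))" "\<lambda>x. q a * q c * q x"
    by (rule A.composition_algebra_isotope[OF k])
  interpret composition_algebra_pair scale mult unit q "A.isotope_mult a c" "scale k (mult (A.cnj c) (A.cnj a))"
    "\<lambda>x. q a * q c * q x"
    by unfold_locales
  have Bb: "B.b x y = q a * q c * A.b x y" for x y
    unfolding B.b_def A.b_def by (simp only: right_diff_distrib)
  have "B.hyperbolic_basis E (\<lambda>i. scale k (F i))"
    unfolding B.hyperbolic_basis_def
  proof (intro allI impI conjI)
    fix i j :: nat assume ij: "i < 4" "j < 4"
    have EF: "A.b (E i) (E j) = 0" "A.b (F i) (F j) = 0" "A.b (E i) (F j) = (if i = j then 1 else 0)"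
      using h ij unfolding A.hyperbolic_basis_def by blast+
    show "B.b (E i) (E j) = 0" "B.b (scale k (F i)) (scale k (F j)) = 0"
      unfolding Bb A.b_scale_left A.b_scale_right EF by simp_all
    show "B.b (E i) (scale k (F j)) = (if i = j then 1 else 0)"
      unfolding Bb A.b_scale_right EF mult.assoc[symmetric] k by simp
  qed
  from laurent_hyperbolic_cayley_triple[OF B.composition_algebra_axioms dep this]
  obtain i' j' l' where t': "B.cayley_triple i' j' l'" "q a * q c * q i' = - 1" "q a * q c * q j' = 1" "q a * q c * q l' = 1"
    by blast
  obtain i j l where t: "A.cayley_triple i j l" "q i = - 1" "q j = 1" "q l = 1"
    using laurent_hyperbolic_cayley_triple[OF C dep h] by blast
  have "q i = q a * q c * q i'" "q j = q a * q c * q j'" "q l = q a * q c * q l'"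
    using t t' by simp_all
  from isomorphic_if_cayley_triples[OF t(1) t'(1) this] show ?thesis
    using that by blast
qed

section \<open>Diagonal forms with monomial coefficients\<close>

lemma double_inject:
  fixes s t :: "'g::linordered_ab_group_add"
  shows "s + s = t + t \<longleftrightarrow> s = t"
  by (metis add_strict_mono less_irrefl linorder_neqE)

lemma two_single:
  fixes \<gamma> :: "'a::comm_ring_1"
  shows "2 * Poly_Mapping.single m \<gamma> = Poly_Mapping.single (m :: 'g::comm_monoid_add) (2 * \<gamma>)"
  using mult_single[of 0 2 m \<gamma>] by simp

lemma lookup_mult_keys:
  fixes p r :: "'g::monoid_add \<Rightarrow>\<^sub>0 'a::semiring_0"
  shows "Poly_Mapping.lookup (p * r) m = (\<Sum>s\<in>Poly_Mapping.keys p. \<Sum>t\<in>Poly_Mapping.keys r.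
    if s + t = m then Poly_Mapping.lookup p s * Poly_Mapping.lookup r t else 0)"
proof -
  have "p * r = (\<Sum>s\<in>Poly_Mapping.keys p. \<Sum>t\<in>Poly_Mapping.keys r.
      Poly_Mapping.single (s + t) (Poly_Mapping.lookup p s * Poly_Mapping.lookup r t))"
    by (subst sum_single_keys[of p], subst sum_single_keys[of r]) (simp add: sum_product mult_single)
  then show ?thesis
    by (simp add: lookup_sum lookup_single when_def)
qed

lemma lookup_mult_unique:
  fixes p r :: "'g::monoid_add \<Rightarrow>\<^sub>0 'a::semiring_0"
  assumes "s0 + t0 = m"
    and unique: "\<And>s t. s \<in> Poly_Mapping.keys p \<Longrightarrow> t \<in> Poly_Mapping.keys r \<Longrightarrow> s + t = m \<Longrightarrow> s = s0 \<and> t = t0"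
  shows "Poly_Mapping.lookup (p * r) m = Poly_Mapping.lookup p s0 * Poly_Mapping.lookup r t0"
proof -
  have "Poly_Mapping.lookup (p * r) m = (\<Sum>s\<in>Poly_Mapping.keys p. \<Sum>t\<in>Poly_Mapping.keys r.
      if t = t0 then if s = s0 then Poly_Mapping.lookup p s0 * Poly_Mapping.lookup r t0 else 0 else 0)"
    unfolding lookup_mult_keys
  proof (intro sum.cong refl)
    fix s t assume st: "s \<in> Poly_Mapping.keys p" "t \<in> Poly_Mapping.keys r"
    show "(if s + t = m then Poly_Mapping.lookup p s * Poly_Mapping.lookup r t else 0)
        = (if t = t0 then if s = s0 then Poly_Mapping.lookup p s0 * Poly_Mapping.lookup r t0 else 0 else 0)"
    proof (cases "s + t = m")
      case True
      then show ?thesis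
        using unique[OF st] by simp
    next
      case False
      then show ?thesis
        using assms(1) by (cases "t = t0"; cases "s = s0") simp_all
    qed
  qed
  then show ?thesis
    by (cases "Poly_Mapping.lookup r t0 = 0") (simp_all add: in_keys_iff)
qed

lemma lookup_mult_none:
  fixes p r :: "'g::monoid_add \<Rightarrow>\<^sub>0 'a::semiring_0"
  assumes "\<And>s t. s \<in> Poly_Mapping.keys p \<Longrightarrow> t \<in> Poly_Mapping.keys r \<Longrightarrow> s + t \<noteq> m"
  shows "Poly_Mapping.lookup (p * r) m = 0"
  unfolding lookup_mult_keys using assms by (intro sum.neutral ballI) simp

text \<open>In an ordered group the least exponents of two factors add up to an exponent of the
  product, and so do the greatest ones. If the product is 1, both sums are zero, which leaves no
  room between least and greatest.\<close>

lemma unit_monomial: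
  fixes p :: "'g::linordered_ab_group_add \<Rightarrow>\<^sub>0 'a::field"
  assumes "p dvd 1"
  obtains m \<gamma> where "p = Poly_Mapping.single m \<gamma>" "\<gamma> \<noteq> 0"
proof -
  obtain r where r: "p * r = 1"
    using assms by (metis dvdE)
  let ?P = "Poly_Mapping.keys p" and ?R = "Poly_Mapping.keys r"
  have ne: "?P \<noteq> {}" "?R \<noteq> {}"
  proof -
    have "p \<noteq> 0" "r \<noteq> 0"
      using r by auto
    then show "?P \<noteq> {}" "?R \<noteq> {}"
      using sum_single_keys[of p] sum_single_keys[of r] by force+
  qed
  have P: "Min ?P \<in> ?P" "Max ?P \<in> ?P" "\<And>s. s \<in> ?P \<Longrightarrow> Min ?P \<le> s" "\<And>s. s \<in> ?P \<Longrightarrow> s \<le> Max ?P"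
    using ne by simp_all
  have R: "Min ?R \<in> ?R" "Max ?R \<in> ?R" "\<And>s. s \<in> ?R \<Longrightarrow> Min ?R \<le> s" "\<And>s. s \<in> ?R \<Longrightarrow> s \<le> Max ?R"
    using ne by simp_all
  have "Poly_Mapping.lookup (p * r) (Min ?P + Min ?R) = Poly_Mapping.lookup p (Min ?P) * Poly_Mapping.lookup r (Min ?R)"
  proof (rule lookup_mult_unique[OF refl])
    fix s t assume "s \<in> ?P" "t \<in> ?R" "s + t = Min ?P + Min ?R"
    then show "s = Min ?P \<and> t = Min ?R"
      using P(3)[of s] R(3)[of t] by (metis add_less_le_mono add_le_less_mono less_irrefl order_less_le)
  qed
  then have 1: "Min ?P + Min ?R = 0"
    using P(1) R(1) unfolding r by (auto simp: lookup_one when_def in_keys_iff split: if_splits)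
  have "Poly_Mapping.lookup (p * r) (Max ?P + Max ?R) = Poly_Mapping.lookup p (Max ?P) * Poly_Mapping.lookup r (Max ?R)"
  proof (rule lookup_mult_unique[OF refl])
    fix s t assume "s \<in> ?P" "t \<in> ?R" "s + t = Max ?P + Max ?R"
    then show "s = Max ?P \<and> t = Max ?R"
      using P(4)[of s] R(4)[of t] by (metis add_less_le_mono add_le_less_mono less_irrefl order_less_le)
  qed
  then have 2: "Max ?P + Max ?R = 0"
    using P(2) R(2) unfolding r by (auto simp: lookup_one when_def in_keys_iff split: if_splits)
  have le: "Min ?P \<le> Max ?P" "Min ?R \<le> Max ?R"
    using P R by blast+
  have eq: "Min ?P = Max ?P"
  proof (rule ccontr)
    assume "Min ?P \<noteq> Max ?P"
    then have "Min ?P + Min ?R < Max ?P + Max ?R"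
      using le by (intro add_less_le_mono) simp_all
    then show False
      using 1 2 by simp
  qed
  have "?P = {Min ?P}"
    using P eq by (metis antisym insertI1 singletonD subset_singletonD subsetI empty_iff ne(1))
  then have "p = Poly_Mapping.single (Min ?P) (Poly_Mapping.lookup p (Min ?P))"
    using sum_single_keys[of p] by (metis (no_types, lifting) finite.emptyI sum.insert sum.empty empty_iff add.right_neutral)
  moreover have "Poly_Mapping.lookup p (Min ?P) \<noteq> 0"
    using P(1) by (simp add: in_keys_iff)
  ultimately show ?thesis
    using that by blast
qed

section \<open>Homogeneous vectors and anisotropic residue forms\<close>

locale monomial_composition_algebra = composition_algebra scale mult unit q
  for scale :: "'k::field_char_0 laurent \<Rightarrow> 'v::ab_group_add \<Rightarrow> 'v" (infixr \<open>*\<^sub>s\<close> 75)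
    and mult (infixl \<open>\<star>\<close> 70) and unit q +
  fixes g :: "nat \<Rightarrow> 'v" and d :: "nat \<Rightarrow> nat \<Rightarrow>\<^sub>0 int" and \<alpha> :: "nat \<Rightarrow> 'k"
  assumes dep: dependent9
    and orthogonal: "\<And>i j. i < 8 \<Longrightarrow> j < 8 \<Longrightarrow> i \<noteq> j \<Longrightarrow> b (g i) (g j) = 0"
    and qg: "\<And>k. k < 8 \<Longrightarrow> q (g k) = Poly_Mapping.single (d k) (\<alpha> k)"
    and \<alpha>: "\<And>k. k < 8 \<Longrightarrow> \<alpha> k \<noteq> 0"
begin

definition crd :: "'v \<Rightarrow> nat \<Rightarrow> 'k laurent" where
  "crd z k = Poly_Mapping.single (- d k) (1 / (2 * \<alpha> k)) * b z (g k)"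

lemma bgg: "k < 8 \<Longrightarrow> b (g k) (g k) = Poly_Mapping.single (d k) (2 * \<alpha> k)"
  unfolding b_self by (simp add: qg two_single)

lemma crd_expansion: "z = (\<Sum>k<8. crd z k *\<^sub>s g k)"
proof -
  have "b (g i) (Poly_Mapping.single (- d j) (1 / (2 * \<alpha> j)) *\<^sub>s g j) = (if i = j then 1 else 0)" if "i < 8" "j < 8" for i j
  proof (cases "i = j")
    case True
    then show ?thesis
      using bgg[OF that(1)] \<alpha>[OF that(1)] by (simp add: b_scale_right mult_single)
  next
    case False
    then show ?thesis
      using orthogonal[OF that False] by (simp add: b_scale_right)
  qed
  from dual_basis_expansion[OF dep this, of z] show ?thesis
    unfolding crd_def b_scale_right .
qed

lemma crd_sum:
  assumes "k < 8"
  shows "crd (\<Sum>k<8. c k *\<^sub>s g k) k = c k"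
proof -
  have "b (\<Sum>k<8. c k *\<^sub>s g k) (g k) = (\<Sum>i<8. if i = k then c k * Poly_Mapping.single (d k) (2 * \<alpha> k) else 0)"
    unfolding b_sum_left b_scale_left using assms orthogonal bgg by (intro sum.cong refl) auto
  then have "crd (\<Sum>k<8. c k *\<^sub>s g k) k = c k * (Poly_Mapping.single (- d k) (1 / (2 * \<alpha> k)) * Poly_Mapping.single (d k) (2 * \<alpha> k))"
    unfolding crd_def using assms by (simp add: mult_ac)
  then show ?thesis
    using \<alpha>[OF assms] by (simp add: mult_single)
qed

lemma crd_diff: "crd (z - w) k = crd z k - crd w k"
  by (simp add: crd_def b_diff_left right_diff_distrib)

lemma b_g: "k < 8 \<Longrightarrow> b (g k) z = Poly_Mapping.single (d k) (2 * \<alpha> k) * crd z k"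
proof -
  assume k: "k < 8"
  have "Poly_Mapping.single (d k) (2 * \<alpha> k) * crd z k
      = (Poly_Mapping.single (d k) (2 * \<alpha> k) * Poly_Mapping.single (- d k) (1 / (2 * \<alpha> k))) * b z (g k)"
    unfolding crd_def by (simp only: mult.assoc)
  also have "\<dots> = b z (g k)"
    using \<alpha>[OF k] by (simp add: mult_single)
  finally show ?thesis
    by (simp only: b_sym[of "g k"])
qed

lemma b_crd: "b z w = (\<Sum>k<8. crd z k * (Poly_Mapping.single (d k) (2 * \<alpha> k) * crd w k))"
proof -
  have "b z w = b (\<Sum>k<8. crd z k *\<^sub>s g k) w"
    using arg_cong[OF crd_expansion[of z], of "\<lambda>z. b z w"] .
  also have "\<dots> = (\<Sum>k<8. crd z k * b (g k) w)"
    by (simp only: b_sum_left b_scale_left)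
  also have "\<dots> = (\<Sum>k<8. crd z k * (Poly_Mapping.single (d k) (2 * \<alpha> k) * crd w k))"
    by (intro sum.cong refl) (simp add: b_g)
  finally show ?thesis .
qed

lemma q_crd: "q z = (\<Sum>k<8. Poly_Mapping.single (d k) (\<alpha> k) * (crd z k * crd z k))"
proof -
  have "2 * q z = (\<Sum>k<8. crd z k * (Poly_Mapping.single (d k) (2 * \<alpha> k) * crd z k))"
    using b_crd[of z z] unfolding b_self .
  also have "\<dots> = 2 * (\<Sum>k<8. Poly_Mapping.single (d k) (\<alpha> k) * (crd z k * crd z k))"
    unfolding sum_distrib_left
  proof (intro sum.cong refl)
    fix k
    have "Poly_Mapping.single (d k) (2 * \<alpha> k) = 2 * Poly_Mapping.single (d k) (\<alpha> k)"
      by (rule two_single[symmetric])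
    then show "crd z k * (Poly_Mapping.single (d k) (2 * \<alpha> k) * crd z k)
        = 2 * (Poly_Mapping.single (d k) (\<alpha> k) * (crd z k * crd z k))"
      by (simp only: mult_ac)
  qed
  finally show ?thesis
    using two_nonzero by simp
qed

text \<open>The grading in which \<open>g k\<close> has half the degree \<open>d k\<close>; degrees
  are doubled to avoid fractions, so that \<open>m\<close> is also the degree of the norm.\<close>

definition homogeneous :: "(nat \<Rightarrow>\<^sub>0 int) \<Rightarrow> 'v \<Rightarrow> bool" where
  "homogeneous m z \<longleftrightarrow> (\<forall>k<8. \<forall>s\<in>Poly_Mapping.keys (crd z k). s + s + d k = m)"

text \<open>These are residue forms as in Springer's theorem: for each \<open>m\<close>, the form
  over the field on those \<open>k\<close> for which \<open>m - d k\<close> is divisible by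
  two.\<close>

definition anisotropic :: bool where
  "anisotropic \<longleftrightarrow> (\<forall>m t \<eta>. (\<forall>k<8. \<eta> k \<noteq> 0 \<longrightarrow> t k + t k + d k = m) \<longrightarrow>
    (\<Sum>k<8. \<alpha> k * (\<eta> k * \<eta> k)) = 0 \<longrightarrow> (\<forall>k<8. \<eta> k = 0))"

lemma homogeneous_monomials:
  assumes "homogeneous m z"
  obtains t \<eta> where "\<And>k. k < 8 \<Longrightarrow> crd z k = Poly_Mapping.single (t k) (\<eta> k)"
    "\<And>k. k < 8 \<Longrightarrow> \<eta> k \<noteq> 0 \<Longrightarrow> t k + t k + d k = m"
proof -
  have "\<exists>t \<eta>. crd z k = Poly_Mapping.single t \<eta> \<and> (\<eta> \<noteq> 0 \<longrightarrow> t + t + d k = m)" if k: "k < 8" for k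
  proof (cases "Poly_Mapping.keys (crd z k) = {}")
    case True
    then have "crd z k = 0"
      using sum_single_keys[of "crd z k"] by simp
    then show ?thesis
      by (intro exI[of _ 0]) simp
  next
    case False
    then obtain s where s: "s \<in> Poly_Mapping.keys (crd z k)"
      by blast
    have "s' = s" if "s' \<in> Poly_Mapping.keys (crd z k)" for s'
    proof -
      have "s' + s' + d k = s + s + d k"
        using assms k s that unfolding homogeneous_def by metis
      then show ?thesis
        by (simp add: double_inject)
    qed
    then have "Poly_Mapping.keys (crd z k) = {s}"
      using s by blast
    then have "crd z k = Poly_Mapping.single s (Poly_Mapping.lookup (crd z k) s)"
      using sum_single_keys[of "crd z k"] by simp
    then show ?thesis
      using assms k s unfolding homogeneous_def by blast
  qed
  then have "\<forall>k. \<exists>t \<eta>. k < 8 \<longrightarrow> crd z k = Poly_Mapping.single t \<eta> \<and> (\<eta> \<noteq> 0 \<longrightarrow> t + t + d k = m)"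
    by blast
  then obtain t \<eta> where "\<forall>k. k < 8 \<longrightarrow> crd z k = Poly_Mapping.single (t k) (\<eta> k) \<and> (\<eta> k \<noteq> 0 \<longrightarrow> t k + t k + d k = m)"
    by metis
  then show ?thesis
    using that by blast
qed

lemma q_monomials:
  assumes "\<And>k. k < 8 \<Longrightarrow> crd z k = Poly_Mapping.single (t k) (\<eta> k)"
    "\<And>k. k < 8 \<Longrightarrow> \<eta> k \<noteq> 0 \<Longrightarrow> t k + t k + d k = m"
  shows "q z = Poly_Mapping.single m (\<Sum>k<8. \<alpha> k * (\<eta> k * \<eta> k))"
proof -
  have sum: "Poly_Mapping.single m (sum f S) = (\<Sum>k\<in>S. Poly_Mapping.single m (f k))" for f :: "nat \<Rightarrow> 'k" and S
    by (induction S rule: infinite_finite_induct) (simp_all add: single_add)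
  have "q z = (\<Sum>k<8. Poly_Mapping.single (d k) (\<alpha> k) * (crd z k * crd z k))"
    by (rule q_crd)
  also have "\<dots> = (\<Sum>k<8. Poly_Mapping.single m (\<alpha> k * (\<eta> k * \<eta> k)))"
  proof (rule sum.cong[OF refl])
    fix k :: nat assume "k \<in> {..<8}"
    then have k: "k < 8"
      by simp
    show "Poly_Mapping.single (d k) (\<alpha> k) * (crd z k * crd z k) = Poly_Mapping.single m (\<alpha> k * (\<eta> k * \<eta> k))"
    proof (cases "\<eta> k = 0")
      case False
      then have m: "m = d k + (t k + t k)"
        using assms(2)[OF k False] by (simp add: add.commute)
      show ?thesis
        unfolding assms(1)[OF k] mult_single m ..
    next
      case True
      show ?thesis
        unfolding assms(1)[OF k] True by simp
    qed
  qed
  finally show ?thesis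
    by (simp only: sum)
qed

lemma homogeneous_unit_norm:
  assumes "anisotropic" "homogeneous m z" "z \<noteq> 0"
  shows "q z dvd 1"
proof -
  obtain t \<eta> where t: "\<And>k. k < 8 \<Longrightarrow> crd z k = Poly_Mapping.single (t k) (\<eta> k)"
    "\<And>k. k < 8 \<Longrightarrow> \<eta> k \<noteq> 0 \<Longrightarrow> t k + t k + d k = m"
    using homogeneous_monomials[OF assms(2)] by blast
  define \<gamma> where "\<gamma> = (\<Sum>k<8. \<alpha> k * (\<eta> k * \<eta> k))"
  have "\<gamma> \<noteq> 0"
  proof
    assume "\<gamma> = 0"
    then have "\<forall>k<8. \<eta> k = 0"
      using assms(1) t(2) unfolding anisotropic_def \<gamma>_def by blast
    then have "z = 0"
      using t(1) by (subst crd_expansion) simp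
    then show False
      using assms(3) by blast
  qed
  moreover have "q z = Poly_Mapping.single m \<gamma>"
    unfolding \<gamma>_def using t by (rule q_monomials)
  ultimately have "q z * Poly_Mapping.single (- m) (1 / \<gamma>) = 1"
    by (simp add: mult_single)
  then show ?thesis
    by (metis dvd_triv_left)
qed

text \<open>At an extremal degree no mixed products of monomials contribute, so the coefficient
  there is a value of a residue form at a nonzero vector.\<close>

lemma lookup_q_extremal:
  assumes an: anisotropic
    and ex: "k0 < 8" "s0 \<in> Poly_Mapping.keys (crd z k0)" "s0 + s0 + d k0 = m"
    and extremal: "\<And>k s t. k < 8 \<Longrightarrow> s \<in> Poly_Mapping.keys (crd z k) \<Longrightarrow> t \<in> Poly_Mapping.keys (crd z k) \<Longrightarrow>
      s + t + d k = m \<Longrightarrow> s + s + d k = m \<and> t + t + d k = m"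
  shows "Poly_Mapping.lookup (q z) m \<noteq> 0"
proof
  assume zero: "Poly_Mapping.lookup (q z) m = 0"
  define t where "t k = (SOME s. s + s + d k = m)" for k
  define \<eta> where "\<eta> k = (if \<exists>s. s + s + d k = m then Poly_Mapping.lookup (crd z k) (t k) else 0)" for k
  have t: "t k + t k + d k = m" if "\<exists>s. s + s + d k = m" for k
    unfolding t_def using someI_ex[OF that] .
  have tI: "s = t k" if "s + s + d k = m" for s k
  proof -
    have "t k + t k + d k = s + s + d k"
      using t[of k] that by auto
    then show ?thesis
      by (simp add: double_inject)
  qed
  have sq: "Poly_Mapping.lookup (crd z k * crd z k) (m - d k) = \<eta> k * \<eta> k" if k: "k < 8" for k
  proof (cases "\<exists>s. s + s + d k = m")
    case True
    have "Poly_Mapping.lookup (crd z k * crd z k) (m - d k)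
        = Poly_Mapping.lookup (crd z k) (t k) * Poly_Mapping.lookup (crd z k) (t k)"
    proof (rule lookup_mult_unique)
      show "t k + t k = m - d k"
        using t[OF True] by (simp add: eq_diff_eq)
      fix s s' assume "s \<in> Poly_Mapping.keys (crd z k)" "s' \<in> Poly_Mapping.keys (crd z k)" "s + s' = m - d k"
      then show "s = t k \<and> s' = t k"
        using extremal[OF k, of s s'] tI by (simp add: eq_diff_eq)
    qed
    then show ?thesis
      using True by (simp add: \<eta>_def)
  next
    case False
    have "Poly_Mapping.lookup (crd z k * crd z k) (m - d k) = 0"
    proof (rule lookup_mult_none)
      fix s s' assume "s \<in> Poly_Mapping.keys (crd z k)" "s' \<in> Poly_Mapping.keys (crd z k)"
      then show "s + s' \<noteq> m - d k"
        using extremal[OF k, of s s'] False by (auto simp: eq_diff_eq)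
    qed
    then show ?thesis
      using False by (simp add: \<eta>_def)
  qed
  have "Poly_Mapping.lookup (q z) m = (\<Sum>k<8. \<alpha> k * Poly_Mapping.lookup (crd z k * crd z k) (m - d k))"
    by (subst q_crd) (simp only: lookup_sum lookup_single_mult)
  also have "\<dots> = (\<Sum>k<8. \<alpha> k * (\<eta> k * \<eta> k))"
    by (intro sum.cong refl) (simp add: sq)
  finally have "(\<Sum>k<8. \<alpha> k * (\<eta> k * \<eta> k)) = 0"
    using zero by simp
  moreover have "\<eta> k \<noteq> 0 \<longrightarrow> t k + t k + d k = m" for k
    using t[of k] by (auto simp: \<eta>_def)
  ultimately have "\<eta> k0 = 0"
    using an ex(1) unfolding anisotropic_def by blast
  moreover have "\<eta> k0 = Poly_Mapping.lookup (crd z k0) s0"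
    unfolding \<eta>_def using ex(3) tI[OF ex(3)] by auto
  ultimately show False
    using ex(2) by (simp add: in_keys_iff)
qed

text \<open>The least and the greatest degree occurring in \<open>z\<close> both appear in
  \<open>q z\<close>; a monomial has only one exponent, so they coincide.\<close>

lemma unit_norm_homogeneous:
  assumes an: anisotropic and u: "q z dvd 1"
  obtains m \<gamma> where "homogeneous m z" "q z = Poly_Mapping.single m \<gamma>" "\<gamma> \<noteq> 0"
proof -
  obtain m \<gamma> where m: "q z = Poly_Mapping.single m \<gamma>" "\<gamma> \<noteq> 0"
    using unit_monomial[OF u] by blast
  define T where "T = (\<Union>k<8. (\<lambda>s. s + s + d k) ` Poly_Mapping.keys (crd z k))"
  have fin: "finite T"
    unfolding T_def by simp
  have TI: "s + s + d k \<in> T" if "k < 8" "s \<in> Poly_Mapping.keys (crd z k)" for k s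
    using that unfolding T_def by blast
  have sums: "(s + t + d) + (s + t + d) = (s + s + d) + (t + t + d)" for s t d :: "nat \<Rightarrow>\<^sub>0 int"
    by (simp add: add_ac)
  have T_eq: "m0 = m" if m0: "m0 \<in> T" and ext: "(\<forall>x\<in>T. m0 \<le> x) \<or> (\<forall>x\<in>T. x \<le> m0)" for m0
  proof -
    obtain k0 s0 where k0: "k0 < 8" "s0 \<in> Poly_Mapping.keys (crd z k0)" "s0 + s0 + d k0 = m0"
      using m0 unfolding T_def by blast
    have "Poly_Mapping.lookup (q z) m0 \<noteq> 0"
    proof (rule lookup_q_extremal[OF an k0])
      fix k s t assume k: "k < 8" "s \<in> Poly_Mapping.keys (crd z k)" "t \<in> Poly_Mapping.keys (crd z k)" "s + t + d k = m0"
      have e: "(s + s + d k) + (t + t + d k) = m0 + m0"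
        using sums[of s t "d k"] unfolding k(4) by simp
      have mem: "s + s + d k \<in> T" "t + t + d k \<in> T"
        using TI k by blast+
      from ext show "s + s + d k = m0 \<and> t + t + d k = m0"
      proof
        assume "\<forall>x\<in>T. m0 \<le> x"
        then have "m0 \<le> s + s + d k" "m0 \<le> t + t + d k"
          using mem by blast+
        then show ?thesis
          using e by (metis add_less_le_mono add_le_less_mono less_irrefl order_less_le)
      next
        assume "\<forall>x\<in>T. x \<le> m0"
        then have "s + s + d k \<le> m0" "t + t + d k \<le> m0"
          using mem by blast+
        then show ?thesis
          using e by (metis add_less_le_mono add_le_less_mono less_irrefl order_less_le)
      qed
    qed
    then show ?thesis
      unfolding m(1) by (simp add: lookup_single when_def split: if_splits)
  qed
  have "x = m" if "x \<in> T" for x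
  proof -
    have ne: "T \<noteq> {}"
      using that by blast
    have "Min T = m" "Max T = m"
      using T_eq[OF Min_in[OF fin ne]] T_eq[OF Max_in[OF fin ne]] Min_le[OF fin] Max_ge[OF fin] by blast+
    then show ?thesis
      using Min_le[OF fin that] Max_ge[OF fin that] by simp
  qed
  then have "homogeneous m z"
    unfolding homogeneous_def using TI by blast
  then show ?thesis
    using that m by blast
qed

text \<open>Both vectors are homogeneous, and of the same degree because that degree is read off
  from the common norm; a nonzero difference is then homogeneous and has unit norm.\<close>

lemma anisotropic_difference:
  assumes an: anisotropic and u: "q x dvd 1" and eq: "q x = q y"
  shows "x = y \<or> q (x - y) dvd 1"
proof (cases "x = y")
  case False
  obtain m \<gamma> where m: "homogeneous m x" "q x = Poly_Mapping.single m \<gamma>" "\<gamma> \<noteq> 0"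
    using unit_norm_homogeneous[OF an u] by blast
  have "q y dvd 1"
    using u eq by simp
  then obtain m' \<gamma>' where m': "homogeneous m' y" "q y = Poly_Mapping.single m' \<gamma>'" "\<gamma>' \<noteq> 0"
    using unit_norm_homogeneous[OF an] by blast
  have "Poly_Mapping.keys (q x) = {m}" "Poly_Mapping.keys (q y) = {m'}"
    unfolding m(2) m'(2) using m(3) m'(3) by simp_all
  then have "m' = m"
    using eq by simp
  have "s \<in> Poly_Mapping.keys (crd x k) \<or> s \<in> Poly_Mapping.keys (crd y k)"
    if "s \<in> Poly_Mapping.keys (crd (x - y) k)" for s k
    using that unfolding crd_diff by (auto simp: in_keys_iff lookup_minus)
  then have "homogeneous m (x - y)"
    using m(1) m'(1) \<open>m' = m\<close> unfolding homogeneous_def by blast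
  then show ?thesis
    using homogeneous_unit_norm[OF an, of m "x - y"] False by simp
qed simp

lemma anisotropic_orthogonal:
  assumes an: anisotropic and u: "\<And>i. i < 4 \<Longrightarrow> q (y i) dvd 1"
  shows "\<exists>v. q v dvd 1 \<and> (\<forall>i<(4::nat). b v (y i) = 0)"
proof -
  have "\<exists>c. (\<exists>k\<in>{..<8::nat}. c k \<noteq> 0) \<and> (\<forall>i\<in>{..<4::nat}. (\<Sum>k\<in>{..<8}. c k * b (g k) (y i)) = 0)"
    by (rule linear_system_nontrivial_solution) simp_all
  then obtain c where c: "\<exists>k<8. c k \<noteq> 0" "\<And>i. i < 4 \<Longrightarrow> (\<Sum>k<8. c k * b (g k) (y i)) = 0"
    by auto
  obtain k0 where k0: "k0 < 8" "c k0 \<noteq> 0"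
    using c(1) by blast
  obtain s0 where s0: "s0 \<in> Poly_Mapping.keys (c k0)"
    using k0(2) sum_single_keys[of "c k0"] by force
  define m where "m = s0 + s0 + d k0"
  \<comment> \<open>The part of degree \<open>m\<close> of the solution. As each \<open>y i\<close>
    is homogeneous, every monomial of its equation receives contributions from one degree of
    \<open>c\<close> only, so this part is again a solution.\<close>
  define C where "C k = (\<Sum>s\<in>Poly_Mapping.keys (c k). if s + s + d k = m then Poly_Mapping.single s (Poly_Mapping.lookup (c k) s) else 0)" for k
  have lookup_C: "Poly_Mapping.lookup (C k) s = (if s + s + d k = m then Poly_Mapping.lookup (c k) s else 0)" for k s
  proof -
    have "Poly_Mapping.lookup (C k) s = (\<Sum>s'\<in>Poly_Mapping.keys (c k). if s' = s then
        (if s + s + d k = m then Poly_Mapping.lookup (c k) s else 0) else 0)"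
      unfolding C_def lookup_sum by (intro sum.cong refl) (auto simp: lookup_single when_def)
    then show ?thesis
      by (auto simp: in_keys_iff)
  qed
  define v where "v = (\<Sum>k<8. C k *\<^sub>s g k)"
  have cv: "crd v k = C k" if "k < 8" for k
    unfolding v_def by (rule crd_sum[OF that])
  have "homogeneous m v"
    unfolding homogeneous_def using cv by (auto simp: in_keys_iff lookup_C split: if_splits)
  moreover have "Poly_Mapping.lookup (crd v k0) s0 \<noteq> 0"
    unfolding cv[OF k0(1)] lookup_C using s0 by (simp add: m_def in_keys_iff)
  then have "v \<noteq> 0"
    by (auto simp: crd_def)
  ultimately have "q v dvd 1"
    using homogeneous_unit_norm[OF an] by blast
  moreover have "b v (y i) = 0" if i: "i < 4" for i
  proof -
    obtain m1 \<gamma> where m1: "homogeneous m1 (y i)"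
      using unit_norm_homogeneous[OF an u[OF i]] by blast
    obtain t \<eta> where t: "\<And>k. k < 8 \<Longrightarrow> crd (y i) k = Poly_Mapping.single (t k) (\<eta> k)"
      "\<And>k. k < 8 \<Longrightarrow> \<eta> k \<noteq> 0 \<Longrightarrow> t k + t k + d k = m1"
      using homogeneous_monomials[OF m1] by blast
    have bg: "b (g k) (y i) = Poly_Mapping.single (d k + t k) (2 * \<alpha> k * \<eta> k)" if "k < 8" for k
      unfolding b_g[OF that] t(1)[OF that] by (simp add: mult_single)
    show ?thesis
    proof (rule poly_mapping_eqI)
      fix M
      have "Poly_Mapping.lookup (b v (y i)) M
          = (\<Sum>k<8. Poly_Mapping.lookup (b (g k) (y i) * C k) M)"
        unfolding v_def b_sum_left b_scale_left lookup_sum by (simp only: mult.commute)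
      also have "\<dots> = (\<Sum>k<8. if M + M = m + m1 then Poly_Mapping.lookup (b (g k) (y i) * c k) M else 0)"
      proof (intro sum.cong refl)
        fix k :: nat assume "k \<in> {..<8}"
        then have k: "k < 8"
          by simp
        show "Poly_Mapping.lookup (b (g k) (y i) * C k) M
            = (if M + M = m + m1 then Poly_Mapping.lookup (b (g k) (y i) * c k) M else 0)"
        proof (cases "\<eta> k = 0")
          case False
          have "(M - (d k + t k)) + (M - (d k + t k)) + d k = M + M - (t k + t k + d k)"
            by (simp add: algebra_simps)
          also have "\<dots> = M + M - m1"
            unfolding t(2)[OF k False] ..
          finally have e: "(M - (d k + t k)) + (M - (d k + t k)) + d k = M + M - m1" .
          show ?thesis
            unfolding bg[OF k] lookup_single_mult lookup_C e diff_eq_eq by simp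
        qed (simp add: bg[OF k])
      qed
      also have "\<dots> = (if M + M = m + m1 then Poly_Mapping.lookup (\<Sum>k<8. c k * b (g k) (y i)) M else 0)"
        unfolding lookup_sum by (simp add: mult.commute)
      finally show "Poly_Mapping.lookup (b v (y i)) M = Poly_Mapping.lookup 0 M"
        unfolding c(2)[OF i] by simp
    qed
  qed
  ultimately show ?thesis
    by blast
qed

lemma anisotropic_orthogonal4:
  assumes an: anisotropic and u: "q x dvd 1" "q y dvd 1" "q z dvd 1" "q w dvd 1"
  shows "\<exists>v. q v dvd 1 \<and> b v x = 0 \<and> b v y = 0 \<and> b v z = 0 \<and> b v w = 0"
proof -
  define f where "f i = (if i = 0 then x else if i = 1 then y else if i = 2 then z else w)" for i :: nat
  have "q (f i) dvd 1" for i
    unfolding f_def using u by simp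
  then obtain v where v: "q v dvd 1" "\<forall>i<4. b v (f i) = 0"
    using anisotropic_orthogonal[OF an, of f] by blast
  have "b v (f 0) = 0" "b v (f 1) = 0" "b v (f 2) = 0" "b v (f 3) = 0"
    using v(2) by simp_all
  then show ?thesis
    using v(1) unfolding f_def by auto
qed

end

section \<open>Isotropic and anisotropic Pfister forms\<close>

text \<open>In the order of the tensor product the bits 4, 2 and 1 of the index stand for the
  factors \<open>- u\<close>, \<open>- v\<close> and \<open>- w\<close>.\<close>

definition pfister_coeff :: "'a::comm_ring_1 \<Rightarrow> 'a \<Rightarrow> 'a \<Rightarrow> nat \<Rightarrow> 'a" where
  "pfister_coeff u v w = (!) [1, - w, - v, v * w, - u, u * w, u * v, - (u * v * w)]"

lemma pfister_coeff_cases: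
  assumes "i < 8" "P 1" "P (- w)" "P (- v)" "P (v * w)" "P (- u)" "P (u * w)" "P (u * v)" "P (- (u * v * w))"
  shows "P (pfister_coeff u v w i)"
proof -
  have "i = 0 \<or> i = 1 \<or> i = 2 \<or> i = 3 \<or> i = 4 \<or> i = 5 \<or> i = 6 \<or> i = 7"
    using assms(1) by linarith
  then show ?thesis
    using assms(2-) unfolding pfister_coeff_def by (elim disjE) simp_all
qed

lemma pfister_coeff_unit:
  assumes "u dvd 1" "v dvd 1" "w dvd 1" "i < 8"
  shows "pfister_coeff u v w i dvd 1"
  using mult_dvd_mono[OF assms(2,3)] mult_dvd_mono[OF assms(1,3)] mult_dvd_mono[OF assms(1,2)]
    mult_dvd_mono[OF mult_dvd_mono[OF assms(1,2)] assms(3)]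
  by - (rule pfister_coeff_cases[OF assms(4), where P = "\<lambda>x. x dvd 1"]; simp add: assms(1-3))

context composition_algebra
begin

lemma hyperbolic_basis_if_similitude_on_basis:
  assumes orth: "\<And>i j. i < 8 \<Longrightarrow> j < 8 \<Longrightarrow> i \<noteq> j \<Longrightarrow> b (g i) (g j) = 0"
    and idx: "distinct (cl @ dl)" "length cl = 4" "length dl = 4" "set (cl @ dl) \<subseteq> {..<8::nat}"
    and qc: "q (g (cl ! 0)) = 1" "q (g (cl ! 1)) = - p" "q (g (cl ! 2)) = - r" "q (g (cl ! 3)) = p * r"
    and qd: "\<And>i. i < 4 \<Longrightarrow> q (g (dl ! i)) = - (\<kappa> * q (g (cl ! i)))"
    and \<kappa>: "\<kappa> = z0 * z0 - p * z1 * z1 - r * z2 * z2 + p * r * z3 * z3"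
    and units: "p dvd 1" "r dvd 1" "\<kappa> dvd 1"
  shows "\<exists>E F. hyperbolic_basis E F"
proof -
  have lt: "cl ! i < 8" "dl ! i < 8" if "i < 4" for i
  proof -
    have "cl ! i \<in> set cl" "dl ! i \<in> set dl"
      using that idx by simp_all
    then show "cl ! i < 8" "dl ! i < 8"
      using idx(4) by auto
  qed
  have "b (g (cl ! i)) (g (cl ! j)) = 0" "b (g (dl ! i)) (g (dl ! j)) = 0" if ij: "i < 4" "j < 4" "i \<noteq> j" for i j
    using ij idx lt by (auto intro!: orth simp: nth_eq_iff_index_eq)
  moreover have "b (g (cl ! i)) (g (dl ! j)) = 0" if ij: "i < 4" "j < 4" for i j
  proof (rule orth[OF lt(1)[OF ij(1)] lt(2)[OF ij(2)]])
    have "cl ! i \<in> set cl" "dl ! j \<in> set dl"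
      using ij idx by simp_all
    then show "cl ! i \<noteq> dl ! j"
      using idx(1) by auto
  qed
  ultimately show ?thesis
    using hyperbolic_basis_if_similitude[of "\<lambda>i. g (cl ! i)" "\<lambda>i. g (dl ! i)" p r \<kappa> z0 z1 z2 z3] qc qd \<kappa> units
    by blast
qed

end

text \<open>One slot is peeled off at a time: an isotropic vector shows that the slot is a value of
  the form on the earlier slots, unless that form is itself isotropic. Over a ring the divisions
  require that nonzero partial sums be units.\<close>

lemma pfister_isotropic_represents:
  fixes u v w :: "'a::idom"
  assumes units: "u dvd 1" "v dvd 1" "w dvd 1"
    and "\<And>k. k < 8 \<Longrightarrow> y k = 0 \<or> y k dvd 1" "\<exists>k<8. y k \<noteq> 0"
    and zero: "(\<Sum>k<8. pfister_coeff u v w k * (y k * y k)) = 0"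
    and parts: "\<And>S. S \<subseteq> {..<8} \<Longrightarrow> (\<Sum>k\<in>S. pfister_coeff u v w k * (y k * y k)) = 0
      \<or> (\<Sum>k\<in>S. pfister_coeff u v w k * (y k * y k)) dvd 1"
  shows "(\<exists>z0 z1 z2 z3. w = z0 * z0 - u * z1 * z1 - v * z2 * z2 + u * v * z3 * z3)
    \<or> (\<exists>z0 z1. v = z0 * z0 - u * z1 * z1) \<or> (\<exists>z. u = z * z)"
proof -
  define N where "N a0 a1 a2 a3 = a0 * a0 - u * a1 * a1 - v * a2 * a2 + u * v * a3 * a3" for a0 a1 a2 a3
  have nz: "u \<noteq> 0" "v \<noteq> 0" "w \<noteq> 0"
    using units by auto
  have eight: "{..<8::nat} = {0, 1, 2, 3, 4, 5, 6, 7}"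
    by auto
  have total: "N (y 0) (y 4) (y 2) (y 6) = w * N (y 1) (y 5) (y 3) (y 7)"
    using zero unfolding eight N_def by (simp add: pfister_coeff_def algebra_simps)
  have odd: "(\<Sum>k\<in>{1, 3, 5, 7}. pfister_coeff u v w k * (y k * y k)) = - (w * N (y 1) (y 5) (y 3) (y 7))"
    unfolding N_def by (simp add: pfister_coeff_def algebra_simps)
  show ?thesis
  proof (cases "N (y 1) (y 5) (y 3) (y 7) = 0")
    case False
    then have "w * N (y 1) (y 5) (y 3) (y 7) \<noteq> 0"
      using nz by simp
    then have "w * N (y 1) (y 5) (y 3) (y 7) dvd 1"
      using parts[of "{1, 3, 5, 7}"] unfolding odd by simp
    then have "N (y 1) (y 5) (y 3) (y 7) dvd 1"
      using dvd_mult_right by blast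
    then obtain c where c: "N (y 1) (y 5) (y 3) (y 7) * c = 1"
      by (metis dvdE)
    define a0 a1 a2 a3 where a: "a0 = y 0" "a1 = y 4" "a2 = y 2" "a3 = y 6"
    define b0 b1 b2 b3 where b: "b0 = y 1" "b1 = y 5" "b2 = y 3" "b3 = y 7"
    \<comment> \<open>The coordinates of the quaternion \<open>a\<close> times the conjugate of
      \<open>b\<close>; divided by the norm of \<open>b\<close> it has norm
      \<open>w\<close>.\<close>
    define c0 where "c0 = a0 * b0 - u * a1 * b1 - v * a2 * b2 + u * v * a3 * b3"
    define c1 where "c1 = a1 * b0 - a0 * b1 + v * a2 * b3 - v * a3 * b2"
    define c2 where "c2 = a2 * b0 - a0 * b2 - u * a1 * b3 + u * a3 * b1"
    define c3 where "c3 = a3 * b0 - a0 * b3 - a1 * b2 + a2 * b1"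
    have "N c0 c1 c2 c3 = N a0 a1 a2 a3 * N b0 b1 b2 b3"
      unfolding N_def c0_def c1_def c2_def c3_def by (simp add: algebra_simps)
    then have "N c0 c1 c2 c3 = w * (N b0 b1 b2 b3 * N b0 b1 b2 b3)"
      using total unfolding a b by simp
    then have "N c0 c1 c2 c3 * (c * c) = w * ((N b0 b1 b2 b3 * c) * (N b0 b1 b2 b3 * c))"
      by (simp only: mult_ac)
    moreover have "N b0 b1 b2 b3 * c = 1"
      unfolding b by (rule c)
    ultimately have "w = N c0 c1 c2 c3 * (c * c)"
      by simp
    also have "\<dots> = N (c0 * c) (c1 * c) (c2 * c) (c3 * c)"
      unfolding N_def by (simp add: algebra_simps)
    finally show ?thesis
      unfolding N_def by blast
  next
    case True
    have even0: "N (y 0) (y 4) (y 2) (y 6) = 0"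
      using total True by simp
    have "\<exists>a0 a1 a2 a3. N a0 a1 a2 a3 = 0 \<and> (a0 \<noteq> 0 \<or> a1 \<noteq> 0 \<or> a2 \<noteq> 0 \<or> a3 \<noteq> 0)
      \<and> (a1 = 0 \<or> a1 dvd 1) \<and> (a3 = 0 \<or> a3 dvd 1) \<and> (a2 * a2 - u * a3 * a3 = 0 \<or> a2 * a2 - u * a3 * a3 dvd 1)"
    proof (cases "y 1 \<noteq> 0 \<or> y 5 \<noteq> 0 \<or> y 3 \<noteq> 0 \<or> y 7 \<noteq> 0")
      case t: True
      have "(\<Sum>k\<in>{3, 7}. pfister_coeff u v w k * (y k * y k)) = v * w * (y 3 * y 3 - u * y 7 * y 7)"
        by (simp add: pfister_coeff_def algebra_simps)
      then have "v * w * (y 3 * y 3 - u * y 7 * y 7) = 0 \<or> v * w * (y 3 * y 3 - u * y 7 * y 7) dvd 1"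
        using parts[of "{3, 7}"] by simp
      then have "y 3 * y 3 - u * y 7 * y 7 = 0 \<or> y 3 * y 3 - u * y 7 * y 7 dvd 1"
        using nz dvd_mult_right by (metis mult_eq_0_iff)
      then show ?thesis
        using t True assms(4)[of 5] assms(4)[of 7]
        by (intro exI[of _ "y 1"] exI[of _ "y 5"] exI[of _ "y 3"] exI[of _ "y 7"]) simp
    next
      case f: False
      obtain k where k: "k < 8" "y k \<noteq> 0"
        using assms(5) by blast
      then have "k \<in> {0, 1, 2, 3, 4, 5, 6, 7}"
        unfolding eight[symmetric] by simp
      then have t: "y 0 \<noteq> 0 \<or> y 4 \<noteq> 0 \<or> y 2 \<noteq> 0 \<or> y 6 \<noteq> 0"
        using f k(2) by auto
      have "(\<Sum>k\<in>{2, 6}. pfister_coeff u v w k * (y k * y k)) = (- v) * (y 2 * y 2 - u * y 6 * y 6)"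
        by (simp add: pfister_coeff_def algebra_simps)
      then have "(- v) * (y 2 * y 2 - u * y 6 * y 6) = 0 \<or> (- v) * (y 2 * y 2 - u * y 6 * y 6) dvd 1"
        using parts[of "{2, 6}"] by (simp only: insert_subset empty_subsetI lessThan_iff) simp
      then have "y 2 * y 2 - u * y 6 * y 6 = 0 \<or> y 2 * y 2 - u * y 6 * y 6 dvd 1"
        using nz dvd_mult_right by (metis mult_eq_0_iff neg_equal_0_iff_equal)
      then show ?thesis
        using t even0 assms(4)[of 4] assms(4)[of 6]
        by (intro exI[of _ "y 0"] exI[of _ "y 4"] exI[of _ "y 2"] exI[of _ "y 6"]) simp
    qed
    then obtain a0 a1 a2 a3 where a: "N a0 a1 a2 a3 = 0" "a0 \<noteq> 0 \<or> a1 \<noteq> 0 \<or> a2 \<noteq> 0 \<or> a3 \<noteq> 0"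
      "a1 = 0 \<or> a1 dvd 1" "a3 = 0 \<or> a3 dvd 1" "a2 * a2 - u * a3 * a3 = 0 \<or> a2 * a2 - u * a3 * a3 dvd 1"
      by blast
    define R where "R = a2 * a2 - u * a3 * a3"
    have NR: "a0 * a0 - u * a1 * a1 = v * R"
      using a(1) unfolding N_def R_def by (simp add: algebra_simps)
    show ?thesis
    proof (cases "R = 0")
      case False
      then obtain c where c: "R * c = 1"
        using a(5) unfolding R_def by (metis dvdE)
      \<comment> \<open>The same quotient in the quadratic algebra in which \<open>u\<close> becomes
        a square.\<close>
      define z0 where "z0 = (a0 * a2 - u * a1 * a3) * c"
      define z1 where "z1 = (a1 * a2 - a0 * a3) * c"
      have "z0 * z0 - u * z1 * z1 = (a0 * a0 - u * a1 * a1) * R * (c * c)"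
        unfolding z0_def z1_def R_def by (simp add: algebra_simps)
      also have "\<dots> = v * (R * c) * (R * c)"
        unfolding NR by (simp only: mult_ac)
      finally have "v = z0 * z0 - u * z1 * z1"
        unfolding c by simp
      then show ?thesis
        by blast
    next
      case True
      have e: "a0 * a0 = u * a1 * a1" "a2 * a2 = u * a3 * a3"
        using NR True unfolding R_def by simp_all
      have sq: "\<exists>z. u = z * z" if "a' dvd 1" "a * a = u * a' * a'" for a a'
      proof -
        obtain c where c: "a' * c = 1"
          using \<open>a' dvd 1\<close> by (metis dvdE)
        have "(a * c) * (a * c) = (a * a) * (c * c)"
          by (simp only: mult_ac)
        also have "\<dots> = u * (a' * c) * (a' * c)"
          unfolding that(2) by (simp only: mult_ac)
        finally have "u = (a * c) * (a * c)"
          unfolding c by simp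
        then show ?thesis
          by blast
      qed
      have "a1 \<noteq> 0 \<or> a3 \<noteq> 0"
      proof (rule ccontr)
        assume "\<not> (a1 \<noteq> 0 \<or> a3 \<noteq> 0)"
        then show False
          using e a(2) by auto
      qed
      then show ?thesis
        using sq e a(3,4) by blast
    qed
  qed
qed

text \<open>The case distinction is over the field of constants: either all residue forms are
  anisotropic, or an isotropic vector of one of them makes the whole Pfister form
  hyperbolic.\<close>

theorem laurent_pfister_isotope_isomorphic:
  fixes scale :: "'k::field_char_0 laurent \<Rightarrow> 'v::ab_group_add \<Rightarrow> 'v" and mult :: "'v \<Rightarrow> 'v \<Rightarrow> 'v"
  assumes C: "composition_algebra scale mult unit q"
    and dep: "composition_algebra.dependent9 scale"
    and orth: "\<And>i j. i < 8 \<Longrightarrow> j < 8 \<Longrightarrow> i \<noteq> j \<Longrightarrow> q (g i + g j) - q (g i) - q (g j) = 0"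
    and qg: "\<And>k. k < 8 \<Longrightarrow> q (g k) = pfister_coeff u v w k"
    and units: "u dvd 1" "v dvd 1" "w dvd 1"
    and k: "q a * q c * k = 1"
  obtains T where "bij T" "\<And>x y. T (x + y) = T x + T y" "\<And>r x. T (scale r x) = scale r (T x)"
    "\<And>x y. T (mult x y) = mult (mult (T x) a) (mult c (T y))"
proof -
  note result = that
  interpret composition_algebra scale mult unit q
    by (rule C)
  have orth': "b (g i) (g j) = 0" if "i < 8" "j < 8" "i \<noteq> j" for i j
    unfolding b_def by (rule orth[OF that])
  have pu: "pfister_coeff u v w i dvd 1" if "i < 8" for i
    by (rule pfister_coeff_unit[OF units that])
  have "\<forall>i. \<exists>d \<alpha>. i < 8 \<longrightarrow> pfister_coeff u v w i = Poly_Mapping.single d \<alpha> \<and> \<alpha> \<noteq> 0"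
  proof
    fix i
    show "\<exists>d \<alpha>. i < 8 \<longrightarrow> pfister_coeff u v w i = Poly_Mapping.single d \<alpha> \<and> \<alpha> \<noteq> 0"
    proof (cases "i < 8")
      case True
      then obtain d \<alpha> where "pfister_coeff u v w i = Poly_Mapping.single d \<alpha>" "\<alpha> \<noteq> 0"
        using unit_monomial[OF pu[OF True]] by blast
      then show ?thesis
        by blast
    qed simp
  qed
  then obtain d \<alpha> where d\<alpha>: "\<And>i. i < 8 \<Longrightarrow> pfister_coeff u v w i = Poly_Mapping.single (d i) (\<alpha> i)"
    "\<And>i. i < 8 \<Longrightarrow> \<alpha> i \<noteq> 0"
    by metis
  interpret M: monomial_composition_algebra scale mult unit q g d \<alpha>
    by unfold_locales (use dep orth' qg d\<alpha> in auto)
  show ?thesis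
  proof (cases M.anisotropic)
    case True
    show ?thesis
    proof (rule isotope_isomorphic_if_anisotropic[OF k])
      show "x = y \<or> q (x - y) dvd 1" if "q x dvd 1" "q x = q y" for x y
        by (rule M.anisotropic_difference[OF True that])
      show "\<exists>v. q v dvd 1 \<and> b v x = 0 \<and> b v y = 0 \<and> b v z = 0 \<and> b v w = 0"
        if "q x dvd 1" "q y dvd 1" "q z dvd 1" "q w dvd 1" for x y z w
        by (rule M.anisotropic_orthogonal4[OF True that])
      show thesis if "bij T" "\<And>x y. T (x + y) = T x + T y" "\<And>r x. T (scale r x) = scale r (T x)"
        "\<And>x y. T (mult x y) = isotope_mult a c (T x) (T y)" for T
        by (rule result[of T, OF that(1-3) that(4)[unfolded isotope_mult_def]])
    qed
  next
    case False
    then obtain m t \<eta> where t: "\<And>i. i < 8 \<Longrightarrow> \<eta> i \<noteq> 0 \<Longrightarrow> t i + t i + d i = m"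
      and zero: "(\<Sum>i<8. \<alpha> i * (\<eta> i * \<eta> i)) = 0" and ex: "\<exists>i<8. \<eta> i \<noteq> 0"
      unfolding M.anisotropic_def by blast
    \<comment> \<open>The isotropic vector over the field, with monomials attached that move all
      terms of the norm to degree \<open>m\<close>. Every partial sum is then a multiple of one
      monomial, so zero or a unit.\<close>
    define y where "y i = Poly_Mapping.single (t i) (\<eta> i)" for i
    have y: "pfister_coeff u v w i * (y i * y i) = Poly_Mapping.single m (\<alpha> i * (\<eta> i * \<eta> i))" if i: "i < 8" for i
    proof (cases "\<eta> i = 0")
      case False
      have m: "m = d i + (t i + t i)"
        using t[OF i False] by (simp add: add.commute)
      show ?thesis
        unfolding y_def d\<alpha>(1)[OF i] mult_single m ..
    next
      case True
      show ?thesis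
        unfolding y_def True by simp
    qed
    have single_sum: "Poly_Mapping.single m (sum f S) = (\<Sum>i\<in>S. Poly_Mapping.single m (f i))" for f :: "nat \<Rightarrow> 'k" and S
      by (induction S rule: infinite_finite_induct) (simp_all add: single_add)
    have part: "(\<Sum>i\<in>S. pfister_coeff u v w i * (y i * y i)) = Poly_Mapping.single m (\<Sum>i\<in>S. \<alpha> i * (\<eta> i * \<eta> i))"
      if "S \<subseteq> {..<8}" for S
      unfolding single_sum using that y by (intro sum.cong refl) auto
    have single_unit: "Poly_Mapping.single m' \<gamma> = (0 :: 'k laurent) \<or> Poly_Mapping.single m' \<gamma> dvd (1 :: 'k laurent)" for m' \<gamma>
    proof (cases "\<gamma> = 0")
      case False
      then have "Poly_Mapping.single m' \<gamma> * Poly_Mapping.single (- m') (1 / \<gamma>) = (1 :: 'k laurent)"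
        by (simp add: mult_single)
      then show ?thesis
        by (metis dvd_triv_left)
    qed simp
    have "(\<exists>z0 z1 z2 z3. w = z0 * z0 - u * z1 * z1 - v * z2 * z2 + u * v * z3 * z3)
      \<or> (\<exists>z0 z1. v = z0 * z0 - u * z1 * z1) \<or> (\<exists>z. u = z * z)"
    proof (rule pfister_isotropic_represents[OF units])
      show "y i = 0 \<or> y i dvd 1" for i
        unfolding y_def by (rule single_unit)
      have "y i \<noteq> 0" if "\<eta> i \<noteq> 0" for i
        using that unfolding y_def by (metis lookup_single_eq lookup_zero)
      then show "\<exists>i<8. y i \<noteq> 0"
        using ex by blast
      show "(\<Sum>i<8. pfister_coeff u v w i * (y i * y i)) = 0"
        using part[of "{..<8}"] zero by simp
      show "(\<Sum>i\<in>S. pfister_coeff u v w i * (y i * y i)) = 0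
          \<or> (\<Sum>i\<in>S. pfister_coeff u v w i * (y i * y i)) dvd 1" if "S \<subseteq> {..<8}" for S
        unfolding part[OF that] by (rule single_unit)
    qed
    \<comment> \<open>In each case the first list carries the norm form of the other two slots and
      the second its multiple by minus the represented slot; shorter representations are padded with
      zeros.\<close>
    moreover have "\<exists>E F. hyperbolic_basis E F" if "w = z0 * z0 - u * z1 * z1 - v * z2 * z2 + u * v * z3 * z3" for z0 z1 z2 z3
    proof (rule hyperbolic_basis_if_similitude_on_basis[OF orth', where cl = "[0, 4, 2, 6]" and dl = "[1, 5, 3, 7]"])
      show "w = z0 * z0 - u * z1 * z1 - v * z2 * z2 + u * v * z3 * z3"
        by (rule that)
      fix i :: nat assume "i < 4"
      then have "i = 0 \<or> i = 1 \<or> i = 2 \<or> i = 3"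
        by linarith
      then show "q (g ([1, 5, 3, 7] ! i)) = - (w * q (g ([0, 4, 2, 6] ! i)))"
        by (elim disjE) (simp_all add: qg pfister_coeff_def mult_ac)
    qed (use units in \<open>simp_all add: qg pfister_coeff_def\<close>)
    moreover have "\<exists>E F. hyperbolic_basis E F" if z: "v = z0 * z0 - u * z1 * z1" for z0 z1
    proof (rule hyperbolic_basis_if_similitude_on_basis[OF orth', where cl = "[0, 4, 1, 5]" and dl = "[2, 6, 3, 7]"])
      show "v = z0 * z0 - u * z1 * z1 - w * 0 * 0 + u * w * 0 * 0"
        using z by simp
      fix i :: nat assume "i < 4"
      then have "i = 0 \<or> i = 1 \<or> i = 2 \<or> i = 3"
        by linarith
      then show "q (g ([2, 6, 3, 7] ! i)) = - (v * q (g ([0, 4, 1, 5] ! i)))"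
        by (elim disjE) (simp_all add: qg pfister_coeff_def mult_ac)
    qed (use units in \<open>simp_all add: qg pfister_coeff_def\<close>)
    moreover have "\<exists>E F. hyperbolic_basis E F" if z: "u = z * z" for z
    proof (rule hyperbolic_basis_if_similitude_on_basis[OF orth', where cl = "[0, 2, 1, 3]" and dl = "[4, 6, 5, 7]"])
      show "u = z * z - v * 0 * 0 - w * 0 * 0 + v * w * 0 * 0"
        using z by simp
      fix i :: nat assume "i < 4"
      then have "i = 0 \<or> i = 1 \<or> i = 2 \<or> i = 3"
        by linarith
      then show "q (g ([4, 6, 5, 7] ! i)) = - (u * q (g ([0, 2, 1, 3] ! i)))"
        by (elim disjE) (simp_all add: qg pfister_coeff_def mult_ac)
    qed (use units in \<open>simp_all add: qg pfister_coeff_def\<close>)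
    ultimately obtain E F where "hyperbolic_basis E F"
      by blast
    from laurent_isotope_isomorphic_if_hyperbolic[OF C dep this k] show ?thesis
      using that unfolding isotope_mult_def by metis
  qed
qed

section \<open>Base change and descent\<close>

text \<open>
  The product \<open>m\<close> is only given on the vectors with coordinates in the subring \<open>P\<close>; its structure
  constants extend it bilinearly to all vectors.
\<close>

locale coordinate_composition_algebra =
  fixes P :: "'a::idom set" and m :: "'a^'n \<Rightarrow> 'a^'n \<Rightarrow> 'a^'n" and e :: "'a^'n" and a :: "'n \<Rightarrow> 'a"
    and vecs :: "('a^'n) set"
  defines "vecs \<equiv> {v. \<forall>i. v $ i \<in> P}"
  assumes two: "(2::'a) dvd 1"
    and zero_closed: "0 \<in> P" and one_closed: "1 \<in> P"
    and add_closed: "r \<in> P \<Longrightarrow> s \<in> P \<Longrightarrow> r + s \<in> P"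
    and mult_closed: "r \<in> P \<Longrightarrow> s \<in> P \<Longrightarrow> r * s \<in> P"
    and m_closed: "v \<in> vecs \<Longrightarrow> w \<in> vecs \<Longrightarrow> m v w \<in> vecs"
    and m_add_left: "v \<in> vecs \<Longrightarrow> v' \<in> vecs \<Longrightarrow> w \<in> vecs \<Longrightarrow> m (v + v') w = m v w + m v' w"
    and m_add_right: "v \<in> vecs \<Longrightarrow> w \<in> vecs \<Longrightarrow> w' \<in> vecs \<Longrightarrow> m v (w + w') = m v w + m v w'"
    and m_scale_left: "r \<in> P \<Longrightarrow> v \<in> vecs \<Longrightarrow> w \<in> vecs \<Longrightarrow> m (r *s v) w = r *s m v w"
    and m_scale_right: "r \<in> P \<Longrightarrow> v \<in> vecs \<Longrightarrow> w \<in> vecs \<Longrightarrow> m v (r *s w) = r *s m v w"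
    and e_closed: "e \<in> vecs"
    and m_unit: "v \<in> vecs \<Longrightarrow> m e v = v" "v \<in> vecs \<Longrightarrow> m v e = v"
    and norm_mult: "v \<in> vecs \<Longrightarrow> w \<in> vecs \<Longrightarrow>
      (\<Sum>i\<in>UNIV. a i * (m v w $ i * m v w $ i))
        = (\<Sum>i\<in>UNIV. a i * (v $ i * v $ i)) * (\<Sum>i\<in>UNIV. a i * (w $ i * w $ i))"
    and coeff_unit: "a i dvd 1"
    and coeff_one: "\<exists>i. a i = 1"
begin

definition mult :: "'a^'n \<Rightarrow> 'a^'n \<Rightarrow> 'a^'n" (infixl \<open>\<star>\<close> 70) where
  "v \<star> w = (\<Sum>i\<in>UNIV. \<Sum>j\<in>UNIV. (v $ i * w $ j) *s m (axis i 1) (axis j 1))"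

definition q :: "'a^'n \<Rightarrow> 'a" where
  "q v = (\<Sum>i\<in>UNIV. a i * (v $ i * v $ i))"

definition b :: "'a^'n \<Rightarrow> 'a^'n \<Rightarrow> 'a" where
  "b v w = 2 * (\<Sum>i\<in>UNIV. a i * (v $ i * w $ i))"

lemma axis_closed: "axis i 1 \<in> vecs"
  using zero_closed one_closed by (simp add: vecs_def axis_def)

lemma vec_add_closed: "v \<in> vecs \<Longrightarrow> w \<in> vecs \<Longrightarrow> v + w \<in> vecs"
  using add_closed by (simp add: vecs_def)

lemma vec_scale_closed: "r \<in> P \<Longrightarrow> v \<in> vecs \<Longrightarrow> r *s v \<in> vecs"
  using mult_closed by (simp add: vecs_def)

lemma linear_expansion:
  fixes L :: "'a^'n \<Rightarrow> 'a^'n"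
  assumes add: "\<And>v w. v \<in> vecs \<Longrightarrow> w \<in> vecs \<Longrightarrow> L (v + w) = L v + L w"
    and scale: "\<And>r v. r \<in> P \<Longrightarrow> v \<in> vecs \<Longrightarrow> L (r *s v) = r *s L v"
    and v: "v \<in> vecs"
  shows "L v = (\<Sum>i\<in>UNIV. v $ i *s L (axis i 1))"
proof -
  have zero: "0 \<in> vecs"
    using zero_closed by (simp add: vecs_def)
  have "L 0 = 0"
    using scale[OF zero_closed zero] by (simp add: vector_smult_lzero)
  then have "(\<Sum>i\<in>S. v $ i *s axis i 1) \<in> vecs \<and>
      L (\<Sum>i\<in>S. v $ i *s axis i 1) = (\<Sum>i\<in>S. v $ i *s L (axis i 1))" for S
  proof (induction S rule: infinite_finite_induct)
    case (insert i S)
    have vi: "v $ i \<in> P"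
      using v by (simp add: vecs_def)
    show ?case
      using insert vec_add_closed[OF vec_scale_closed[OF vi axis_closed]] add[OF vec_scale_closed[OF vi axis_closed]]
        scale[OF vi axis_closed] by simp
  qed (use zero in simp_all)
  from this[of UNIV] show ?thesis
    by (simp add: basis_expansion)
qed

lemma linear_form_zero:
  fixes L :: "'a^'n \<Rightarrow> 'a"
  assumes add: "\<And>v w. L (v + w) = L v + L w"
    and scale: "\<And>r v. L (r *s v) = r * L v"
    and axis: "\<And>i. L (axis i 1) = 0"
  shows "L v = 0"
proof -
  have "L 0 = 0"
    using scale[of 0 0] by simp
  then have "L (\<Sum>i\<in>S. v $ i *s axis i 1) = 0" for S
    by (induction S rule: infinite_finite_induct) (simp_all add: add scale axis)
  from this[of UNIV] show ?thesis
    by (simp add: basis_expansion)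
qed

lemma mult_add_left: "(v + v') \<star> w = v \<star> w + v' \<star> w"
  unfolding mult_def by (simp add: distrib_right vector_sadd_rdistrib sum.distrib vec_eq_iff)

lemma mult_add_right: "v \<star> (w + w') = v \<star> w + v \<star> w'"
  unfolding mult_def by (simp add: distrib_left distrib_right sum.distrib vec_eq_iff)

lemma mult_scale_left: "(r *s v) \<star> w = r *s (v \<star> w)"
  unfolding mult_def by (simp add: sum_distrib_left mult.assoc vec_eq_iff)

lemma mult_scale_right: "v \<star> (r *s w) = r *s (v \<star> w)"
  unfolding mult_def by (simp add: sum_distrib_left mult_ac vec_eq_iff)

lemma mult_eq_m:
  assumes v: "v \<in> vecs" and w: "w \<in> vecs"
  shows "v \<star> w = m v w"
proof -
  have "m v w = (\<Sum>i\<in>UNIV. v $ i *s m (axis i 1) w)"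
    by (rule linear_expansion) (use v w m_add_left m_scale_left in auto)
  also have "m (axis i 1) w = (\<Sum>j\<in>UNIV. w $ j *s m (axis i 1) (axis j 1))" for i
    by (rule linear_expansion) (use w axis_closed m_add_right m_scale_right in auto)
  then have "(\<Sum>i\<in>UNIV. v $ i *s m (axis i 1) w) = v \<star> w"
    unfolding mult_def by (simp add: vec_eq_iff sum_distrib_left mult.assoc)
  finally show ?thesis ..
qed

lemma b_add_left: "b (v + v') w = b v w + b v' w"
  unfolding b_def by (simp add: sum.distrib distrib_left distrib_right)

lemma b_scale_left: "b (r *s v) w = r * b v w"
  unfolding b_def by (simp add: sum_distrib_left mult_ac)

lemma b_sym: "b v w = b w v"
  unfolding b_def by (simp add: mult_ac)

lemma b_add_right: "b v (w + w') = b v w + b v w'"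
  using b_add_left b_sym by metis

lemma b_scale_right: "b v (r *s w) = r * b v w"
  using b_scale_left b_sym by metis

lemma q_add: "q (v + w) = q v + q w + b v w"
  unfolding q_def b_def by (simp add: sum.distrib sum_distrib_left algebra_simps)

lemma b_self: "b v v = 2 * q v"
  unfolding q_def b_def ..

lemma q_scale: "q (r *s v) = r * r * q v"
  unfolding q_def by (simp add: sum_distrib_left mult_ac)

lemma b_m:
  assumes "v \<in> vecs" "v' \<in> vecs" "w \<in> vecs" "w' \<in> vecs"
  shows "b (m v w) (m v' w') + b (m v' w) (m v w') = b v v' * b w w'"
proof -
  have nm: "q (m x y) = q x * q y" if "x \<in> vecs" "y \<in> vecs" for x y
    unfolding q_def using norm_mult[OF that] .
  have *: "b (m x w) (m x w') = q x * b w w'" if x: "x \<in> vecs" for x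
    using nm[OF x vec_add_closed[OF assms(3,4)]] nm[OF x assms(3)] nm[OF x assms(4)]
      m_add_right[OF x assms(3,4)] q_add[of "m x w" "m x w'"] q_add[of w w'] by (simp add: distrib_left)
  have "b (m v w + m v' w) (m v w' + m v' w') = (q v + q v' + b v v') * b w w'"
    using *[OF vec_add_closed[OF assms(1,2)]] m_add_left assms q_add[of v v'] by simp
  then show ?thesis
    using *[OF assms(1)] *[OF assms(2)] by (simp add: b_add_left b_add_right distrib_right add.commute)
qed

text \<open>Multiplicativity of the norm is known only for coordinates in \<open>P\<close>, and
  being quadratic it cannot be checked on the axes. Its full polarization is multilinear, so there
  the axes suffice.\<close>

lemma b_mult: "b (v \<star> w) (v' \<star> w') + b (v' \<star> w) (v \<star> w') = b v v' * b w w'"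
proof -
  note linear = mult_add_left mult_add_right mult_scale_left mult_scale_right b_add_left b_add_right
    b_scale_left b_scale_right
  define F where "F v v' w w' = b (v \<star> w) (v' \<star> w') + b (v' \<star> w) (v \<star> w') - b v v' * b w w'" for v v' w w'
  have axes: "F (axis i 1) (axis j 1) (axis k 1) (axis l 1) = 0" for i j k l
    unfolding F_def using b_m[OF axis_closed axis_closed axis_closed axis_closed] by (simp add: mult_eq_m axis_closed)
  have w': "F (axis i 1) (axis j 1) (axis k 1) y = 0" for i j k y
  proof (rule linear_form_zero[of "F (axis i 1) (axis j 1) (axis k 1)"])
    show "F (axis i 1) (axis j 1) (axis k 1) (axis l 1) = 0" for l
      by (rule axes)
  qed (simp_all add: F_def linear right_diff_distrib distrib_left mult_ac)
  have w: "F (axis i 1) (axis j 1) x y = 0" for i j x y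
  proof (rule linear_form_zero[of "\<lambda>w. F (axis i 1) (axis j 1) w y"])
    show "F (axis i 1) (axis j 1) (axis k 1) y = 0" for k
      by (rule w')
  qed (simp_all add: F_def linear right_diff_distrib distrib_left distrib_right mult_ac)
  have v': "F (axis i 1) z x y = 0" for i z x y
  proof (rule linear_form_zero[of "\<lambda>v'. F (axis i 1) v' x y"])
    show "F (axis i 1) (axis k 1) x y = 0" for k
      by (rule w)
  qed (simp_all add: F_def linear right_diff_distrib distrib_left distrib_right mult_ac)
  have "F v v' w w' = 0"
  proof (rule linear_form_zero[of "\<lambda>v. F v v' w w'"])
    show "F (axis k 1) v' w w' = 0" for k
      by (rule v')
  qed (simp_all add: F_def linear right_diff_distrib distrib_left distrib_right mult_ac)
  then show ?thesis
    unfolding F_def by simp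
qed

lemma two_nonzero: "(2::'a) \<noteq> 0"
  using two by (metis dvd_0_left_iff zero_neq_one)

lemma q_mult: "q (v \<star> w) = q v * q w"
proof -
  have "2 * (2 * q (v \<star> w)) = 2 * (2 * (q v * q w))"
    using b_mult[of v w v w] unfolding b_self by (simp add: algebra_simps)
  then show ?thesis
    by (simp only: mult_left_cancel[OF two_nonzero])
qed

lemma mult_unit: "e \<star> v = v" "v \<star> e = v"
proof -
  have "(e \<star> v - v) $ j = 0" for j
    by (rule linear_form_zero[of "\<lambda>v. (e \<star> v - v) $ j"])
      (simp_all add: mult_add_right mult_scale_right mult_eq_m e_closed axis_closed m_unit algebra_simps)
  then show "e \<star> v = v"
    by (simp add: vec_eq_iff)
  have "(v \<star> e - v) $ j = 0" for j
    by (rule linear_form_zero[of "\<lambda>v. (v \<star> e - v) $ j"])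
      (simp_all add: mult_add_left mult_scale_left mult_eq_m e_closed axis_closed m_unit algebra_simps)
  then show "v \<star> e = v"
    by (simp add: vec_eq_iff)
qed

lemma sum_axis: "(\<Sum>j\<in>UNIV. f j * (g j * axis i (1::'a) $ j)) = f i * g i" for f g :: "'n \<Rightarrow> 'a"
  by (simp add: axis_def if_distrib[of "\<lambda>z. _ * z"] sum.delta' cong: if_cong)

lemma b_axis: "b v (axis i 1) = 2 * (a i * v $ i)"
  unfolding b_def sum_axis ..

lemma q_axis: "q (axis i 1) = a i"
  unfolding q_def sum_axis by simp

lemma q_unit: "q e = 1"
proof -
  obtain i where "a i = 1"
    using coeff_one by blast
  then have "q (axis i 1) = 1"
    by (simp add: q_axis)
  then show ?thesis
    using q_mult[of e "axis i 1"] by (simp add: mult_unit)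
qed

lemma composition_algebra: "composition_algebra (*s) (\<star>) e q"
proof unfold_locales
  show "x = 0" if zero: "\<And>y. q (x + y) - q x - q y = 0" for x
  proof -
    have "a i * x $ i = 0" for i
      using zero[of "axis i 1"] two_nonzero by (simp add: q_add b_axis)
    moreover have "a i \<noteq> 0" for i
      using coeff_unit[of i] by auto
    ultimately show ?thesis
      by (simp add: vec_eq_iff)
  qed
qed (simp_all add: two mult_add_left mult_add_right mult_scale_left mult_scale_right mult_unit q_scale q_mult
    q_unit q_add b_add_left b_scale_left vector_add_ldistrib vector_sadd_rdistrib vector_smult_assoc)

text \<open>Applying \<open>\<rho>\<close> to coordinates respects the product because the structure
  constants lie in \<open>P\<close>. Following \<open>T\<close> and its inverse by this map gives
  mutually inverse maps of \<open>vecs\<close>.\<close>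

lemma descent:
  assumes \<rho>_add: "\<And>r s. \<rho> (r + s) = \<rho> r + \<rho> s" and \<rho>_mult: "\<And>r s. \<rho> (r * s) = \<rho> r * \<rho> s"
    and \<rho>_closed: "\<And>r. \<rho> r \<in> P" and \<rho>_id: "\<And>r. r \<in> P \<Longrightarrow> \<rho> r = r"
    and T: "bij T" "\<And>x y. T (x + y) = T x + T y" "\<And>r x. T (r *s x) = r *s T x"
    and T_mult: "\<And>x y. T (x \<star> y) = (T x \<star> c) \<star> (d \<star> T y)"
    and c: "c \<in> vecs" and d: "d \<in> vecs"
  obtains G where "bij_betw G vecs vecs" "\<And>x y. G (x + y) = G x + G y" "\<And>r x. r \<in> P \<Longrightarrow> G (r *s x) = r *s G x"
    "\<And>x y. x \<in> vecs \<Longrightarrow> y \<in> vecs \<Longrightarrow> G (m (m x c) (m d y)) = m (G x) (G y)"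
proof -
  define \<sigma> where "\<sigma> v = (\<chi> i. \<rho> (v $ i))" for v :: "'a^'n"
  have \<rho>_0: "\<rho> 0 = 0"
    by (rule \<rho>_id[OF zero_closed])
  have \<sigma>_add: "\<sigma> (v + w) = \<sigma> v + \<sigma> w" for v w
    by (simp add: \<sigma>_def vec_eq_iff \<rho>_add)
  have \<sigma>_scale: "\<sigma> (r *s v) = \<rho> r *s \<sigma> v" for r v
    by (simp add: \<sigma>_def vec_eq_iff \<rho>_mult)
  have \<sigma>_closed: "\<sigma> v \<in> vecs" for v
    by (simp add: \<sigma>_def vecs_def \<rho>_closed)
  have \<sigma>_id: "\<sigma> v = v" if "v \<in> vecs" for v
    using that by (simp add: \<sigma>_def vecs_def vec_eq_iff \<rho>_id)
  have \<sigma>_sum: "\<sigma> (sum f S) = (\<Sum>i\<in>S. \<sigma> (f i))" for f :: "'z \<Rightarrow> _" and S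
    by (induction S rule: infinite_finite_induct) (simp_all add: \<sigma>_add, simp_all add: \<sigma>_def vec_eq_iff \<rho>_0)
  have \<sigma>_mult: "\<sigma> (v \<star> w) = \<sigma> v \<star> \<sigma> w" for v w
  proof -
    have "\<sigma> (m (axis i 1) (axis j 1)) = m (axis i 1) (axis j 1)" for i j
      by (intro \<sigma>_id m_closed axis_closed)
    then show ?thesis
      unfolding mult_def by (simp add: \<sigma>_sum \<sigma>_scale \<rho>_mult) (simp add: \<sigma>_def)
  qed
  \<comment> \<open>A linear map is determined on the axes, and after \<open>\<sigma>\<close> the
    coordinates enter only through \<open>\<rho>\<close>, which is idempotent.\<close>
  have \<sigma>_linear: "\<sigma> (L (\<sigma> v)) = \<sigma> (L v)"
    if "\<And>x y. L (x + y) = L x + L y" "\<And>r x. L (r *s x) = r *s L x" for L :: "'a^'n \<Rightarrow> 'a^'n" and v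
  proof -
    have expand: "L x = (\<Sum>i\<in>UNIV. x $ i *s L (axis i 1))" for x
    proof -
      have "(L x - (\<Sum>i\<in>UNIV. x $ i *s L (axis i 1))) $ j = 0" for j
      proof (rule linear_form_zero[of "\<lambda>x. (L x - (\<Sum>i\<in>UNIV. x $ i *s L (axis i 1))) $ j"])
        show "(L (axis k 1) - (\<Sum>i\<in>UNIV. axis k 1 $ i *s L (axis i 1))) $ j = 0" for k
          by (simp add: axis_def if_distrib[of "\<lambda>z. z * _"] sum.delta cong: if_cong)
      qed (simp_all add: that sum.distrib sum_distrib_left algebra_simps)
      then show ?thesis
        by (simp add: vec_eq_iff)
    qed
    have "\<rho> (\<sigma> v $ i) = \<rho> (v $ i)" for i
      by (simp add: \<sigma>_def \<rho>_id \<rho>_closed)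
    then show ?thesis
      unfolding expand[of "\<sigma> v"] expand[of v] by (simp add: \<sigma>_sum \<sigma>_scale)
  qed
  define S where "S = inv_into UNIV T"
  have TS: "T (S x) = x" "S (T x) = x" for x
    using T(1) unfolding S_def by (simp_all add: bij_is_surj surj_f_inv_f bij_is_inj)
  have S: "S (x + y) = S x + S y" "S (r *s x) = r *s S x" for x y r
    by (metis TS T(2), metis TS T(3))
  have S_mult: "S ((x \<star> c) \<star> (d \<star> y)) = S x \<star> S y" for x y
    by (metis TS T_mult)
  show ?thesis
  proof (rule that[of "\<lambda>x. \<sigma> (S x)"])
    show "bij_betw (\<lambda>x. \<sigma> (S x)) vecs vecs"
      by (rule bij_betw_byWitness[of _ "\<lambda>x. \<sigma> (T x)"])
        (auto simp: \<sigma>_closed \<sigma>_linear[OF T(2,3)] \<sigma>_linear[OF S] TS \<sigma>_id)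
    show "\<sigma> (S (x + y)) = \<sigma> (S x) + \<sigma> (S y)" for x y
      by (simp add: S \<sigma>_add)
    show "\<sigma> (S (r *s x)) = r *s \<sigma> (S x)" if "r \<in> P" for r x
      by (simp add: S \<sigma>_scale \<rho>_id that)
    show "\<sigma> (S (m (m x c) (m d y))) = m (\<sigma> (S x)) (\<sigma> (S y))" if "x \<in> vecs" "y \<in> vecs" for x y
    proof -
      have "m (m x c) (m d y) = (x \<star> c) \<star> (d \<star> y)"
        using that c d by (simp add: mult_eq_m m_closed)
      then show ?thesis
        by (simp add: S_mult \<sigma>_mult mult_eq_m \<sigma>_closed)
    qed
  qed
qed

end

section \<open>The retraction onto finitely many variables\<close>

text \<open>The induced ring homomorphism sends \<open>t\<^sub>i\<close> to 1 for
  \<open>i \<ge> n\<close> and fixes \<open>laurent_ring n\<close>.\<close>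

definition restrict_exponent :: "nat \<Rightarrow> (nat \<Rightarrow>\<^sub>0 int) \<Rightarrow> (nat \<Rightarrow>\<^sub>0 int)" where
  "restrict_exponent n m = (\<Sum>i<n. Poly_Mapping.single i (Poly_Mapping.lookup m i))"

lemma lookup_restrict_exponent:
  "Poly_Mapping.lookup (restrict_exponent n m) i = (if i < n then Poly_Mapping.lookup m i else 0)"
  by (simp add: restrict_exponent_def lookup_sum lookup_single when_def sum.delta)

lemma restrict_exponent_add: "restrict_exponent n (m + m') = restrict_exponent n m + restrict_exponent n m'"
  by (rule poly_mapping_eqI) (simp add: lookup_restrict_exponent lookup_add)

lemma restrict_exponent_id: "Poly_Mapping.keys m \<subseteq> {..<n} \<Longrightarrow> restrict_exponent n m = m"
  by (rule poly_mapping_eqI) (auto simp: lookup_restrict_exponent in_keys_iff subset_iff)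

lemma laurent_ring_simps [simp]:
  "x \<otimes>\<^bsub>laurent_ring n\<^esub> y = x * y" "x \<oplus>\<^bsub>laurent_ring n\<^esub> y = x + y"
  "\<one>\<^bsub>laurent_ring n\<^esub> = 1" "\<zero>\<^bsub>laurent_ring n\<^esub> = 0"
  by (simp_all add: laurent_ring_def)

lemma push_restrict_exponent_closed:
  "push (restrict_exponent n) p \<in> carrier (laurent_ring n)"
proof -
  have "Poly_Mapping.keys m \<subseteq> {..<n}" if "m \<in> Poly_Mapping.keys (push (restrict_exponent n) p)" for m
  proof -
    have "m \<in> range (restrict_exponent n)"
      using that lookup_push_notin[of m "restrict_exponent n" p] by (auto simp: in_keys_iff)
    then show ?thesis
      by (auto simp: in_keys_iff lookup_restrict_exponent split: if_splits)
  qed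
  then show ?thesis
    by (simp add: laurent_ring_def)
qed

lemma push_restrict_exponent_id:
  assumes "p \<in> carrier (laurent_ring n)"
  shows "push (restrict_exponent n) p = p"
proof -
  have "push (restrict_exponent n) p = (\<Sum>m\<in>Poly_Mapping.keys p. Poly_Mapping.single m (Poly_Mapping.lookup p m))"
    unfolding push_def using assms by (intro sum.cong) (simp_all add: laurent_ring_def restrict_exponent_id)
  also have "\<dots> = p"
    by (rule sum_single_keys[symmetric])
  finally show ?thesis .
qed

lemma laurent_ring_uminus:
  fixes x :: "'k::field_char_0 laurent"
  assumes "x \<in> carrier (laurent_ring n)"
  shows "\<ominus>\<^bsub>laurent_ring n\<^esub> x = - x"
proof -
  interpret cring "laurent_ring n :: 'k laurent ring"
    by (rule cring_laurent_ring)
  show ?thesis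
    by (rule minus_equality) (use assms in \<open>simp_all add: laurent_ring_def\<close>)
qed

lemma laurent_ring_finsum:
  fixes g :: "'i \<Rightarrow> 'k::field_char_0 laurent"
  assumes "finite S" "\<And>i. i \<in> S \<Longrightarrow> g i \<in> carrier (laurent_ring n)"
  shows "(\<Oplus>\<^bsub>laurent_ring n\<^esub>i\<in>S. g i) = (\<Sum>i\<in>S. g i)"
  using assms
proof (induction S)
  case empty
  interpret cring "laurent_ring n :: 'k laurent ring"
    by (rule cring_laurent_ring)
  show ?case
    by simp
next
  case (insert i S)
  interpret cring "laurent_ring n :: 'k laurent ring"
    by (rule cring_laurent_ring)
  show ?case
    using insert by (subst finsum_insert) auto
qed

lemma laurent_ring_closed:
  fixes x y :: "'k::field_char_0 laurent"
  assumes "x \<in> carrier (laurent_ring n)"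
  shows "- x \<in> carrier (laurent_ring n)"
    and "y \<in> carrier (laurent_ring n) \<Longrightarrow> x + y \<in> carrier (laurent_ring n)"
    and "y \<in> carrier (laurent_ring n) \<Longrightarrow> x * y \<in> carrier (laurent_ring n)"
proof -
  interpret cring "laurent_ring n :: 'k laurent ring"
    by (rule cring_laurent_ring)
  show "- x \<in> carrier (laurent_ring n)"
    using a_inv_closed[OF assms] by (simp add: laurent_ring_uminus assms)
  show "x + y \<in> carrier (laurent_ring n)" "x * y \<in> carrier (laurent_ring n)" if "y \<in> carrier (laurent_ring n)"
    using a_closed[OF assms that] m_closed[OF assms that] by simp_all
qed

lemma laurent_ring_0_1_closed [simp]: "0 \<in> carrier (laurent_ring n)" "1 \<in> carrier (laurent_ring n)"
  by (simp_all add: laurent_ring_def)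

lemma laurent_ring_Units_dvd: "u \<in> Units (laurent_ring n) \<Longrightarrow> u dvd 1"
  unfolding Units_def by (auto intro: dvdI[OF sym])

lemma laurent_ring_pfister_coeff:
  fixes u v w :: "'k::field_char_0 laurent"
  assumes "u \<in> carrier (laurent_ring n)" "v \<in> carrier (laurent_ring n)" "w \<in> carrier (laurent_ring n)"
    and "i < 8"
  shows "pfister_coeff u v w i \<in> carrier (laurent_ring n)"
  by (rule pfister_coeff_cases[OF assms(4), where P = "\<lambda>x. x \<in> carrier (laurent_ring n)"])
    (simp_all add: assms laurent_ring_closed)

lemma pfister_form_laurent_ring:
  fixes u v w :: "'k::field_char_0 laurent"
  assumes u: "u \<in> carrier (laurent_ring n)" and v: "v \<in> carrier (laurent_ring n)" and w: "w \<in> carrier (laurent_ring n)"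
    and h: "\<And>i. i < 8 \<Longrightarrow> h i \<in> carrier (laurent_ring n)"
  shows "pfister_form (laurent_ring n) u v w h = (\<Sum>i<8. pfister_coeff u v w i * (h i * h i))"
proof -
  interpret cring "laurent_ring n :: 'k laurent ring"
    by (rule cring_laurent_ring)
  have coeff: "pfister_coeff u v w i \<in> carrier (laurent_ring n)" if "i < 8" for i
    by (rule laurent_ring_pfister_coeff[OF u v w that])
  let ?l = "tensor_diagonal (laurent_ring n)
         (tensor_diagonal (laurent_ring n) [\<one>\<^bsub>laurent_ring n\<^esub>, \<ominus>\<^bsub>laurent_ring n\<^esub> u] [\<one>\<^bsub>laurent_ring n\<^esub>, \<ominus>\<^bsub>laurent_ring n\<^esub> v]) [\<one>\<^bsub>laurent_ring n\<^esub>, \<ominus>\<^bsub>laurent_ring n\<^esub> w]"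
  have l: "?l = [1, - w, - v, v * w, - u, u * w, u * v, - (u * v * w)]"
    by (simp add: tensor_diagonal_def laurent_ring_uminus u v w)
  have len: "length [1, - w, - v, v * w, - u, u * w, u * v, - (u * v * w)] = 8"
    by simp
  show ?thesis
    unfolding pfister_form_def diagonal_form_def l
    unfolding len pfister_coeff_def[symmetric] laurent_ring_simps
    by (rule laurent_ring_finsum) (use coeff h in \<open>simp_all add: laurent_ring_closed\<close>)
qed

section \<open>Octonion algebras with Pfister norm over the given ring\<close>

lemma algebra_isomorphic_if_isotope_map:
  assumes C: "unital_algebra R C" and B: "unital_algebra R B"
    and iso: "algebra_isomorphic R B (principal_isotope C a c)"
    and H: "bij_betw H (carrier C) (carrier C)"
      "\<And>x y. x \<in> carrier C \<Longrightarrow> y \<in> carrier C \<Longrightarrow> H (x \<oplus>\<^bsub>C\<^esub> y) = H x \<oplus>\<^bsub>C\<^esub> H y"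
      "\<And>r x. r \<in> carrier R \<Longrightarrow> x \<in> carrier C \<Longrightarrow> H (r \<odot>\<^bsub>C\<^esub> x) = r \<odot>\<^bsub>C\<^esub> H x"
      "\<And>x y. x \<in> carrier C \<Longrightarrow> y \<in> carrier C \<Longrightarrow> H ((x \<otimes>\<^bsub>C\<^esub> a) \<otimes>\<^bsub>C\<^esub> (c \<otimes>\<^bsub>C\<^esub> y)) = H x \<otimes>\<^bsub>C\<^esub> H y"
  shows "algebra_isomorphic R B C"
proof -
  interpret C: unital_algebra R C
    by (rule C)
  interpret B: unital_algebra R B
    by (rule B)
  obtain h where h: "h \<in> ring_iso B (principal_isotope C a c)" "h \<in> module_isos R B (principal_isotope C a c)"
    using iso unfolding algebra_isomorphic_def by blast
  have bij: "bij_betw h (carrier B) (carrier C)"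
    using h(1) by (simp add: ring_iso_def principal_isotope_def)
  have h_closed: "h x \<in> carrier C" if "x \<in> carrier B" for x
    using bij that by (rule bij_betwE[rule_format])
  have h_add: "h (x \<oplus>\<^bsub>B\<^esub> y) = h x \<oplus>\<^bsub>C\<^esub> h y" if "x \<in> carrier B" "y \<in> carrier B" for x y
    using h(1) that by (simp add: ring_iso_def ring_hom_def principal_isotope_def)
  have h_mult: "h (x \<otimes>\<^bsub>B\<^esub> y) = (h x \<otimes>\<^bsub>C\<^esub> a) \<otimes>\<^bsub>C\<^esub> (c \<otimes>\<^bsub>C\<^esub> h y)" if "x \<in> carrier B" "y \<in> carrier B" for x y
    using h(1) that by (simp add: ring_iso_def ring_hom_def principal_isotope_def)
  have h_smult: "h (r \<odot>\<^bsub>B\<^esub> x) = r \<odot>\<^bsub>C\<^esub> h x" if "r \<in> carrier R" "x \<in> carrier B" for r x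
    using h(2) that by (simp add: module_isos_def module_homs_def principal_isotope_def)
  define K where "K x = H (h x)" for x
  have K: "bij_betw K (carrier B) (carrier C)"
    using bij_betw_trans[OF bij H(1)] unfolding K_def comp_def .
  have K_closed: "K x \<in> carrier C" if "x \<in> carrier B" for x
    using K that by (rule bij_betwE[rule_format])
  have K_mult: "K (x \<otimes>\<^bsub>B\<^esub> y) = K x \<otimes>\<^bsub>C\<^esub> K y" if "x \<in> carrier B" "y \<in> carrier B" for x y
    unfolding K_def h_mult[OF that] by (rule H(4)) (use h_closed that in auto)
  have K_add: "K (x \<oplus>\<^bsub>B\<^esub> y) = K x \<oplus>\<^bsub>C\<^esub> K y" if "x \<in> carrier B" "y \<in> carrier B" for x y
    unfolding K_def h_add[OF that] by (rule H(2)) (use h_closed that in auto)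
  have K_smult: "K (r \<odot>\<^bsub>B\<^esub> x) = r \<odot>\<^bsub>C\<^esub> K x" if "r \<in> carrier R" "x \<in> carrier B" for r x
    unfolding K_def h_smult[OF that] by (rule H(3)) (use h_closed that in auto)
  \<comment> \<open>A surjective multiplicative map sends the unit to the unit, so the unit of the
    principal isotope need not be computed.\<close>
  obtain z where z: "z \<in> carrier B" "K z = \<one>\<^bsub>C\<^esub>"
    using K C.unit_closed unfolding bij_betw_def by (metis imageE)
  have "K \<one>\<^bsub>B\<^esub> = K \<one>\<^bsub>B\<^esub> \<otimes>\<^bsub>C\<^esub> K z"
    unfolding z(2) by (rule C.unit_right[symmetric]) (rule K_closed[OF B.unit_closed])
  also have "\<dots> = K (\<one>\<^bsub>B\<^esub> \<otimes>\<^bsub>B\<^esub> z)"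
    by (rule K_mult[symmetric, OF B.unit_closed z(1)])
  also have "\<dots> = \<one>\<^bsub>C\<^esub>"
    unfolding B.unit_left[OF z(1)] by (rule z(2))
  finally have K_one: "K \<one>\<^bsub>B\<^esub> = \<one>\<^bsub>C\<^esub>" .
  have "K \<in> ring_iso B C"
    using K K_closed K_mult K_add K_one by (simp add: ring_iso_def ring_hom_def)
  moreover have "K \<in> module_isos R B C"
    using K K_closed K_smult K_add by (simp add: module_isos_def module_homs_def)
  ultimately show ?thesis
    unfolding algebra_isomorphic_def by blast
qed

locale pfister_octonions =
  fixes n :: nat and C :: "('k::field_char_0 laurent, 'c, 'x) module_scheme" and q :: "'c \<Rightarrow> 'k laurent"
    and f :: "'c \<Rightarrow> nat \<Rightarrow> 'k laurent" and u v w :: "'k laurent"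
  assumes octonion: "octonion_algebra (laurent_ring n) C q"
    and f: "f \<in> module_isos (laurent_ring n) C (free_module (laurent_ring n) 8)"
    and norm: "x \<in> carrier C \<Longrightarrow> pfister_form (laurent_ring n) u v w (f x) = q x"
    and units: "u \<in> Units (laurent_ring n)" "v \<in> Units (laurent_ring n)" "w \<in> Units (laurent_ring n)"
begin

sublocale unital_algebra "laurent_ring n" C
  using octonion by (simp add: octonion_algebra_def)

text \<open>Coordinates in \<open>free_module\<close> are numbered by naturals, while vectors are
  indexed by a type; any bijection will do.\<close>

definition idx :: "8 \<Rightarrow> nat" where
  "idx = (SOME h. bij_betw h UNIV {..<8})"

lemma idx: "bij_betw idx UNIV {..<8}"
proof -
  have "\<exists>h. bij_betw h (UNIV :: 8 set) {..<8::nat}"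
    by (rule finite_same_card_bij) simp_all
  then show ?thesis
    unfolding idx_def by (rule someI_ex)
qed

lemma idx_less [simp]: "idx i < 8"
  using bij_betwE[OF idx] by simp

definition coords :: "'c \<Rightarrow> 'k laurent^8" where
  "coords x = (\<chi> i. f x (idx i))"

definition vecs :: "('k laurent^8) set" where
  "vecs = {v. \<forall>i. v $ i \<in> carrier (laurent_ring n)}"

definition coeff :: "8 \<Rightarrow> 'k laurent" where
  "coeff i = pfister_coeff u v w (idx i)"

lemma f_closed: "x \<in> carrier C \<Longrightarrow> f x \<in> {..<8} \<rightarrow>\<^sub>E carrier (laurent_ring n)"
  using f by (auto simp: module_isos_def module_homs_def free_module_def)

lemma coords_add: "x \<in> carrier C \<Longrightarrow> y \<in> carrier C \<Longrightarrow> coords (x \<oplus>\<^bsub>C\<^esub> y) = coords x + coords y"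
  using f by (simp add: coords_def vec_eq_iff module_isos_def module_homs_def free_module_def)

lemma coords_smult: "r \<in> carrier (laurent_ring n) \<Longrightarrow> x \<in> carrier C \<Longrightarrow> coords (r \<odot>\<^bsub>C\<^esub> x) = r *s coords x"
  using f by (simp add: coords_def vec_eq_iff module_isos_def module_homs_def free_module_def)

lemma coords_bij: "bij_betw coords (carrier C) vecs"
proof -
  have "bij_betw f (carrier C) ({..<8} \<rightarrow>\<^sub>E carrier (laurent_ring n))"
    using f by (simp add: module_isos_def free_module_def)
  moreover have "bij_betw (\<lambda>h. \<chi> i. h (idx i)) ({..<8} \<rightarrow>\<^sub>E carrier (laurent_ring n)) vecs"
  proof (rule bij_betw_byWitness[of _ "\<lambda>v. \<lambda>k\<in>{..<8}. v $ inv_into UNIV idx k"])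
    have right: "idx (inv_into UNIV idx k) = k" if "k < 8" for k
      using bij_betw_inv_into_right[OF idx] that by simp
    have left: "inv_into UNIV idx (idx i) = i" for i
      using bij_betw_inv_into_left[OF idx] by simp
    show "\<forall>h \<in> {..<8} \<rightarrow>\<^sub>E carrier (laurent_ring n). (\<lambda>k\<in>{..<8}. (\<chi> i. h (idx i)) $ inv_into UNIV idx k) = h"
      by (auto simp: right fun_eq_iff restrict_def PiE_def extensional_def)
    show "\<forall>v \<in> vecs. (\<chi> i. (\<lambda>k\<in>{..<8}. v $ inv_into UNIV idx k) (idx i)) = v"
      by (simp add: vec_eq_iff left)
    show "(\<lambda>h. \<chi> i. h (idx i)) ` ({..<8} \<rightarrow>\<^sub>E carrier (laurent_ring n)) \<subseteq> vecs"
      by (auto simp: vecs_def PiE_def Pi_def)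
    show "(\<lambda>v. \<lambda>k\<in>{..<8}. v $ inv_into UNIV idx k) ` vecs \<subseteq> {..<8} \<rightarrow>\<^sub>E carrier (laurent_ring n)"
      by (auto simp: vecs_def split: if_splits)
  qed
  moreover have "coords = (\<lambda>h. \<chi> i. h (idx i)) \<circ> f"
    by (simp add: fun_eq_iff coords_def)
  ultimately show ?thesis
    by (simp only: bij_betw_trans)
qed

lemma coords_closed: "x \<in> carrier C \<Longrightarrow> coords x \<in> vecs"
  using coords_bij by (auto simp: bij_betw_def)

lemma vecs_coords: "z \<in> vecs \<Longrightarrow> \<exists>x \<in> carrier C. z = coords x"
  using coords_bij by (auto simp: bij_betw_def)

definition vec_mult :: "'k laurent^8 \<Rightarrow> 'k laurent^8 \<Rightarrow> 'k laurent^8" where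
  "vec_mult y z = coords (inv_into (carrier C) coords y \<otimes>\<^bsub>C\<^esub> inv_into (carrier C) coords z)"

lemma vec_mult_coords:
  "x \<in> carrier C \<Longrightarrow> y \<in> carrier C \<Longrightarrow> vec_mult (coords x) (coords y) = coords (x \<otimes>\<^bsub>C\<^esub> y)"
  by (simp add: vec_mult_def bij_betw_inv_into_left[OF coords_bij])

lemma norm_coords:
  assumes "x \<in> carrier C"
  shows "(\<Sum>i\<in>UNIV. coeff i * (coords x $ i * coords x $ i)) = q x"
proof -
  have "(\<Sum>i\<in>UNIV. coeff i * (coords x $ i * coords x $ i)) = (\<Sum>k<8. pfister_coeff u v w k * (f x k * f x k))"
    unfolding coeff_def coords_def
    using sum.reindex_bij_betw[OF idx, of "\<lambda>k. pfister_coeff u v w k * (f x k * f x k)"] by simp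
  also have "\<dots> = pfister_form (laurent_ring n) u v w (f x)"
    using units f_closed[OF assms] by (intro pfister_form_laurent_ring[symmetric]) (auto simp: Units_def)
  finally show ?thesis
    by (simp add: norm assms)
qed

lemma q_mult: "x \<in> carrier C \<Longrightarrow> y \<in> carrier C \<Longrightarrow> q (x \<otimes>\<^bsub>C\<^esub> y) = q x * q y"
  using octonion by (simp add: octonion_algebra_def)

sublocale coords: coordinate_composition_algebra "carrier (laurent_ring n)" vec_mult "coords \<one>\<^bsub>C\<^esub>" coeff vecs
proof -
  show "coordinate_composition_algebra (carrier (laurent_ring n)) vec_mult (coords \<one>\<^bsub>C\<^esub>) coeff"
  proof (unfold_locales, unfold vecs_def[symmetric])
    have "(2 :: 'k laurent) * Poly_Mapping.single 0 (1 / 2) = 1"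
      by (simp add: two_single)
    then show "(2 :: 'k laurent) dvd 1"
      by (metis dvd_triv_left)
    show "coeff i dvd 1" for i
      unfolding coeff_def by (rule pfister_coeff_unit) (use units laurent_ring_Units_dvd in auto)
    obtain i where "idx i = 0"
      using bij_betw_imp_surj_on[OF idx] by (metis imageE lessThan_iff zero_less_numeral)
    then show "\<exists>i. coeff i = 1"
      unfolding coeff_def by (intro exI[of _ i]) (simp add: pfister_coeff_def)
    fix y z :: "'k laurent^8" assume y: "y \<in> vecs" and z: "z \<in> vecs"
    obtain x x' where x: "x \<in> carrier C" "x' \<in> carrier C" "y = coords x" "z = coords x'"
      using vecs_coords[OF y] vecs_coords[OF z] by blast
    show "vec_mult y z \<in> vecs"
      unfolding x(3,4) by (simp add: x vec_mult_coords coords_closed mult_closed)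
    show "(\<Sum>i\<in>UNIV. coeff i * (vec_mult y z $ i * vec_mult y z $ i))
      = (\<Sum>i\<in>UNIV. coeff i * (y $ i * y $ i)) * (\<Sum>i\<in>UNIV. coeff i * (z $ i * z $ i))"
      unfolding x(3,4) by (simp add: x vec_mult_coords norm_coords mult_closed q_mult)
    show "vec_mult (coords \<one>\<^bsub>C\<^esub>) y = y" "vec_mult y (coords \<one>\<^bsub>C\<^esub>) = y"
      unfolding x(3) by (simp_all add: x vec_mult_coords unit_closed unit_left unit_right)
    show "vec_mult (r *s y) z = r *s vec_mult y z" "vec_mult y (r *s z) = r *s vec_mult y z"
      if "r \<in> carrier (laurent_ring n)" for r
      unfolding x(3,4) by (simp_all add: x that vec_mult_coords mult_closed mult_smult_left mult_smult_right
          flip: coords_smult)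
    fix z' :: "'k laurent^8" assume z': "z' \<in> vecs"
    obtain x'' where x'': "x'' \<in> carrier C" "z' = coords x''"
      using vecs_coords[OF z'] by blast
    show "vec_mult (y + z) z' = vec_mult y z' + vec_mult z z'" "vec_mult y (z + z') = vec_mult y z + vec_mult y z'"
      unfolding x(3,4) x''(2) by (simp_all add: x x'' vec_mult_coords mult_closed mult_add_left mult_add_right
          flip: coords_add)
  next
    show "coords \<one>\<^bsub>C\<^esub> \<in> vecs"
      by (rule coords_closed[OF unit_closed])
  qed (simp_all add: laurent_ring_closed)
  show "vecs \<equiv> {v. \<forall>i. v $ i \<in> carrier (laurent_ring n)}"
    by (rule eq_reflection) (rule vecs_def)
qed

text \<open>The isomorphism over all variables goes from the algebra to its isotope; descent follows
  its inverse by the retraction, which accounts for the direction of \<open>H\<close>.\<close>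

lemma isotope_map:
  assumes a: "a \<in> Units C" and c: "c \<in> Units C"
  obtains H where "bij_betw H (carrier C) (carrier C)"
    "\<And>x y. x \<in> carrier C \<Longrightarrow> y \<in> carrier C \<Longrightarrow> H (x \<oplus>\<^bsub>C\<^esub> y) = H x \<oplus>\<^bsub>C\<^esub> H y"
    "\<And>r x. r \<in> carrier (laurent_ring n) \<Longrightarrow> x \<in> carrier C \<Longrightarrow> H (r \<odot>\<^bsub>C\<^esub> x) = r \<odot>\<^bsub>C\<^esub> H x"
    "\<And>x y. x \<in> carrier C \<Longrightarrow> y \<in> carrier C \<Longrightarrow>
      H ((x \<otimes>\<^bsub>C\<^esub> a) \<otimes>\<^bsub>C\<^esub> (c \<otimes>\<^bsub>C\<^esub> y)) = H x \<otimes>\<^bsub>C\<^esub> H y"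
proof -
  note result = that
  have Q: "coords.q (coords x) = q x" if "x \<in> carrier C" for x
    unfolding coords.q_def by (rule norm_coords[OF that])
  obtain a' c' where a': "a \<in> carrier C" "a' \<in> carrier C" "a \<otimes>\<^bsub>C\<^esub> a' = \<one>\<^bsub>C\<^esub>"
    and c': "c \<in> carrier C" "c' \<in> carrier C" "c \<otimes>\<^bsub>C\<^esub> c' = \<one>\<^bsub>C\<^esub>"
    using a c unfolding Units_def by blast
  have "q a * q a' = 1" "q c * q c' = 1"
    using q_mult[of a a'] q_mult[of c c'] a' c' coords.q_unit Q[OF unit_closed] by simp_all
  then have k: "coords.q (coords a) * coords.q (coords c) * (q a' * q c') = 1"
    using Q[OF a'(1)] Q[OF c'(1)] by (metis mult.assoc mult.left_commute mult_1_right)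
  define g where "g k = (axis (inv_into UNIV idx k) 1 :: 'k laurent^8)" for k
  have idx_inv: "idx (inv_into UNIV idx k) = k" if "k < 8" for k
    using bij_betw_inv_into_right[OF idx] that by simp
  have dep: "composition_algebra.dependent9 ((*s) :: 'k laurent \<Rightarrow> 'k laurent^8 \<Rightarrow> _)"
    unfolding composition_algebra.dependent9_def[OF coords.composition_algebra]
  proof
    fix z :: "nat \<Rightarrow> 'k laurent^8"
    have "\<exists>c. (\<exists>i\<in>{..<9}. c i \<noteq> 0) \<and> (\<forall>r\<in>UNIV. (\<Sum>i\<in>{..<9}. c i * z i $ r) = 0)"
      by (rule linear_system_nontrivial_solution) simp_all
    then show "\<exists>c. (\<exists>i<9. c i \<noteq> 0) \<and> (\<Sum>i<9. c i *s z i) = 0"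
      by (auto simp: vec_eq_iff)
  qed
  obtain T where T: "bij T" "\<And>x y. T (x + y) = T x + T y" "\<And>r x. T (r *s x) = r *s T x"
    "\<And>x y. T (coords.mult x y) = coords.mult (coords.mult (T x) (coords a)) (coords.mult (coords c) (T y))"
  proof (rule laurent_pfister_isotope_isomorphic[OF coords.composition_algebra dep _ _ _ _ _ k])
    show "u dvd 1" "v dvd 1" "w dvd 1"
      using units laurent_ring_Units_dvd by auto
    show "coords.q (g k) = pfister_coeff u v w k" if "k < 8" for k
      unfolding g_def coords.q_axis coeff_def idx_inv[OF that] ..
    show "coords.q (g i + g j) - coords.q (g i) - coords.q (g j) = 0" if "i < 8" "j < 8" "i \<noteq> j" for i j
    proof -
      have "inv_into UNIV idx i \<noteq> inv_into UNIV idx j"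
        using idx_inv that by metis
      then show ?thesis
        by (simp add: coords.q_add g_def coords.b_axis) (simp add: axis_def)
    qed
  qed (rule that)
  obtain G where G: "bij_betw G vecs vecs" "\<And>x y. G (x + y) = G x + G y"
    "\<And>r x. r \<in> carrier (laurent_ring n) \<Longrightarrow> G (r *s x) = r *s G x"
    "\<And>x y. x \<in> vecs \<Longrightarrow> y \<in> vecs \<Longrightarrow>
      G (vec_mult (vec_mult x (coords a)) (vec_mult (coords c) y)) = vec_mult (G x) (G y)"
    proof (rule coords.descent[where \<rho> = "push (restrict_exponent n)", OF push_add push_mult[OF restrict_exponent_add]
          push_restrict_exponent_closed push_restrict_exponent_id T coords_closed[OF a'(1)] coords_closed[OF c'(1)]])
    qed (assumption, rule that)
  define H where "H x = inv_into (carrier C) coords (G (coords x))" for x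
  have coords_H: "coords (H x) = G (coords x)" if "x \<in> carrier C" for x
    unfolding H_def by (rule bij_betw_inv_into_right[OF coords_bij]) (use bij_betwE[OF G(1)] coords_closed[OF that] in blast)
  have H: "bij_betw H (carrier C) (carrier C)"
    using bij_betw_trans[OF bij_betw_trans[OF coords_bij G(1)] bij_betw_inv_into[OF coords_bij]]
    unfolding H_def comp_def .
  have H_closed: "H x \<in> carrier C" if "x \<in> carrier C" for x
    using H that by (rule bij_betwE[rule_format])
  have eqI: "x = y" if "coords x = coords y" "x \<in> carrier C" "y \<in> carrier C" for x y
    using coords_bij that unfolding bij_betw_def inj_on_def by blast
  show ?thesis
  proof (rule result[OF H])
    fix x y assume x: "x \<in> carrier C" and y: "y \<in> carrier C"
    show "H (x \<oplus>\<^bsub>C\<^esub> y) = H x \<oplus>\<^bsub>C\<^esub> H y"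
      by (rule eqI) (simp_all add: x y H_closed coords_H coords_add G(2))
    show "H (r \<odot>\<^bsub>C\<^esub> x) = r \<odot>\<^bsub>C\<^esub> H x" if "r \<in> carrier (laurent_ring n)" for r
      by (rule eqI) (simp_all add: that x H_closed coords_H coords_smult G(3))
    show "H ((x \<otimes>\<^bsub>C\<^esub> a) \<otimes>\<^bsub>C\<^esub> (c \<otimes>\<^bsub>C\<^esub> y)) = H x \<otimes>\<^bsub>C\<^esub> H y"
      using G(4)[OF coords_closed[OF x] coords_closed[OF y]]
      by (intro eqI) (simp_all add: x y a' c' H_closed coords_H mult_closed vec_mult_coords flip: coords_H)
  qed
qed

end

theorem proposition7p12:
  fixes n :: nat
    and R :: "'k::field_char_0 laurent ring"
    and C :: "('k laurent, 'c, 'x) module_scheme"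
    and q :: "'c \<Rightarrow> 'k laurent"
    and B :: "('k laurent, 'd, 'y) module_scheme"
  assumes "R = laurent_ring n"
    and "octonion_algebra R C q"
    and "isometric_to_pfister R C q"
    and "isotope R C B"
  shows "algebra_isomorphic R B C"
proof -
  obtain u v w f where "u \<in> Units R" "v \<in> Units R" "w \<in> Units R" "f \<in> module_isos R C (free_module R 8)"
    "\<And>x. x \<in> carrier C \<Longrightarrow> pfister_form R u v w (f x) = q x"
    using assms(3) unfolding isometric_to_pfister_def isometric_def by blast
  then interpret pfister_octonions n C q f u v w
    using assms(1,2) by unfold_locales auto
  obtain a c where a: "a \<in> Units C" and c: "c \<in> Units C" and B: "unital_algebra R B"
    and iso: "algebra_isomorphic R B (principal_isotope C a c)"
    using assms(4) unfolding isotope_def by blast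
  obtain H where "bij_betw H (carrier C) (carrier C)"
    "\<And>x y. x \<in> carrier C \<Longrightarrow> y \<in> carrier C \<Longrightarrow> H (x \<oplus>\<^bsub>C\<^esub> y) = H x \<oplus>\<^bsub>C\<^esub> H y"
    "\<And>r x. r \<in> carrier R \<Longrightarrow> x \<in> carrier C \<Longrightarrow> H (r \<odot>\<^bsub>C\<^esub> x) = r \<odot>\<^bsub>C\<^esub> H x"
    "\<And>x y. x \<in> carrier C \<Longrightarrow> y \<in> carrier C \<Longrightarrow>
      H ((x \<otimes>\<^bsub>C\<^esub> a) \<otimes>\<^bsub>C\<^esub> (c \<otimes>\<^bsub>C\<^esub> y)) = H x \<otimes>\<^bsub>C\<^esub> H y"
    proof (rule isotope_map[OF a c, folded assms(1)])
    qed (rule that)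
  then show ?thesis
    by (rule algebra_isomorphic_if_isotope_map[OF unital_algebra_axioms[folded assms(1)] B iso])
qed

end
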